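(* Let $\alpha>0$ and let $(N,C_1,\dots,C_N)$ be a random vector, where $N\in\{0,1,2,\dots\}\cup\{\infty\}$ and the $C_i$ are real valued. Suppose that there exists $j\ge 1$ with $P(N\ge j,|C_j|>0)>0$ such that the measure $P(\log|C_j|\in du,\ |C_j|>0,\ N\ge j)$ is nonlattice. Assume further that $E\left[\sum_{j=1}^N|C_j|^\alpha\log|C_j|\right]>0$, $E\left[\sum_{j=1}^N|C_j|^\alpha\right]=1$, $E\left[\sum_{j=1}^N|C_j|^\gamma\right]<\infty$ for some $0\le\gamma<\alpha$, and that $R$ is a real valued random variable independent of $(N,C_1,\dots,C_N)$. Consider the two conditions $$(+)\qquad \int_0^\infty\left|P(R>t)-E\left[\sum_{j=1}^N 1(C_jR>t)\right]\right|t^{\alpha-1}\,dt<\infty,$$ $$(-)\qquad \int_0^\infty\left|P(R<-t)-E\left[\sum_{j=1}^N 1(C_jR<-t)\right]\right|t^{\alpha-1}\,dt<\infty,$$ and the quantities $$H_\pm=\frac{1}{E\left[\sum_{j=1}^N|C_j|^\alpha\log|C_j|\right]}\int_0^\infty v^{\alpha-1}\left(P((\pm1)R>v)-E\left[\sum_{j=1}^N1((\pm1)C_jR>v)\right]\right)dv.$$ (a) Suppose $\{C_i\}\ge 0$ a.s. If $E[(R^+)^\beta]<\infty$ for any $0<\beta<\alpha$ and $(+)$ holds, then $P(R>t)\sim H_+t^{-\alpha}$ as $t\to\infty$, with $0\le H_+<\infty$. Respectively, if $E[(R^-)^\beta]<\infty$ for any $0<\beta<\alpha$ and $(-)$ holds,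 then $P(R<-t)\sim H_-t^{-\alpha}$ as $t\to\infty$, with $0\le H_-<\infty$. (b) If $P(C_j<0)>0$ for some $j\ge1$, $E[|R|^\beta]<\infty$ for any $0<\beta<\alpha$, and both $(+)$ and $(-)$ hold, then $$P(R>t)\sim P(R<-t)\sim Ht^{-\alpha},\qquad t\to\infty,$$ where $0\le H=(H_++H_-)/2<\infty$ is given by $$H=\frac{1}{2E\left[\sum_{j=1}^N|C_j|^\alpha\log|C_j|\right]}\int_0^\infty v^{\alpha-1}\left(P(|R|>v)-E\left[\sum_{j=1}^N1(|C_jR|>v)\right]\right)dv.$$
   Context: Conventions: $x^+=\max(x,0)$, $x^-=\max(-x,0)$; $1(\cdot)$ is the indicator; $0^\alpha\log 0=0$ for $\alpha>0$. Sums $\sum_{j=1}^N$ run over all finite integers $j$ with $1\le j\le N$ (so over all $j\ge1$ if $N=\infty$); the components of the vector are dependent in an arbitrary way. Statements about $C_j$ such as $P(C_j<0)$ refer to the event on which $C_j$ is present, i.e. $\{N\ge j,\ C_j<0\}$; "$\{C_i\}\ge0$ a.s." means that almost surely $C_i\ge0$ for all $i\le N$. A distribution (finite measure) on $\mathbb{R}$ is lattice if it is concentrated on a set of points of the form $a+j\lambda$, $j\in\mathbb{Z}$, for some constants $a\in\mathbb{R}$, $\lambda>0$; otherwise it is nonlattice. The expectation $E[\sum_{j=1}^N|C_j|^\alpha\log|C_j|]$ is allowed to be $+\infty$, in which case $H_\pm$ and $H$ are $0$. The relation $f(t)\sim Ht^{-\alpha}$ means $t^{\alpha}f(t)\to H$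 as $t\to\infty$ (in particular, if $H=0$, $f(t)=o(t^{-\alpha})$). *)

theory Defs
  imports "HOL-Probability.Probability"
begin

definition sum_upto :: "enat \<Rightarrow> (nat \<Rightarrow> 'b::{topological_space,comm_monoid_add}) \<Rightarrow> 'b" where
  "sum_upto n f = (\<Sum>j. if 1 \<le> j \<and> enat j \<le> n then f j else 0)"

text \<open>
  Only the components \<open>C\<^sub>j\<close> with \<open>1 \<le> j \<le> N\<close> are part of the vector. Padding the absent ones by 0
  yields a map into a fixed product space that generates the same sigma-algebra as
  \<open>(N, C\<^sub>1, \<dots>, C\<^sub>N)\<close>, because \<open>N\<close> itself is recorded; the values of \<open>C j\<close> off \<open>{N \<ge> j}\<close> are irrelevant.
\<close>
definition weight_space :: "(enat \<times> (nat \<Rightarrow> real)) measure" where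
  "weight_space = count_space UNIV \<Otimes>\<^sub>M (\<Pi>\<^sub>M j\<in>{1..}. borel)"

definition weight_vector :: "('a \<Rightarrow> enat) \<Rightarrow> (nat \<Rightarrow> 'a \<Rightarrow> real) \<Rightarrow> 'a \<Rightarrow> enat \<times> (nat \<Rightarrow> real)" where
  "weight_vector N C \<omega> = (N \<omega>, \<lambda>j\<in>{1..}. if enat j \<le> N \<omega> then C j \<omega> else 0)"

text \<open>
  Stated through the generated sigma-algebras because the library's \<open>indep_var\<close> requires both
  variables to have the same value type.
\<close>
definition indep_of_weights ::
  "'a measure \<Rightarrow> ('a \<Rightarrow> enat) \<Rightarrow> (nat \<Rightarrow> 'a \<Rightarrow> real) \<Rightarrow> ('a \<Rightarrow> real) \<Rightarrow> bool" where
  "indep_of_weights M N C R \<longleftrightarrow>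
     prob_space.indep_set M
       {R -` A \<inter> space M | A. A \<in> sets borel}
       {weight_vector N C -` B \<inter> space M | B. B \<in> sets weight_space}"

definition lattice_measure :: "real measure \<Rightarrow> bool" where
  "lattice_measure \<mu> \<longleftrightarrow> (\<exists>a d. d > 0 \<and> (AE u in \<mu>. \<exists>k::int. u = a + of_int k * d))"

text \<open>The finite measure \<open>P(log |C\<^sub>j| \<in> du, |C\<^sub>j| > 0, N \<ge> j)\<close>, of total mass at most 1.\<close>
definition log_weight_measure ::
  "'a measure \<Rightarrow> ('a \<Rightarrow> enat) \<Rightarrow> (nat \<Rightarrow> 'a \<Rightarrow> real) \<Rightarrow> nat \<Rightarrow> real measure" where
  "log_weight_measure M N C j =
     distr (restrict_space M {\<omega> \<in> space M. enat j \<le> N \<omega> \<and> \<bar>C j \<omega>\<bar> > 0}) borel (\<lambda>\<omega>. ln \<bar>C j \<omega>\<bar>)"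

text \<open>The usual convention \<open>0\<^sup>0 = 1\<close>, whereas \<open>0 powr 0 = 0\<close>.\<close>
definition abs_pow :: "real \<Rightarrow> real \<Rightarrow> real" where
  "abs_pow x g = (if g = 0 then 1 else \<bar>x\<bar> powr g)"

definition weight_moment ::
  "'a measure \<Rightarrow> ('a \<Rightarrow> enat) \<Rightarrow> (nat \<Rightarrow> 'a \<Rightarrow> real) \<Rightarrow> real \<Rightarrow> ennreal" where
  "weight_moment M N C g = (\<integral>\<^sup>+\<omega>. sum_upto (N \<omega>) (\<lambda>j. ennreal (abs_pow (C j \<omega>) g)) \<partial>M)"

text \<open>
  Integral of an extended real function as the integral of its positive part (\<open>e2ennreal\<close> maps
  negative values to 0) minus that of its negative part; meaningful if at least one is finite.
\<close>
definition ext_integral :: "'a measure \<Rightarrow> ('a \<Rightarrow> ereal) \<Rightarrow> ereal" where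
  "ext_integral M f =
     enn2ereal (\<integral>\<^sup>+x. e2ennreal (f x) \<partial>M) - enn2ereal (\<integral>\<^sup>+x. e2ennreal (- f x) \<partial>M)"

text \<open>
  \<open>E[\<Sum> |C\<^sub>j|\<^sup>\<alpha> log |C\<^sub>j|]\<close>, possibly infinite; a vanishing \<open>C\<^sub>j\<close> contributes 0 as \<open>0 powr \<alpha> = 0\<close>.
  If \<open>weight_moment M N C \<gamma> < \<infinity>\<close> for some \<open>\<gamma> < \<alpha>\<close>, the negative terms have finite total
  expectation, so the series converges almost surely in \<open>(-\<infinity>, \<infinity>]\<close>.
\<close>
definition log_moment ::
  "'a measure \<Rightarrow> ('a \<Rightarrow> enat) \<Rightarrow> (nat \<Rightarrow> 'a \<Rightarrow> real) \<Rightarrow> real \<Rightarrow> ereal" where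
  "log_moment M N C \<alpha> =
     ext_integral M (\<lambda>\<omega>. sum_upto (N \<omega>) (\<lambda>j. ereal (\<bar>C j \<omega>\<bar> powr \<alpha> * ln \<bar>C j \<omega>\<bar>)))"

text \<open>\<open>P(X > t) - E[\<Sum> 1(Y\<^sub>j > t)]\<close>, where the expectation may be infinite.\<close>
definition tail_diff ::
  "'a measure \<Rightarrow> ('a \<Rightarrow> enat) \<Rightarrow> ('a \<Rightarrow> real) \<Rightarrow> (nat \<Rightarrow> 'a \<Rightarrow> real) \<Rightarrow> real \<Rightarrow> ereal" where
  "tail_diff M N X Y t =
     ereal (measure M {\<omega> \<in> space M. X \<omega> > t})
     - enn2ereal (\<integral>\<^sup>+\<omega>. sum_upto (N \<omega>) (\<lambda>j. if Y j \<omega> > t then 1 else 0) \<partial>M)"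

definition tail_diff_integrable ::
  "'a measure \<Rightarrow> real \<Rightarrow> ('a \<Rightarrow> enat) \<Rightarrow> ('a \<Rightarrow> real) \<Rightarrow> (nat \<Rightarrow> 'a \<Rightarrow> real) \<Rightarrow> bool" where
  "tail_diff_integrable M \<alpha> N X Y \<longleftrightarrow>
     (\<integral>\<^sup>+t\<in>{0<..}. e2ennreal (\<bar>tail_diff M N X Y t\<bar> * ereal (t powr (\<alpha> - 1))) \<partial>lborel) < \<infinity>"

definition tail_diff_integral ::
  "'a measure \<Rightarrow> real \<Rightarrow> ('a \<Rightarrow> enat) \<Rightarrow> ('a \<Rightarrow> real) \<Rightarrow> (nat \<Rightarrow> 'a \<Rightarrow> real) \<Rightarrow> ereal" where
  "tail_diff_integral M \<alpha> N X Y =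
     ext_integral (restrict_space lborel {0<..})
       (\<lambda>v. ereal (v powr (\<alpha> - 1)) * tail_diff M N X Y v)"

text \<open>
  The constants \<open>H\<^sub>+\<close> and \<open>H\<^sub>-\<close>, for \<open>s = 1\<close> and \<open>s = - 1\<close>. In \<open>ereal\<close>, \<open>1 / \<infinity> = 0\<close> and
  \<open>0 * x = 0\<close>, so they vanish if the logarithmic moment is infinite.
\<close>
definition H_const ::
  "'a measure \<Rightarrow> real \<Rightarrow> ('a \<Rightarrow> enat) \<Rightarrow> (nat \<Rightarrow> 'a \<Rightarrow> real) \<Rightarrow> ('a \<Rightarrow> real) \<Rightarrow> real \<Rightarrow> ereal" where
  "H_const M \<alpha> N C R s =
     1 / log_moment M N C \<alpha> *
     tail_diff_integral M \<alpha> N (\<lambda>\<omega>. s * R \<omega>) (\<lambda>j \<omega>. s * C j \<omega> * R \<omega>)"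

definition H_abs ::
  "'a measure \<Rightarrow> real \<Rightarrow> ('a \<Rightarrow> enat) \<Rightarrow> (nat \<Rightarrow> 'a \<Rightarrow> real) \<Rightarrow> ('a \<Rightarrow> real) \<Rightarrow> ereal" where
  "H_abs M \<alpha> N C R =
     1 / (2 * log_moment M N C \<alpha>) *
     tail_diff_integral M \<alpha> N (\<lambda>\<omega>. \<bar>R \<omega>\<bar>) (\<lambda>j \<omega>. \<bar>C j \<omega> * R \<omega>\<bar>)"

text \<open>\<open>f(t) \<sim> H t\<^sup>-\<^sup>\<alpha>\<close> in the sense that also covers \<open>H = 0\<close>, where it says \<open>f(t) = o(t\<^sup>-\<^sup>\<alpha>)\<close>.\<close>
definition power_tail :: "(real \<Rightarrow> real) \<Rightarrow> ereal \<Rightarrow> real \<Rightarrow> bool" where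
  "power_tail f H \<alpha> \<longleftrightarrow> ((\<lambda>t. ereal (t powr \<alpha> * f t)) \<longlongrightarrow> H) at_top"

end

theory Submission
  imports Defs "HOL-Real_Asymp.Real_Asymp"
begin

text \<open>
  Put \<open>r\<^sub>s u = exp (\<alpha> u) P(s R > exp u)\<close> for \<open>s = \<plusminus>1\<close>. Let \<open>X\<close> and \<open>S\<close> be the logarithm of the modulus and
  the sign of a weight that is selected with density \<open>\<bar>C\<^sub>j\<bar>\<^sup>\<alpha>\<close>; since \<open>E[\<Sum> \<bar>C\<^sub>j\<bar>\<^sup>\<alpha>] = 1\<close>, this is a probability
  law. By independence of \<open>R\<close> and the weights, \<open>exp (\<alpha> u) E[\<Sum> 1(s C\<^sub>j R > exp u)]\<close> is the mean of
  \<open>r\<^sub>s\<^sub>S (u - X)\<close> (\<open>exceedances_weighted_tail\<close>). So the tails solve a renewal equation on the whole line,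
  \<open>r\<^sub>s u = g\<^sub>s u + E r\<^sub>s\<^sub>S (u - X)\<close>, in which conditions \<open>(\<plusminus>)\<close> say that \<open>g\<^sub>s\<close> is integrable, \<open>E X\<close> is the
  logarithmic moment, which lies in \<open>(0, \<infinity>]\<close>, and the moments of \<open>R\<close> give \<open>r\<^sub>s u = O(exp (\<epsilon> u))\<close> for every
  small \<open>\<epsilon> > 0\<close>. The claim is that \<open>r\<^sub>s\<close> converges to \<open>\<integral>g\<^sub>s / E X\<close> if \<open>S = 1\<close>, and to the mean of the two
  such values if \<open>S = -1\<close> has positive probability.

  For \<open>S = 1\<close> four observations suffice (\<open>renewal_limit\<close>).

  \<^item> The averages \<open>z\<close> of \<open>r\<close> over windows of fixed length are bounded. The bound compares \<open>r\<close> with the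
    renewal series, which converges under an exponential weight, because \<open>E X > 0\<close> makes the Laplace
    transform of \<open>X\<close> smaller than 1 near 0 (\<open>nonneg_window_bounded\<close>, \<open>ex_exponent\<close>).

  \<^item> \<open>z\<close> is Lipschitz and \<open>z t - E z (t - X)\<close> tends to 0. An argument in the spirit of Choquet and Deny
    shows that \<open>z t - z (t - x)\<close> tends to 0 for all \<open>x\<close>, because the points of the support of \<open>X\<close> generate a
    dense subgroup (\<open>asymptotic_translation_invariance\<close>).

  \<^item> Integrating the equation for \<open>z\<close> over \<open>(-\<infinity>, t]\<close> shows that the mean of \<open>\<integral>z\<close> over the interval from
    \<open>t - X\<close> to \<open>t\<close> converges to the integral of the averaged \<open>g\<close>. By translation invariance this mean is
    close to \<open>z t * E X\<close>, which identifies the limit of \<open>z\<close> (\<open>invariant_solution_limit\<close>).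

  \<^item> \<open>exp (- \<alpha> t) r t\<close> decreases, so \<open>r\<close> itself converges (\<open>tauberian_window\<close>).

  If both signs occur, \<open>r\<^sub>1 + r\<^sub>-\<^sub>1\<close> is covered by the case just treated. The difference \<open>y = r\<^sub>1 - r\<^sub>-\<^sub>1\<close> solves
  \<open>y u = g u + E[S y (u - X)]\<close> with \<open>g = g\<^sub>1 - g\<^sub>-\<^sub>1\<close>, and the second observation, with signs, shows that its
  averages are both invariant under translations and asymptotically equal to their own negatives. They
  vanish at infinity, and the two tails share the limit of the sum equally (\<open>signed_renewal_limit\<close>).
\<close>


section \<open>Closed subgroups of the real line\<close>

lemma closed_subgroup_int_multiple:
  fixes T :: "real set"
  assumes "closed T" "0 \<in> T" and minus: "\<And>x y. x \<in> T \<Longrightarrow> y \<in> T \<Longrightarrow> x - y \<in> T"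
  assumes x: "x \<in> T"
  shows "of_int k * x \<in> T"
proof -
  have neg: "- y \<in> T" if "y \<in> T" for y using minus[OF \<open>0 \<in> T\<close> that] by simp
  have nat: "of_nat n * x \<in> T" for n
  proof (induction n)
    case 0
    then show ?case using \<open>0 \<in> T\<close> by simp
  next
    case (Suc n)
    have "of_nat n * x - (- x) \<in> T" by (intro minus Suc neg x)
    then show ?case by (simp add: algebra_simps)
  qed
  show ?thesis
    by (cases k) (use nat neg[OF nat] in \<open>auto simp del: of_nat_Suc\<close>)
qed

text \<open>A subgroup with arbitrarily small positive elements is dense; otherwise its least positive element
  exists by closedness and generates it.\<close>
lemma closed_subgroup_real_cases:
  fixes T :: "real set"
  assumes "closed T" "0 \<in> T" and minus: "\<And>x y. x \<in> T \<Longrightarrow> y \<in> T \<Longrightarrow> x - y \<in> T"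
  obtains "T = UNIV" | d where "d > 0" "\<And>x. x \<in> T \<Longrightarrow> \<exists>k::int. x = of_int k * d"
proof (cases "\<forall>e>0. \<exists>x\<in>T. 0 < x \<and> x < e")
  case True
  have "y \<in> closure T" for y
  proof (subst closure_approachable, intro allI impI)
    fix e :: real assume "e > 0"
    with True obtain x where x: "x \<in> T" "0 < x" "x < e" by blast
    have "of_int \<lfloor>y / x\<rfloor> * x \<in> T" by (rule closed_subgroup_int_multiple[OF assms x(1)])
    moreover have "dist (of_int \<lfloor>y / x\<rfloor> * x) y < e"
    proof -
      have "of_int \<lfloor>y / x\<rfloor> * x \<le> y" "y < of_int \<lfloor>y / x\<rfloor> * x + x"
        using floor_divide_lower[OF x(2), of y] floor_divide_upper[OF x(2), of y]
        by (auto simp: algebra_simps)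
      then show ?thesis using x by (simp add: dist_real_def)
    qed
    ultimately show "\<exists>w\<in>T. dist w y < e" by blast
  qed
  then have "T = UNIV" using \<open>closed T\<close> by auto
  then show ?thesis using that by blast
next
  case False
  then obtain e where e: "e > 0" "\<And>x. x \<in> T \<Longrightarrow> 0 < x \<Longrightarrow> e \<le> x" by (force simp: not_less)
  show ?thesis
  proof (cases "\<exists>x\<in>T. x > 0")
    case False
    have "x = 0" if "x \<in> T" for x
    proof (rule ccontr)
      assume "x \<noteq> 0"
      then have "x > 0 \<or> - x > 0" by auto
      then show False using False that minus[OF \<open>0 \<in> T\<close> that] by auto
    qed
    then show ?thesis by (metis that(2) mult_zero_left of_int_0 zero_less_one)
  next
    case True
    let ?P = "T \<inter> {e..}"
    define d where "d = Inf ?P"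
    have ne: "?P \<noteq> {}" using True e by auto
    have "d \<in> ?P" unfolding d_def
      by (rule closed_contains_Inf) (use ne \<open>closed T\<close> in auto)
    then have d: "d \<in> T" "d > 0" using e by auto
    have "\<exists>k::int. x = of_int k * d" if x: "x \<in> T" for x
    proof -
      let ?k = "\<lfloor>x / d\<rfloor>" let ?y = "x - of_int ?k * d"
      have y: "?y \<in> T" by (intro minus x closed_subgroup_int_multiple[OF assms d(1)])
      have b: "0 \<le> ?y" "?y < d"
        using floor_divide_lower[OF d(2), of x] floor_divide_upper[OF d(2), of x]
        by (auto simp: algebra_simps)
      have "?y = 0"
      proof (rule ccontr)
        assume "?y \<noteq> 0"
        with b e(2)[OF y] y have "?y \<in> ?P" by auto
        then have "d \<le> ?y" unfolding d_def by (rule cInf_lower) auto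
        with b show False by simp
      qed
      then show ?thesis by auto
    qed
    then show ?thesis using d that(2) by blast
  qed
qed

section \<open>Asymptotic invariance under translations\<close>

locale random_step = prob_space Q for Q :: "'b measure" +
  fixes X :: "'b \<Rightarrow> real"
  assumes X_meas [measurable]: "X \<in> borel_measurable Q"
    and nonarithmetic: "\<And>d. d > 0 \<Longrightarrow> \<not> (AE x in Q. \<exists>k::int. X x = of_int k * d)"
begin

text \<open>\<open>(a, e)\<close> belongs to the support of the joint law of \<open>X\<close> and a sign \<open>S\<close>.\<close>
definition essential :: "('b \<Rightarrow> real) \<Rightarrow> real \<Rightarrow> real \<Rightarrow> bool" where
  "essential S a e \<longleftrightarrow> (\<forall>\<rho>>0. prob {x \<in> space Q. \<bar>X x - a\<bar> < \<rho> \<and> S x = e} > 0)"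

text \<open>The complement of the support is covered by countably many null intervals with rational
  end points.\<close>
lemma AE_essential:
  assumes [measurable]: "S \<in> borel_measurable Q"
    and S: "\<And>x. x \<in> space Q \<Longrightarrow> S x \<in> {1, -1}"
  shows "AE x in Q. essential S (X x) (S x)"
proof -
  let ?E = "\<lambda>p q e. {x \<in> space Q. X x \<in> {real_of_rat p<..<real_of_rat q} \<and> S x = e}"
  have "AE x in Q. \<forall>p q. \<forall>e\<in>{1,-1::real}. prob (?E p q e) = 0 \<longrightarrow> x \<notin> ?E p q e"
  proof (unfold AE_all_countable, intro allI AE_finite_allI)
    fix p q and e :: real
    show "AE x in Q. prob (?E p q e) = 0 \<longrightarrow> x \<notin> ?E p q e"
    proof (cases "prob (?E p q e) = 0")
      case True
      then have "AE x in Q. x \<notin> ?E p q e"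
        by (subst AE_iff_measurable[where N="?E p q e"]) (auto simp: emeasure_eq_measure)
      then show ?thesis by simp
    qed auto
  qed simp_all
  then show ?thesis
    using AE_space
  proof eventually_elim
    case (elim x)
    show ?case unfolding essential_def
    proof (intro allI impI)
      fix \<rho> :: real assume "\<rho> > 0"
      obtain p where p: "X x - \<rho> < real_of_rat p" "real_of_rat p < X x"
        using of_rat_dense[of "X x - \<rho>" "X x"] \<open>\<rho> > 0\<close> by auto
      obtain q where q: "X x < real_of_rat q" "real_of_rat q < X x + \<rho>"
        using of_rat_dense[of "X x" "X x + \<rho>"] \<open>\<rho> > 0\<close> by auto
      have "x \<in> ?E p q (S x)" using p q elim by auto
      then have "prob (?E p q (S x)) \<noteq> 0" using elim(1) S[OF elim(2)] by blast
      then have "0 < prob (?E p q (S x))" by (simp add: zero_less_measure_iff)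
      also have "\<dots> \<le> prob {y \<in> space Q. \<bar>X y - X x\<bar> < \<rho> \<and> S y = S x}"
        by (rule finite_measure_mono) (use p q in auto)
      finally show "prob {y \<in> space Q. \<bar>X y - X x\<bar> < \<rho> \<and> S y = S x} > 0" .
    qed
  qed
qed

text \<open>Here \<open>s\<close> is the limit superior of \<open>\<bar>d\<bar>\<close>. A mean of values that are asymptotically bounded by \<open>s\<close> can
  only come close to \<open>s\<close> if almost all of these values do, with the right sign, and by continuity this
  reaches every point of the support. The signs \<open>\<sigma> n\<close> allow \<open>d\<close> to be near \<open>s\<close> at some of the points
  \<open>\<tau> n\<close> and near \<open>- s\<close> at the others.\<close>
lemma extremal_values_propagate:
  fixes d :: "real \<Rightarrow> real" and \<tau> \<sigma> :: "nat \<Rightarrow> real"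
  assumes [measurable]: "S \<in> borel_measurable Q" "d \<in> borel_measurable borel"
    and S: "\<And>x. x \<in> space Q \<Longrightarrow> S x \<in> {1, -1}"
    and bdd: "\<And>t. \<bar>d t\<bar> \<le> B"
    and lip: "\<And>t u. \<bar>d t - d u\<bar> \<le> L * \<bar>t - u\<bar>" and "L \<ge> 0"
    and harm: "((\<lambda>t. d t - (\<integral>x. S x * d (t - X x) \<partial>Q)) \<longlongrightarrow> 0) at_top"
    and upper: "\<And>\<delta>. \<delta> > 0 \<Longrightarrow> eventually (\<lambda>t. \<bar>d t\<bar> < s + \<delta>) at_top"
    and ess: "essential S a e" and e: "e \<in> {1, -1}"
    and \<tau>: "filterlim \<tau> at_top sequentially"
    and \<sigma>: "\<And>n. \<sigma> n \<in> {1, -1}"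
    and lim: "(\<lambda>n. \<sigma> n * d (\<tau> n)) \<longlonglongrightarrow> s"
  shows "(\<lambda>n. \<sigma> n * e * d (\<tau> n - a)) \<longlonglongrightarrow> s"
proof -
  \<comment> \<open>The excess of \<open>\<bar>d\<bar>\<close> over \<open>s\<close> is bounded and vanishes at infinity, so its mean vanishes as well;
    adding it makes the integrand \<open>w\<close> below nonnegative.\<close>
  define ex where "ex t = max 0 (\<bar>d t\<bar> - s)" for t
  have "s \<ge> -B"
  proof -
    have "\<sigma> n * d (\<tau> n) \<ge> - B" for n using \<sigma>[of n] bdd[of "\<tau> n"] by auto
    then show ?thesis using lim by (meson LIMSEQ_le_const)
  qed
  have ex_meas [measurable]: "ex \<in> borel_measurable borel" unfolding ex_def by measurable
  have ex_bdd: "\<bar>ex t\<bar> \<le> 2 * B" for t using \<open>s \<ge> -B\<close> bdd[of t] unfolding ex_def by auto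
  have ex_lim: "(ex \<longlongrightarrow> 0) at_top"
  proof (rule order_tendstoI)
    fix b :: real assume "b > 0"
    then show "eventually (\<lambda>t. ex t < b) at_top"
      by (rule upper[THEN eventually_mono]) (use \<open>b > 0\<close> in \<open>auto simp: ex_def\<close>)
  qed (auto simp: ex_def less_max_iff_disj)
  have shift: "filterlim (\<lambda>n. \<tau> n - u) at_top sequentially" for u
    using filterlim_tendsto_add_at_top[OF tendsto_const[of "-u"] \<tau>] by (simp add: algebra_simps)
  have Eex: "(\<lambda>n. \<integral>x. ex (\<tau> n - X x) \<partial>Q) \<longlonglongrightarrow> (\<integral>x. 0 \<partial>Q)"
    by (rule integral_dominated_convergence[where w="\<lambda>_. 2 * B"])
      (auto intro!: filterlim_compose[OF ex_lim] shift ex_bdd AE_I2)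
  define w where "w n x = s - \<sigma> n * S x * d (\<tau> n - X x) + ex (\<tau> n - X x)" for n x
  have int1: "integrable Q (\<lambda>x. S x * d (\<tau> n - X x))" for n
    by (rule integrable_const_bound[where B=B]) (use S bdd in \<open>fastforce intro!: AE_I2 simp: abs_mult\<close>)+
  have int2: "integrable Q (\<lambda>x. ex (\<tau> n - X x))" for n
    by (rule integrable_const_bound[where B="2*B"]) (use ex_bdd in \<open>auto intro!: AE_I2\<close>)
  have w_int: "integrable Q (w n)" for n
    unfolding w_def mult.assoc using int1[of n] int2[of n] by auto
  have w_nonneg: "w n x \<ge> 0" if "x \<in> space Q" for n x
    using S[OF that] \<sigma>[of n] unfolding w_def ex_def by (auto simp: max_def)
  have "(\<lambda>n. d (\<tau> n) - (\<integral>x. S x * d (\<tau> n - X x) \<partial>Q)) \<longlonglongrightarrow> 0"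
    by (rule filterlim_compose[OF harm \<tau>])
  moreover have "\<bar>\<sigma> n\<bar> = 1" for n using \<sigma>[of n] by auto
  ultimately have A: "(\<lambda>n. \<sigma> n * (d (\<tau> n) - (\<integral>x. S x * d (\<tau> n - X x) \<partial>Q))) \<longlonglongrightarrow> 0"
    by (subst tendsto_rabs_zero_iff[symmetric]) (simp add: abs_mult tendsto_rabs_zero)
  have "(\<integral>x. w n x \<partial>Q) = (s - \<sigma> n * d (\<tau> n)) + \<sigma> n * (d (\<tau> n) - (\<integral>x. S x * d (\<tau> n - X x) \<partial>Q))
      + (\<integral>x. ex (\<tau> n - X x) \<partial>Q)" for n
    unfolding w_def mult.assoc using int1[of n] int2[of n]
    by (simp add: prob_space right_diff_distrib)
  moreover have "(\<lambda>n. (s - \<sigma> n * d (\<tau> n)) + \<sigma> n * (d (\<tau> n) - (\<integral>x. S x * d (\<tau> n - X x) \<partial>Q))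
      + (\<integral>x. ex (\<tau> n - X x) \<partial>Q)) \<longlonglongrightarrow> (s - s) + 0 + (\<integral>x. 0 \<partial>Q)"
    by (intro tendsto_intros lim A Eex)
  ultimately have w_lim: "(\<lambda>n. \<integral>x. w n x \<partial>Q) \<longlonglongrightarrow> 0" by simp
  show ?thesis
  proof (rule order_tendstoI)
    fix b assume "b > s"
    have "eventually (\<lambda>n. \<bar>d (\<tau> n - a)\<bar> < s + (b - s)) sequentially"
      using \<open>b > s\<close> by (intro eventually_compose_filterlim[OF upper shift]) auto
    then show "eventually (\<lambda>n. \<sigma> n * e * d (\<tau> n - a) < b) sequentially"
    proof eventually_elim
      case (elim n)
      then show ?case using e \<sigma>[of n] by auto
    qed
  next
    fix b assume "b < s"
    \<comment> \<open>Within distance \<open>\<rho>\<close> of \<open>a\<close> the function \<open>d\<close> varies by at most half of the gap between \<open>b\<close> and \<open>s\<close>.\<close>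
    define \<rho> where "\<rho> = (s - b) / (2 * (L + 1))"
    have "\<rho> > 0" using \<open>b < s\<close> \<open>L \<ge> 0\<close> by (simp add: \<rho>_def)
    have L\<rho>: "L * \<rho> \<le> (s - b) / 2"
      using \<open>b < s\<close> \<open>L \<ge> 0\<close> by (simp add: \<rho>_def divide_simps mult_left_mono)
    let ?E = "{x \<in> space Q. \<bar>X x - a\<bar> < \<rho> \<and> S x = e}"
    define m where "m = prob ?E"
    have "m > 0" using ess \<open>\<rho> > 0\<close> by (simp add: essential_def m_def)
    have low: "m * (s - \<sigma> n * e * d (\<tau> n - a) - L * \<rho>) \<le> (\<integral>x. w n x \<partial>Q)" for n
    proof -
      let ?c = "s - \<sigma> n * e * d (\<tau> n - a) - L * \<rho>"
      have "m * ?c = (\<integral>x. indicator ?E x * ?c \<partial>Q)" by (simp add: m_def)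
      also have "\<dots> \<le> (\<integral>x. w n x \<partial>Q)"
      proof (rule integral_mono[OF _ w_int])
        show "integrable Q (\<lambda>x. indicator ?E x * ?c)" 
          by (intro integrable_mult_left integrable_real_indicator) (auto simp: emeasure_eq_measure)
        fix x assume x: "x \<in> space Q"
        show "indicator ?E x * ?c \<le> w n x"
        proof (cases "x \<in> ?E")
          case False
          then show ?thesis using w_nonneg[OF x] by simp
        next
          case True
          have "\<bar>d (\<tau> n - X x) - d (\<tau> n - a)\<bar> \<le> L * \<bar>X x - a\<bar>"
            using lip[of "\<tau> n - X x" "\<tau> n - a"] by (simp add: abs_minus_commute)
          also have "\<dots> \<le> L * \<rho>" using True \<open>L \<ge> 0\<close> by (intro mult_left_mono) auto
          finally have "\<sigma> n * e * (d (\<tau> n - X x) - d (\<tau> n - a)) \<le> L * \<rho>"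
            using e \<sigma>[of n] by (auto simp: abs_le_iff)
          moreover have "ex (\<tau> n - X x) \<ge> 0" by (simp add: ex_def)
          ultimately show ?thesis using True by (simp add: w_def algebra_simps)
        qed
      qed
      finally show ?thesis .
    qed
    have "eventually (\<lambda>n. (\<integral>x. w n x \<partial>Q) < m * ((s - b) / 2)) sequentially"
      using w_lim \<open>m > 0\<close> \<open>b < s\<close> by (intro order_tendstoD(2)) auto
    then show "eventually (\<lambda>n. b < \<sigma> n * e * d (\<tau> n - a)) sequentially"
    proof eventually_elim
      case (elim n)
      then have "m * (s - \<sigma> n * e * d (\<tau> n - a) - L * \<rho>) < m * ((s - b) / 2)"
        using low[of n] by linarith
      then have "s - \<sigma> n * e * d (\<tau> n - a) - L * \<rho> < (s - b) / 2" using \<open>m > 0\<close> by simp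
      then show ?case using L\<rho> by argo
    qed
  qed
qed

text \<open>Let \<open>d t = z t - e * z (t - a)\<close> and let \<open>s\<close> be the limit superior of \<open>\<bar>d\<bar>\<close>. Where \<open>d\<close> is close to
  \<open>\<plusminus>s\<close>, it is also close to \<open>\<plusminus>s\<close> at the next \<open>K\<close> points shifted by multiples of \<open>a\<close>, with signs such
  that these values telescope to \<open>z t - e ^ K * z (t - K * a)\<close>. This is bounded in \<open>K\<close>, so \<open>s = 0\<close>.\<close>
lemma asymptotic_period_essential:
  fixes z :: "real \<Rightarrow> real"
  assumes [measurable]: "S \<in> borel_measurable Q" "z \<in> borel_measurable borel"
    and S: "\<And>x. x \<in> space Q \<Longrightarrow> S x \<in> {1, -1}"
    and bdd: "\<And>t. \<bar>z t\<bar> \<le> A"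
    and lip: "\<And>t u. \<bar>z t - z u\<bar> \<le> L * \<bar>t - u\<bar>" and "L \<ge> 0"
    and harm: "((\<lambda>t. z t - (\<integral>x. S x * z (t - X x) \<partial>Q)) \<longlongrightarrow> 0) at_top"
    and ess: "essential S a e" and e: "e \<in> {1, -1}"
  shows "((\<lambda>t. z t - e * z (t - a)) \<longlongrightarrow> 0) at_top"
proof -
  define d where "d t = z t - e * z (t - a)" for t
  have [measurable]: "d \<in> borel_measurable borel" unfolding d_def by measurable
  have d_bdd: "\<bar>d t\<bar> \<le> 2 * A" for t using bdd[of t] bdd[of "t - a"] e by (auto simp: d_def)
  have d_lip: "\<bar>d t - d u\<bar> \<le> (2 * L) * \<bar>t - u\<bar>" for t u
    using lip[of t u] lip[of "t - a" "u - a"] e by (auto simp: d_def)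
  have int: "integrable Q (\<lambda>x. S x * z (t - X x))" for t
    by (rule integrable_const_bound[where B=A]) (use S bdd in \<open>fastforce intro!: AE_I2 simp: abs_mult\<close>)+
  have "(\<integral>x. S x * d (t - X x) \<partial>Q) =
      (\<integral>x. S x * z (t - X x) - e * (S x * z ((t - a) - X x)) \<partial>Q)" for t
    unfolding d_def by (intro Bochner_Integration.integral_cong) (auto simp: algebra_simps)
  also have "\<dots> t = (\<integral>x. S x * z (t - X x) \<partial>Q) - e * (\<integral>x. S x * z ((t - a) - X x) \<partial>Q)" for t
    using int[of t] int[of "t - a"] by simp
  finally have eq: "d t - (\<integral>x. S x * d (t - X x) \<partial>Q) = (z t - (\<integral>x. S x * z (t - X x) \<partial>Q))
      - e * (z (t - a) - (\<integral>x. S x * z ((t - a) - X x) \<partial>Q))" for t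
    by (simp add: d_def right_diff_distrib)
  have shift: "filterlim (\<lambda>t. t - a) at_top at_top"
    using filterlim_tendsto_add_at_top[OF tendsto_const[of "-a"] filterlim_ident] by simp
  have "((\<lambda>t. (z t - (\<integral>x. S x * z (t - X x) \<partial>Q))
      - e * (z (t - a) - (\<integral>x. S x * z ((t - a) - X x) \<partial>Q))) \<longlongrightarrow> 0 - e * 0) at_top"
    by (intro tendsto_intros harm filterlim_compose[OF harm shift])
  then have d_harm: "((\<lambda>t. d t - (\<integral>x. S x * d (t - X x) \<partial>Q)) \<longlongrightarrow> 0) at_top"
    by (simp add: eq)

  define Bs where "Bs = {b. eventually (\<lambda>t. \<bar>d t\<bar> \<le> b) at_top}"
  define s where "s = Inf Bs"
  have "Bs \<noteq> {}" using d_bdd by (auto simp: Bs_def intro!: exI[of _ "2 * A"])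
  have Bs_nonneg: "b \<ge> 0" if "b \<in> Bs" for b
  proof -
    have "eventually (\<lambda>t::real. 0 \<le> b) at_top" using that unfolding Bs_def mem_Collect_eq
      by (rule eventually_mono) (rule order_trans[OF abs_ge_zero])
    then show ?thesis by simp
  qed
  then have bb: "bdd_below Bs" by (intro bdd_belowI)
  have upper: "eventually (\<lambda>t. \<bar>d t\<bar> < s + \<delta>) at_top" if "\<delta> > 0" for \<delta>
  proof -
    have "Inf Bs < s + \<delta>" using that by (simp add: s_def)
    then obtain b where "b \<in> Bs" "b < s + \<delta>" using cInf_lessD[OF \<open>Bs \<noteq> {}\<close>] by blast
    then show ?thesis unfolding Bs_def by (auto elim!: eventually_mono)
  qed
  have "\<exists>t\<ge>real n. \<bar>d t\<bar> > s - 1 / (real n + 1)" for n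
  proof (rule ccontr)
    assume "\<not> ?thesis"
    then have "s - 1 / (real n + 1) \<in> Bs"
      by (auto simp: Bs_def not_less eventually_at_top_linorder)
    then have "s \<le> s - 1 / (real n + 1)" unfolding s_def by (rule cInf_lower[OF _ bb])
    then show False by (simp add: field_simps)
  qed
  then obtain \<tau> where \<tau>: "\<And>n. \<tau> n \<ge> real n" "\<And>n. \<bar>d (\<tau> n)\<bar> > s - 1 / (real n + 1)" by metis
  have \<tau>_lim: "filterlim \<tau> at_top sequentially"
    by (rule filterlim_at_top_mono[OF filterlim_real_sequentially]) (use \<tau> in auto)
  define \<sigma> where "\<sigma> n = (if d (\<tau> n) \<ge> 0 then 1 else - 1 :: real)" for n
  have \<sigma>_d: "\<sigma> n * d (\<tau> n) = \<bar>d (\<tau> n)\<bar>" for n by (simp add: \<sigma>_def)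
  have start: "(\<lambda>n. \<sigma> n * d (\<tau> n)) \<longlonglongrightarrow> s" unfolding \<sigma>_d
  proof (rule order_tendstoI)
    fix b assume "b > s"
    then show "eventually (\<lambda>n. \<bar>d (\<tau> n)\<bar> < b) sequentially"
      using eventually_compose_filterlim[OF upper[of "b - s"] \<tau>_lim] by simp
  next
    fix b assume "b < s"
    have "(\<lambda>n. s - 1 / (real n + 1)) \<longlonglongrightarrow> s - 0"
      by (intro tendsto_intros LIMSEQ_Suc[OF lim_1_over_n, simplified])
        (use LIMSEQ_inverse_real_of_nat in \<open>simp add: divide_simps inverse_eq_divide add.commute\<close>)
    then have "eventually (\<lambda>n. b < s - 1 / (real n + 1)) sequentially"
      using \<open>b < s\<close> by (intro order_tendstoD(1)) auto
    then show "eventually (\<lambda>n. b < \<bar>d (\<tau> n)\<bar>) sequentially"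
      by (rule eventually_mono) (use \<tau>(2) order_less_trans in blast)
  qed
  have e_pow: "e ^ k \<in> {1, -1}" for k by (induction k) (use e in auto)
  have \<sigma>_e: "\<sigma> n * e ^ k \<in> {1, -1}" for n k using e_pow[of k] by (auto simp: \<sigma>_def)
  have propagate: "(\<lambda>n. \<sigma> n * e ^ k * d (\<tau> n - real k * a)) \<longlonglongrightarrow> s" for k
  proof (induction k)
    case 0
    show ?case using start by simp
  next
    case (Suc k)
    have "filterlim (\<lambda>n. \<tau> n - real k * a) at_top sequentially"
      using filterlim_tendsto_add_at_top[OF tendsto_const[of "- (real k * a)"] \<tau>_lim] by simp
    then have "(\<lambda>n. (\<sigma> n * e ^ k) * e * d (\<tau> n - real k * a - a)) \<longlonglongrightarrow> s"
      by (intro extremal_values_propagate[OF _ _ S d_bdd d_lip _ d_harm upper ess e _ \<sigma>_e Suc])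
        (use \<open>L \<ge> 0\<close> in auto)
    then show ?case by (simp add: algebra_simps)
  qed
  have tele: "(\<Sum>k<K. e ^ k * d (t - real k * a)) = z t - e ^ K * z (t - real K * a)" for K t
    by (induction K) (auto simp: d_def algebra_simps)
  have "real K * s \<le> 2 * A" for K
  proof -
    have "(\<lambda>n. \<Sum>k<K. \<sigma> n * e ^ k * d (\<tau> n - real k * a)) \<longlonglongrightarrow> (\<Sum>k<K. s)"
      by (intro tendsto_sum propagate)
    moreover have "(\<Sum>k<K. \<sigma> n * e ^ k * d (\<tau> n - real k * a)) \<le> 2 * A" for n
    proof -
      have "(\<Sum>k<K. \<sigma> n * e ^ k * d (\<tau> n - real k * a))
          = \<sigma> n * (z (\<tau> n) - e ^ K * z (\<tau> n - real K * a))"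
        by (simp only: tele[symmetric] sum_distrib_left mult.assoc)
      also have "\<dots> \<le> 2 * A"
        using bdd[of "\<tau> n"] bdd[of "\<tau> n - real K * a"] e_pow[of K]
        by (auto simp: \<sigma>_def)
      finally show ?thesis .
    qed
    ultimately show ?thesis by (intro LIMSEQ_le_const2) auto
  qed
  then have "s \<le> 0" by (meson not_le ex_less_of_nat_mult)
  show ?thesis unfolding d_def[symmetric]
  proof (rule tendstoI)
    fix \<delta> :: real assume "\<delta> > 0"
    then show "eventually (\<lambda>t. dist (d t) 0 < \<delta>) at_top"
      using \<open>s \<le> 0\<close> by (intro eventually_mono[OF upper]) auto
  qed
qed

text \<open>The asymptotic periods of \<open>z\<close> form a closed subgroup that contains twice every point of the support
  of \<open>X\<close>. It cannot be discrete, as \<open>X\<close> would then be arithmetic, so it is the whole line. If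
  the sign \<open>-1\<close> occurs at a point \<open>a\<close>, then both \<open>z t\<close> and \<open>- z t\<close> are close to \<open>z (t - a)\<close>.\<close>
lemma asymptotic_translation_invariance:
  fixes z :: "real \<Rightarrow> real"
  assumes [measurable]: "S \<in> borel_measurable Q" "z \<in> borel_measurable borel"
    and S: "\<And>x. x \<in> space Q \<Longrightarrow> S x \<in> {1, -1}"
    and bdd: "\<And>t. \<bar>z t\<bar> \<le> A"
    and lip: "\<And>t u. \<bar>z t - z u\<bar> \<le> L * \<bar>t - u\<bar>" and "L \<ge> 0"
    and harm: "((\<lambda>t. z t - (\<integral>x. S x * z (t - X x) \<partial>Q)) \<longlongrightarrow> 0) at_top"
  shows "((\<lambda>t. z t - z (t - x)) \<longlongrightarrow> 0) at_top"
    and "\<not> (AE x in Q. S x = 1) \<Longrightarrow> (z \<longlongrightarrow> 0) at_top"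
proof -
  have shift: "filterlim (\<lambda>t. t - x) at_top at_top" for x :: real
    using filterlim_tendsto_add_at_top[OF tendsto_const[of "-x"] filterlim_ident] by simp
  define T where "T = {x. ((\<lambda>t. z t - z (t - x)) \<longlongrightarrow> 0) at_top}"
  note period = asymptotic_period_essential[OF assms(1-3) bdd lip \<open>L \<ge> 0\<close> harm]
  have T_diff: "x - y \<in> T" if "x \<in> T" "y \<in> T" for x y
  proof -
    have lim: "((\<lambda>t. z (t - - y) - z (t - - y - w)) \<longlongrightarrow> 0) at_top" if "w \<in> T" for w
      by (rule filterlim_compose[OF _ shift]) (use that in \<open>simp add: T_def\<close>)
    from tendsto_diff[OF lim[OF that(1)] lim[OF that(2)]]
    show ?thesis by (simp add: T_def algebra_simps)
  qed
  have T_closed: "closed T"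
  proof (subst closed_sequential_limits, intro allI impI, elim conjE)
    fix y x assume y: "\<forall>n. y n \<in> T" and "y \<longlonglongrightarrow> x"
    show "x \<in> T" unfolding T_def mem_Collect_eq
    proof (rule tendstoI)
      fix \<delta> :: real assume "\<delta> > 0"
      have "(\<lambda>n. L * \<bar>y n - x\<bar>) \<longlonglongrightarrow> L * \<bar>x - x\<bar>" by (intro tendsto_intros \<open>y \<longlonglongrightarrow> x\<close>)
      then have "eventually (\<lambda>n. L * \<bar>y n - x\<bar> < \<delta> / 2) sequentially"
        using \<open>\<delta> > 0\<close> by (intro order_tendstoD(2)) auto
      then obtain n where n: "L * \<bar>y n - x\<bar> < \<delta> / 2" by (auto simp: eventually_sequentially)
      have "eventually (\<lambda>t. dist (z t - z (t - y n)) 0 < \<delta> / 2) at_top"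
        using y \<open>\<delta> > 0\<close> unfolding T_def by (intro tendstoD) auto
      then show "eventually (\<lambda>t. dist (z t - z (t - x)) 0 < \<delta>) at_top"
      proof eventually_elim
        case (elim t)
        have "\<bar>z (t - x) - z (t - y n)\<bar> \<le> L * \<bar>y n - x\<bar>" using lip[of "t - x" "t - y n"] by simp
        then show ?case using elim n unfolding dist_real_def by linarith
      qed
    qed
  qed
  \<comment> \<open>Doubling a point of the support removes the sign.\<close>
  have T_double: "2 * a \<in> T" if "essential S a e" "e \<in> {1, -1}" for a e
  proof -
    have p: "((\<lambda>t. z t - e * z (t - a)) \<longlongrightarrow> 0) at_top" by (rule period[OF _ that])
    have "((\<lambda>t. (z t - e * z (t - a)) + e * (z (t - a) - e * z (t - a - a))) \<longlongrightarrow> 0 + e * 0) at_top"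
      by (intro tendsto_intros p filterlim_compose[OF p shift])
    then show ?thesis using that(2) by (auto simp: T_def algebra_simps)
  qed
  have AE_ess: "AE x in Q. essential S (X x) (S x)" by (rule AE_essential) (use S in auto)
  have "T = UNIV"
  proof (rule ccontr)
    assume "T \<noteq> UNIV"
    moreover have "0 \<in> T" by (simp add: T_def)
    ultimately obtain d where d: "d > 0" "\<And>x. x \<in> T \<Longrightarrow> \<exists>k::int. x = of_int k * d"
      using closed_subgroup_real_cases[OF T_closed _ T_diff] by metis
    have "AE x in Q. \<exists>k::int. X x = of_int k * (d / 2)"
      using AE_ess AE_space
    proof eventually_elim
      case (elim x)
      from d(2)[OF T_double[OF elim(1) S[OF elim(2)]]] show ?case by (auto simp: field_simps)
    qed
    with nonarithmetic[of "d / 2"] d(1) show False by simp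
  qed
  then show inv: "((\<lambda>t. z t - z (t - x)) \<longlongrightarrow> 0) at_top" for x by (auto simp: T_def)
  assume "\<not> (AE x in Q. S x = 1)"
  then obtain a where a: "essential S a (-1)"
  proof -
    have "\<exists>a. essential S a (-1)"
    proof (rule ccontr)
      assume no: "\<nexists>a. essential S a (-1)"
      have "AE x in Q. S x = 1" using AE_ess AE_space
      proof (eventually_elim)
        case (elim x)
        then show ?case using S[of x] no by auto
      qed
      with \<open>\<not> (AE x in Q. S x = 1)\<close> show False by blast
    qed
    then show ?thesis using that by blast
  qed
  have "((\<lambda>t. ((z t - z (t - a)) + (z t - (-1) * z (t - a))) / 2) \<longlongrightarrow> (0 + 0) / 2) at_top"
    by (intro tendsto_intros inv period[OF _ a]) auto
  then show "(z \<longlongrightarrow> 0) at_top" by simp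
qed

end

section \<open>Averages over a sliding window\<close>

definition window :: "real \<Rightarrow> (real \<Rightarrow> real) \<Rightarrow> real \<Rightarrow> real" where
  "window h y t = (\<integral>s. indicator {t-h..t} s * y s \<partial>lborel)"

lemma window_measurable [measurable]:
  assumes [measurable]: "y \<in> borel_measurable borel"
  shows "window h y \<in> borel_measurable borel"
proof -
  have "(\<lambda>t. \<integral>s. (if t - h \<le> s \<and> s \<le> t then 1 else 0) * y s \<partial>lborel) \<in> borel_measurable borel"
    by measurable
  also have "(\<lambda>t. \<integral>s. (if t - h \<le> s \<and> s \<le> t then 1 else 0) * y s \<partial>lborel) = window h y"
    unfolding window_def by (intro ext Bochner_Integration.integral_cong) (auto simp: indicator_def)
  finally show ?thesis .
qed

lemma window_shift: "window h y (t - u) = (\<integral>s. indicator {t-h..t} s * y (s - u) \<partial>lborel)"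
  unfolding window_def
  by (subst lborel_integral_real_affine[where c=1 and t="-u"])
    (auto intro!: Bochner_Integration.integral_cong simp: indicator_def)

lemma window_integrable:
  fixes y :: "real \<Rightarrow> real"
  assumes [measurable]: "y \<in> borel_measurable borel" and "\<And>t. \<bar>y t\<bar> \<le> A"
  shows "integrable lborel (\<lambda>s. indicator {a..b::real} s * y s)"
  by (rule integrableI_bounded_set[where A="{a..b}" and B=A])
    (use assms in \<open>auto simp: emeasure_lborel_Icc_eq\<close>)

lemma integrable_indicator_Icc: "integrable lborel (\<lambda>s. indicator {a..b::real} s * (c :: real))"
  by (intro integrable_mult_left integrable_real_indicator) (auto simp: emeasure_lborel_Icc_eq)

lemma window_bound:
  assumes y [measurable]: "y \<in> borel_measurable borel" and bdd: "\<And>t. \<bar>y t\<bar> \<le> A" and "h \<ge> 0"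
  shows "\<bar>window h y t\<bar> \<le> A * h"
proof -
  have "norm (window h y t) \<le> (\<integral>s. indicator {t-h..t} s * A \<partial>lborel)"
    unfolding window_def
  proof (rule Bochner_Integration.integral_norm_bound_integral[OF window_integrable[OF y bdd]])
    show "integrable lborel (\<lambda>s. indicator {t-h..t} s * A)"
      by (rule integrable_indicator_Icc)
    show "norm (indicator {t-h..t} s * y s) \<le> indicator {t-h..t} s * A" for s
      using bdd[of s] by (auto simp: indicator_def)
  qed
  then show ?thesis using \<open>h \<ge> 0\<close> by (simp add: mult.commute)
qed

lemma window_lipschitz:
  assumes y [measurable]: "y \<in> borel_measurable borel" and bdd: "\<And>t. \<bar>y t\<bar> \<le> A"
  shows "\<bar>window h y t - window h y u\<bar> \<le> 2 * A * \<bar>t - u\<bar>"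
proof -
  have *: "\<bar>window h y t - window h y u\<bar> \<le> 2 * A * (t - u)" if "u \<le> t" for t u
  proof -
    have "A \<ge> 0" using bdd[of 0] by linarith
    let ?f = "\<lambda>s. indicator {u..t} s * A + indicator {u-h..t-h} s * A :: real"
    have diff: "window h y t - window h y u =
        (\<integral>s. indicator {t-h..t} s * y s - indicator {u-h..u} s * y s \<partial>lborel)"
      unfolding window_def
      by (rule Bochner_Integration.integral_diff[symmetric]; rule window_integrable[OF y bdd])
    have "norm (\<integral>s. indicator {t-h..t} s * y s - indicator {u-h..u} s * y s \<partial>lborel)
        \<le> (\<integral>s. ?f s \<partial>lborel)"
    proof (rule Bochner_Integration.integral_norm_bound_integral)
      show "integrable lborel ?f" by (intro Bochner_Integration.integrable_add integrable_indicator_Icc)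
      fix s
      have ys: "\<bar>y s\<bar> \<le> A" by (rule bdd)
      have "\<bar>indicator {t-h..t} s - indicator {u-h..u} s :: real\<bar>
          \<le> indicator {u..t} s + indicator {u-h..t-h} s"
        using that by (auto split: split_indicator)
      then have "\<bar>indicator {t-h..t} s - indicator {u-h..u} s\<bar> * \<bar>y s\<bar>
          \<le> (indicator {u..t} s + indicator {u-h..t-h} s) * A"
        by (intro mult_mono ys) auto
      then show "norm (indicator {t-h..t} s * y s - indicator {u-h..u} s * y s) \<le> ?f s"
        by (simp add: left_diff_distrib[symmetric] distrib_right abs_mult)
    qed (intro Bochner_Integration.integrable_diff window_integrable[OF y bdd])
    moreover have "(\<integral>s. ?f s \<partial>lborel) = 2 * A * (t - u)"
    proof -
      have val: "(\<integral>s. indicator {a..b::real} s * A \<partial>lborel) = (b - a) * A" if "a \<le> b" for a b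
        using that by simp
      have "(\<integral>s. ?f s \<partial>lborel) = (t - u) * A + ((t - h) - (u - h)) * A"
        using that by (simp only: Bochner_Integration.integral_add[OF integrable_indicator_Icc integrable_indicator_Icc] val diff_right_mono)
      then show ?thesis by (simp add: algebra_simps)
    qed
    ultimately show ?thesis by (simp only: diff real_norm_def)
  qed
  show ?thesis
  proof (cases "u \<le> t")
    case True
    then show ?thesis using *[OF True] by simp
  next
    case False
    then have "t \<le> u" by simp
    from *[OF this] show ?thesis using False by (simp add: abs_minus_commute)
  qed
qed

lemma window_tendsto_zero:
  assumes "integrable lborel g"
  shows "(window h g \<longlongrightarrow> 0) at_top"
proof -
  have [measurable]: "g \<in> borel_measurable borel" using assms by simp
  have "((\<lambda>t. \<integral>s. indicator {t-h..t} s * g s \<partial>lborel) \<longlongrightarrow> (\<integral>s. 0 \<partial>(lborel :: real measure))) at_top"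
  proof (rule integral_dominated_convergence_at_top[of "\<lambda>_. 0" lborel "\<lambda>t s. indicator {t-h..t} s * g s" "\<lambda>s. \<bar>g s\<bar>"])
    show "AE s in lborel. ((\<lambda>t. indicator {t-h..t} s * g s) \<longlongrightarrow> 0) at_top"
    proof (rule AE_I2)
      fix s :: real
      have "eventually (\<lambda>t. t > s + h) at_top" by (rule eventually_gt_at_top)
      then have "eventually (\<lambda>t. indicator {t-h..t} s * g s = 0) at_top"
        by eventually_elim auto
      then show "((\<lambda>t. indicator {t-h..t} s * g s) \<longlongrightarrow> 0) at_top" by (rule tendsto_eventually)
    qed
  qed (use assms in \<open>auto simp: indicator_def\<close>)
  then show ?thesis by (simp add: window_def[abs_def])
qed

lemma window_integral:
  assumes g: "integrable lborel g" and "h \<ge> 0"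
  shows "integrable lborel (window h g)" "(\<integral>t. window h g t \<partial>lborel) = h * (\<integral>s. g s \<partial>lborel)"
proof -
  have [measurable]: "g \<in> borel_measurable borel" using g by simp
  let ?f = "\<lambda>(s, t). (if t - h \<le> s \<and> s \<le> t then 1 else 0) * g s :: real"
  have sec: "(\<lambda>t. ?f (s, t)) = (\<lambda>t. indicator {s..s+h} t * g s)" for s
    by (auto simp: fun_eq_iff indicator_def)
  have int: "integrable (lborel \<Otimes>\<^sub>M lborel) ?f"
  proof (rule lborel_pair.Fubini_integrable)
    have "(\<integral>t. norm (?f (s, t)) \<partial>lborel) = h * \<bar>g s\<bar>" for s
    proof -
      have "(\<integral>t. norm (?f (s, t)) \<partial>lborel) = (\<integral>t. indicator {s..s+h} t * \<bar>g s\<bar> \<partial>lborel)"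
        by (intro Bochner_Integration.integral_cong) (auto simp: indicator_def)
      then show ?thesis using \<open>h \<ge> 0\<close> by simp
    qed
    then show "integrable lborel (\<lambda>s. \<integral>t. norm (?f (s, t)) \<partial>lborel)" using g by simp
    show "AE s in lborel. integrable lborel (\<lambda>t. ?f (s, t))"
      unfolding sec by (intro AE_I2 integrable_mult_left integrable_real_indicator)
        (auto simp: emeasure_lborel_Icc_eq)
  qed measurable
  have win: "(\<integral>s. ?f (s, t) \<partial>lborel) = window h g t" for t
    unfolding window_def by (intro Bochner_Integration.integral_cong) (auto simp: indicator_def)
  show "integrable lborel (window h g)" using lborel_pair.integrable_snd[of "\<lambda>s t. ?f (s, t)"] int by (simp add: win[unfolded prod.case])
  have "(\<integral>t. window h g t \<partial>lborel) = (\<integral>s. (\<integral>t. ?f (s, t) \<partial>lborel) \<partial>lborel)"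
    using lborel_pair.Fubini_integral[of "\<lambda>s t. ?f (s, t)"] int by (simp add: win[unfolded prod.case])
  also have "\<dots> = (\<integral>s. h * g s \<partial>lborel)" unfolding sec using \<open>h \<ge> 0\<close> by simp
  finally show "(\<integral>t. window h g t \<partial>lborel) = h * (\<integral>s. g s \<partial>lborel)" by simp
qed

context random_step
begin

lemma window_renewal_equation:
  assumes S_meas [measurable]: "S \<in> borel_measurable Q" and y [measurable]: "y \<in> borel_measurable borel"
    and S: "\<And>x. x \<in> space Q \<Longrightarrow> S x \<in> {1, -1}" and bdd: "\<And>t. \<bar>y t\<bar> \<le> A" and "h \<ge> 0"
    and g: "integrable lborel g"
    and eq: "\<And>t. y t = g t + (\<integral>x. S x * y (t - X x) \<partial>Q)"
  shows "window h y t = window h g t + (\<integral>x. S x * window h y (t - X x) \<partial>Q)"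
proof -
  have [measurable]: "g \<in> borel_measurable borel" using g by simp
  interpret pair_sigma_finite Q lborel ..
  have "A \<ge> 0" using bdd[of 0] by linarith
  let ?f = "\<lambda>x s. indicator {t-h..t} s * (S x * y (s - X x))"
  have int: "integrable (Q \<Otimes>\<^sub>M lborel) (case_prod ?f)"
  proof (rule integrableI_bounded_set[where A="space Q \<times> {t-h..t}" and B=A])
    show "emeasure (Q \<Otimes>\<^sub>M lborel) (space Q \<times> {t-h..t}) < \<infinity>"
      by (subst lborel.emeasure_pair_measure_Times) (auto simp: emeasure_space_1 emeasure_lborel_Icc_eq ennreal_mult_less_top)
    show "AE x in Q \<Otimes>\<^sub>M lborel. x \<in> space Q \<times> {t-h..t} \<longrightarrow> norm (case_prod ?f x) \<le> A"
      using S bdd by (intro AE_I2) (fastforce simp: abs_mult space_pair_measure)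
    show "AE x in Q \<Otimes>\<^sub>M lborel. x \<notin> space Q \<times> {t-h..t} \<longrightarrow> case_prod ?f x = 0"
      by (intro AE_I2) (auto simp: space_pair_measure indicator_def)
  qed auto
  have "(\<integral>x. S x * window h y (t - X x) \<partial>Q) = (\<integral>x. (\<integral>s. ?f x s \<partial>lborel) \<partial>Q)"
  proof (rule Bochner_Integration.integral_cong[OF refl])
    fix x
    have "(\<integral>s. ?f x s \<partial>lborel) = (\<integral>s. S x * (indicator {t-h..t} s * y (s - X x)) \<partial>lborel)"
      by (intro Bochner_Integration.integral_cong) auto
    then show "S x * window h y (t - X x) = (\<integral>s. ?f x s \<partial>lborel)"
      by (simp add: window_shift)
  qed
  also have "\<dots> = (\<integral>s. (\<integral>x. ?f x s \<partial>Q) \<partial>lborel)"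
    by (rule Fubini_integral[OF int, symmetric])
  also have "\<dots> = (\<integral>s. indicator {t-h..t} s * y s - indicator {t-h..t} s * g s \<partial>lborel)"
  proof (rule Bochner_Integration.integral_cong[OF refl])
    fix s
    have "(\<integral>x. S x * y (s - X x) \<partial>Q) = y s - g s" using eq[of s] by linarith
    then show "(\<integral>x. ?f x s \<partial>Q) = indicator {t-h..t} s * y s - indicator {t-h..t} s * g s"
      by (simp add: right_diff_distrib)
  qed
  also have "\<dots> = window h y t - window h g t"
    unfolding window_def
    by (rule Bochner_Integration.integral_diff[OF window_integrable[OF y bdd]])
      (use integrable_real_mult_indicator[OF _ g] in \<open>simp add: mult.commute\<close>)
  finally show ?thesis by simp
qed

text \<open>The solution itself need not be continuous and \<open>g\<close> need not vanish at infinity. Averaging over a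
  window makes the solution Lipschitz and turns \<open>g\<close> into a perturbation that does vanish.\<close>
lemma window_translation_invariance:
  assumes S_meas [measurable]: "S \<in> borel_measurable Q" and y [measurable]: "y \<in> borel_measurable borel"
    and S: "\<And>x. x \<in> space Q \<Longrightarrow> S x \<in> {1, -1}" and bdd: "\<And>t. \<bar>y t\<bar> \<le> A" and "h \<ge> 0"
    and g: "integrable lborel g"
    and eq: "\<And>t. y t = g t + (\<integral>x. S x * y (t - X x) \<partial>Q)"
  shows "((\<lambda>t. window h y t - window h y (t - x)) \<longlongrightarrow> 0) at_top"
    and "\<not> (AE x in Q. S x = 1) \<Longrightarrow> (window h y \<longlongrightarrow> 0) at_top"
proof -
  have "window h y t - (\<integral>x. S x * window h y (t - X x) \<partial>Q) = window h g t" for t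
    using window_renewal_equation[OF S_meas y S bdd \<open>h \<ge> 0\<close> g eq, where t=t] by linarith
  then have "((\<lambda>t. window h y t - (\<integral>x. S x * window h y (t - X x) \<partial>Q)) \<longlongrightarrow> 0) at_top"
    using window_tendsto_zero[OF g] by simp
  note inv = asymptotic_translation_invariance[OF S_meas window_measurable[OF y] _
      window_bound[OF y bdd \<open>h \<ge> 0\<close>] window_lipschitz[OF y bdd] _ this]
  have A: "0 \<le> 2 * A" using bdd[of 0] by linarith
  show "((\<lambda>t. window h y t - window h y (t - x)) \<longlongrightarrow> 0) at_top"
    by (rule inv(1)) (use S A in blast)+
  show "(window h y \<longlongrightarrow> 0) at_top" if "\<not> (AE x in Q. S x = 1)"
    by (rule inv(2)) (use S A that in blast)+
qed

end

section \<open>Boundedness of the solution\<close>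

context random_step
begin

text \<open>Iterating the inequality bounds the average of \<open>r\<close> by the convolution of \<open>\<bar>g\<bar>\<close> with a partial sum
  \<open>V n\<close> of the renewal series, plus a remainder that contains the \<open>n\<close>-th power of the Laplace transform of
  \<open>X\<close> at \<open>\<epsilon>\<close>. The remainder tends to 0, and the partial sums are bounded uniformly in \<open>n\<close> and \<open>t\<close>.\<close>
lemma nonneg_window_bounded:
  fixes r g :: "real \<Rightarrow> real"
  assumes r [measurable]: "r \<in> borel_measurable borel" and r_nonneg: "\<And>t. 0 \<le> r t"
    and r_growth: "\<And>t. r t \<le> c * exp (\<epsilon> * t)" and "\<epsilon> > 0"
    and \<phi>_less: "(\<integral>\<^sup>+x. ennreal (exp (- \<epsilon> * X x)) \<partial>Q) < 1"
    and g: "integrable lborel g"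
    and ineq: "\<And>t. ennreal (r t) \<le> ennreal \<bar>g t\<bar> + (\<integral>\<^sup>+x. ennreal (r (t - X x)) \<partial>Q)"
  shows "\<exists>B. \<forall>t. (\<integral>\<^sup>+s. indicator {0..1} (t - s) * ennreal (r s) \<partial>lborel) \<le> ennreal B"
proof -
  interpret pair_sigma_finite Q lborel ..
  have [measurable]: "g \<in> borel_measurable borel" using g by simp
  have "c \<ge> 0" using r_nonneg[of 0] r_growth[of 0] by simp
  define \<phi> where "\<phi> = (\<integral>\<^sup>+x. ennreal (exp (- \<epsilon> * X x)) \<partial>Q)"
  obtain q where q: "\<phi> = ennreal q" "0 \<le> q" "q < 1"
    using \<phi>_less[folded \<phi>_def] by (cases "\<phi>") auto
  have tilt: "(\<integral>\<^sup>+x. ennreal (k * exp (\<epsilon> * (t - X x))) \<partial>Q) = ennreal (k * q * exp (\<epsilon> * t))"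
    if "k \<ge> 0" for k t
  proof -
    have "(\<integral>\<^sup>+x. ennreal (k * exp (\<epsilon> * (t - X x))) \<partial>Q) =
        (\<integral>\<^sup>+x. ennreal (k * exp (\<epsilon> * t)) * ennreal (exp (- \<epsilon> * X x)) \<partial>Q)"
      using that by (intro nn_integral_cong)
        (simp add: ennreal_mult'[symmetric] mult.assoc exp_add[symmetric] algebra_simps)
    also have "\<dots> = ennreal (k * exp (\<epsilon> * t)) * ennreal q"
      unfolding q(1)[symmetric] \<phi>_def by (rule nn_integral_cmult) measurable
    also have "\<dots> = ennreal (k * exp (\<epsilon> * t) * q)"
      by (rule ennreal_mult[symmetric]) (use that q in auto)
    finally show ?thesis by (simp only: mult.assoc mult.commute mult.left_commute)
  qed

  \<comment> \<open>The partial sums of the renewal series of the indicator of \<open>[0, 1]\<close>.\<close>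
  define V :: "nat \<Rightarrow> real \<Rightarrow> ennreal" where
    "V = rec_nat (\<lambda>_. 0) (\<lambda>_ v t. indicator {0..1} t + (\<integral>\<^sup>+x. v (t - X x) \<partial>Q))"
  have V_0: "V 0 t = 0" and V_Suc: "V (Suc n) t = indicator {0..1} t + (\<integral>\<^sup>+x. V n (t - X x) \<partial>Q)" for n t
    by (simp_all add: V_def)
  have V_meas [measurable]: "V n \<in> borel_measurable borel" for n
  proof (induction n)
    case 0
    show ?case by (simp add: V_0[abs_def] cong: measurable_cong)
  next
    case (Suc n)
    note [measurable] = Suc
    show ?case unfolding V_Suc[abs_def] by measurable
  qed
  define K where "K = 1 / (1 - q)"
  have K: "1 + K * q = K" "K \<ge> 0" using q by (auto simp: K_def field_simps)
  have V_exp: "V n t \<le> ennreal (K * exp (\<epsilon> * t))" for n t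
  proof (induction n arbitrary: t)
    case 0
    show ?case by (simp add: V_0)
  next
    case (Suc n)
    have "V (Suc n) t \<le> ennreal (exp (\<epsilon> * t)) + (\<integral>\<^sup>+x. ennreal (K * exp (\<epsilon> * (t - X x))) \<partial>Q)"
      unfolding V_Suc by (intro add_mono nn_integral_mono Suc)
        (use \<open>\<epsilon> > 0\<close> in \<open>auto simp: indicator_def ennreal_1[symmetric] simp del: ennreal_1 intro!: ennreal_leI\<close>)
    also have "\<dots> = ennreal (exp (\<epsilon> * t)) + ennreal (K * q * exp (\<epsilon> * t))"
      by (subst tilt[OF K(2)]) (rule refl)
    also have "\<dots> = ennreal ((1 + K * q) * exp (\<epsilon> * t))"
      using K(2) q by (subst ennreal_plus[symmetric]) (auto simp: distrib_right)
    finally show ?case by (simp only: K(1))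
  qed
  \<comment> \<open>On \<open>[0, 1]\<close> the exponential bound is a constant; elsewhere \<open>V (Suc n)\<close> is a mean of values of \<open>V n\<close>.\<close>
  have V_bdd: "V n t \<le> ennreal (K * exp \<epsilon>)" for n t
  proof (induction n arbitrary: t)
    case 0
    show ?case by (simp add: V_0)
  next
    case (Suc n)
    show ?case
    proof (cases "t \<in> {0..1}")
      case True
      have "V (Suc n) t \<le> ennreal (K * exp (\<epsilon> * t))" by (rule V_exp)
      also have "\<dots> \<le> ennreal (K * exp \<epsilon>)"
        using True \<open>\<epsilon> > 0\<close> K by (intro ennreal_leI mult_left_mono) auto
      finally show ?thesis .
    next
      case False
      then have "V (Suc n) t = (\<integral>\<^sup>+x. V n (t - X x) \<partial>Q)" by (simp add: V_Suc)
      also have "\<dots> \<le> (\<integral>\<^sup>+x. ennreal (K * exp \<epsilon>) \<partial>Q)" by (intro nn_integral_mono Suc)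
      finally show ?thesis by (simp add: emeasure_space_1)
    qed
  qed

  define z where "z t = (\<integral>\<^sup>+s. indicator {0..1} (t - s) * ennreal (r s) \<partial>lborel)" for t
  have z_shift: "z (t - u) = (\<integral>\<^sup>+s. indicator {0..1} (t - s) * ennreal (r (s - u)) \<partial>lborel)" for t u
    unfolding z_def by (subst nn_integral_real_affine[where c=1 and t="-u"]) (auto simp: algebra_simps)
  have z_exp: "z t \<le> ennreal (c * exp (\<epsilon> * t))" for t
  proof -
    have "z t \<le> (\<integral>\<^sup>+s. ennreal (c * exp (\<epsilon> * t)) * indicator {t-1..t} s \<partial>lborel)"
      unfolding z_def
    proof (rule nn_integral_mono)
      fix s
      show "indicator {0..1} (t - s) * ennreal (r s) \<le> ennreal (c * exp (\<epsilon> * t)) * indicator {t-1..t} s"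
      proof (cases "s \<in> {t-1..t}")
        case True
        have "r s \<le> c * exp (\<epsilon> * s)" by (rule r_growth)
        also have "\<dots> \<le> c * exp (\<epsilon> * t)" using True \<open>\<epsilon> > 0\<close> \<open>c \<ge> 0\<close> by (intro mult_left_mono) auto
        finally show ?thesis using True by (simp add: indicator_def ennreal_leI)
      qed (auto simp: indicator_def)
    qed
    also have "\<dots> = ennreal (c * exp (\<epsilon> * t))"
      by (subst nn_integral_cmult_indicator) (auto simp: emeasure_lborel_Icc_eq)
    finally show ?thesis .
  qed
  have z_V: "z t \<le> (\<integral>\<^sup>+s. V n (t - s) * ennreal \<bar>g s\<bar> \<partial>lborel) + ennreal (c * q ^ n * exp (\<epsilon> * t))" for n t
  proof (induction n arbitrary: t)
    case 0
    show ?case using z_exp by (simp add: V_0)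
  next
    case (Suc n)
    have "z t \<le> (\<integral>\<^sup>+s. indicator {0..1} (t - s) * ennreal \<bar>g s\<bar>
        + (\<integral>\<^sup>+x. indicator {0..1} (t - s) * ennreal (r (s - X x)) \<partial>Q) \<partial>lborel)"
      unfolding z_def
    proof (rule nn_integral_mono)
      fix s
      show "indicator {0..1} (t - s) * ennreal (r s) \<le> indicator {0..1} (t - s) * ennreal \<bar>g s\<bar>
        + (\<integral>\<^sup>+x. indicator {0..1} (t - s) * ennreal (r (s - X x)) \<partial>Q)"
        using ineq[of s] by (auto simp: indicator_def)
    qed
    also have "\<dots> = (\<integral>\<^sup>+s. indicator {0..1} (t - s) * ennreal \<bar>g s\<bar> \<partial>lborel)
        + (\<integral>\<^sup>+s. (\<integral>\<^sup>+x. indicator {0..1} (t - s) * ennreal (r (s - X x)) \<partial>Q) \<partial>lborel)"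
      by (rule nn_integral_add) measurable
    also have "(\<integral>\<^sup>+s. (\<integral>\<^sup>+x. indicator {0..1} (t - s) * ennreal (r (s - X x)) \<partial>Q) \<partial>lborel)
        = (\<integral>\<^sup>+x. z (t - X x) \<partial>Q)"
      unfolding z_shift by (rule Fubini') measurable
    also have "\<dots> \<le> (\<integral>\<^sup>+x. (\<integral>\<^sup>+s. V n (t - X x - s) * ennreal \<bar>g s\<bar> \<partial>lborel)
        + ennreal (c * q ^ n * exp (\<epsilon> * (t - X x))) \<partial>Q)"
      by (intro nn_integral_mono Suc)
    also have "\<dots> = (\<integral>\<^sup>+x. (\<integral>\<^sup>+s. V n (t - X x - s) * ennreal \<bar>g s\<bar> \<partial>lborel) \<partial>Q)
        + (\<integral>\<^sup>+x. ennreal (c * q ^ n * exp (\<epsilon> * (t - X x))) \<partial>Q)"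
      by (rule nn_integral_add) measurable
    also have "(\<integral>\<^sup>+x. ennreal (c * q ^ n * exp (\<epsilon> * (t - X x))) \<partial>Q) = ennreal (c * q ^ Suc n * exp (\<epsilon> * t))"
      using q \<open>c \<ge> 0\<close> by (subst tilt) (auto simp: ac_simps)
    also have "(\<integral>\<^sup>+x. (\<integral>\<^sup>+s. V n (t - X x - s) * ennreal \<bar>g s\<bar> \<partial>lborel) \<partial>Q)
        = (\<integral>\<^sup>+s. (\<integral>\<^sup>+x. V n (t - X x - s) * ennreal \<bar>g s\<bar> \<partial>Q) \<partial>lborel)"
      by (rule Fubini'[symmetric]) measurable
    also have "\<dots> = (\<integral>\<^sup>+s. (\<integral>\<^sup>+x. V n (t - s - X x) \<partial>Q) * ennreal \<bar>g s\<bar> \<partial>lborel)"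
      by (intro nn_integral_cong) (subst nn_integral_multc, auto simp: algebra_simps)
    also have "(\<integral>\<^sup>+s. indicator {0..1} (t - s) * ennreal \<bar>g s\<bar> \<partial>lborel) + (\<dots> + ennreal (c * q ^ Suc n * exp (\<epsilon> * t)))
       = (\<integral>\<^sup>+s. V (Suc n) (t - s) * ennreal \<bar>g s\<bar> \<partial>lborel) + ennreal (c * q ^ Suc n * exp (\<epsilon> * t))"
      by (simp add: V_Suc distrib_right nn_integral_add add.assoc)
    finally show ?case by (simp add: add_left_mono)
  qed
  define G where "G = (\<integral>s. \<bar>g s\<bar> \<partial>lborel)"
  have G: "(\<integral>\<^sup>+s. ennreal \<bar>g s\<bar> \<partial>lborel) = ennreal G" "G \<ge> 0"
    using g by (auto simp: G_def nn_integral_eq_integral)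
  have "z t \<le> ennreal (K * exp \<epsilon> * G)" for t
  proof (rule LIMSEQ_le_const)
    show "(\<lambda>n. ennreal (K * exp \<epsilon> * G + c * q ^ n * exp (\<epsilon> * t))) \<longlonglongrightarrow> ennreal (K * exp \<epsilon> * G)"
    proof (rule tendsto_ennrealI)
      have "(\<lambda>n. K * exp \<epsilon> * G + c * q ^ n * exp (\<epsilon> * t)) \<longlonglongrightarrow> K * exp \<epsilon> * G + c * 0 * exp (\<epsilon> * t)"
        by (intro tendsto_intros LIMSEQ_power_zero) (use q in auto)
      then show "(\<lambda>n. K * exp \<epsilon> * G + c * q ^ n * exp (\<epsilon> * t)) \<longlonglongrightarrow> K * exp \<epsilon> * G" by simp
    qed
    have "z t \<le> ennreal (K * exp \<epsilon> * G + c * q ^ n * exp (\<epsilon> * t))" for n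
    proof -
      have "(\<integral>\<^sup>+s. V n (t - s) * ennreal \<bar>g s\<bar> \<partial>lborel) \<le> (\<integral>\<^sup>+s. ennreal (K * exp \<epsilon>) * ennreal \<bar>g s\<bar> \<partial>lborel)"
        by (intro nn_integral_mono mult_right_mono V_bdd) auto
      also have "\<dots> = ennreal (K * exp \<epsilon> * G)"
        using K G by (subst nn_integral_cmult) (auto simp: ennreal_mult'[symmetric])
      finally have "z t \<le> ennreal (K * exp \<epsilon> * G) + ennreal (c * q ^ n * exp (\<epsilon> * t))"
        using z_V[of t n] by (meson add_right_mono order_trans)
      then show ?thesis using K G q \<open>c \<ge> 0\<close> by (simp add: ennreal_plus[symmetric] del: ennreal_plus)
    qed
    then show "\<exists>N. \<forall>n\<ge>N. z t \<le> ennreal (K * exp \<epsilon> * G + c * q ^ n * exp (\<epsilon> * t))" by blast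
  qed
  then show ?thesis unfolding z_def by blast
qed

end

section \<open>Positive drift\<close>

lemma enn2real_strict_mono: "x < y \<Longrightarrow> y < \<infinity> \<Longrightarrow> enn2real x < enn2real y"
  by (cases x; cases y) (auto simp: ennreal_less_iff)

text \<open>The mean of \<open>X\<close> lies in \<open>(0, \<infinity>]\<close>. As it may be infinite, its positivity is stated through the positive
  and the negative part.\<close>
locale positive_drift = random_step Q X for Q :: "'b measure" and X +
  fixes \<kappa> :: real
  assumes \<kappa>_pos: "\<kappa> > 0"
    and exp_integrable: "integrable Q (\<lambda>x. exp (- \<kappa> * X x))"
    and drift: "(\<integral>\<^sup>+x. ennreal (- X x) \<partial>Q) < (\<integral>\<^sup>+x. ennreal (X x) \<partial>Q)"
begin

definition truncated :: "nat \<Rightarrow> 'b \<Rightarrow> real" where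
  "truncated n x = min (X x) (real n)"

lemma truncated_measurable [measurable]: "truncated n \<in> borel_measurable Q"
  unfolding truncated_def[abs_def] by measurable

lemma neg_part_finite: "(\<integral>\<^sup>+x. ennreal (- X x) \<partial>Q) < \<infinity>"
  using drift by (auto simp: less_top[symmetric])

lemma truncated_integrable: "integrable Q (truncated n)"
proof (rule integrableI_bounded)
  have "(\<integral>\<^sup>+x. ennreal (norm (truncated n x)) \<partial>Q) \<le> (\<integral>\<^sup>+x. ennreal (real n) + ennreal (- X x) \<partial>Q)"
  proof (rule nn_integral_mono)
    fix x
    show "ennreal (norm (truncated n x)) \<le> ennreal (real n) + ennreal (- X x)"
    proof (cases "X x \<ge> 0")
      case True
      then have "ennreal (norm (truncated n x)) \<le> ennreal (real n)"
        by (intro ennreal_leI) (auto simp: truncated_def)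
      then show ?thesis by (rule order_trans) simp
    next
      case False
      then have "ennreal (norm (truncated n x)) = ennreal (- X x)" by (simp add: truncated_def)
      then show ?thesis by simp
    qed
  qed
  also have "\<dots> = ennreal (real n) + (\<integral>\<^sup>+x. ennreal (- X x) \<partial>Q)"
    by (subst nn_integral_add) (auto simp: emeasure_space_1)
  also have "\<dots> < \<infinity>" using neg_part_finite by simp
  finally show "(\<integral>\<^sup>+x. ennreal (norm (truncated n x)) \<partial>Q) < \<infinity>" .
qed measurable

lemma truncated_mean:
  "(\<integral>x. truncated n x \<partial>Q)
    = enn2real (\<integral>\<^sup>+x. ennreal (truncated n x) \<partial>Q) - enn2real (\<integral>\<^sup>+x. ennreal (- X x) \<partial>Q)"
proof -
  have "ennreal (- truncated n x) = ennreal (- X x)" for x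
    by (cases "X x \<ge> 0") (auto simp: truncated_def ennreal_neg)
  then show ?thesis using real_lebesgue_integral_def[OF truncated_integrable[of n]] by simp
qed

lemma truncated_pos_lim:
  "(\<lambda>n. \<integral>\<^sup>+x. ennreal (truncated n x) \<partial>Q) \<longlonglongrightarrow> (\<integral>\<^sup>+x. ennreal (X x) \<partial>Q)"
proof -
  have inc: "incseq (\<lambda>n x. ennreal (truncated n x))"
    by (auto simp: incseq_def le_fun_def truncated_def intro!: ennreal_leI)
  have "(SUP n. ennreal (truncated n x)) = ennreal (X x)" for x
  proof (rule antisym)
    show "(SUP n. ennreal (truncated n x)) \<le> ennreal (X x)"
      by (rule SUP_least) (auto simp: truncated_def intro!: ennreal_leI)
    obtain n where "X x \<le> real n" using real_arch_simple by blast
    then have "truncated n x = X x" by (simp add: truncated_def)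
    then show "ennreal (X x) \<le> (SUP n. ennreal (truncated n x))" by (intro SUP_upper2[of n]) auto
  qed
  then have "(\<integral>\<^sup>+x. ennreal (X x) \<partial>Q) = (SUP n. \<integral>\<^sup>+x. ennreal (truncated n x) \<partial>Q)"
    using nn_integral_monotone_convergence_SUP[OF inc] by simp
  moreover have "incseq (\<lambda>n. \<integral>\<^sup>+x. ennreal (truncated n x) \<partial>Q)"
    using inc by (auto simp: incseq_def le_fun_def intro!: nn_integral_mono)
  ultimately show ?thesis using LIMSEQ_SUP by metis
qed

lemma ex_truncated_mean_pos: "\<exists>n. (\<integral>x. truncated n x \<partial>Q) > 0"
proof -
  have "eventually (\<lambda>n. (\<integral>\<^sup>+x. ennreal (- X x) \<partial>Q) < (\<integral>\<^sup>+x. ennreal (truncated n x) \<partial>Q)) sequentially"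
    using truncated_pos_lim drift by (rule order_tendstoD(1))
  then obtain n where n: "(\<integral>\<^sup>+x. ennreal (- X x) \<partial>Q) < (\<integral>\<^sup>+x. ennreal (truncated n x) \<partial>Q)"
    by (auto simp: eventually_sequentially)
  moreover have "(\<integral>\<^sup>+x. ennreal (truncated n x) \<partial>Q) < \<infinity>"
    using integrableD(2)[OF truncated_integrable[of n]] by (simp add: less_top)
  ultimately have "enn2real (\<integral>\<^sup>+x. ennreal (- X x) \<partial>Q) < enn2real (\<integral>\<^sup>+x. ennreal (truncated n x) \<partial>Q)"
    by (intro enn2real_strict_mono) auto
  then show ?thesis by (auto simp: truncated_mean)
qed

lemma ex_truncated_mean_greater:
  assumes "\<not> integrable Q X"
  shows "\<exists>n. (\<integral>x. truncated n x \<partial>Q) > b"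
proof -
  let ?b = "\<bar>b\<bar> + enn2real (\<integral>\<^sup>+x. ennreal (- X x) \<partial>Q)"
  have "(\<integral>\<^sup>+x. ennreal (X x) \<partial>Q) = \<infinity>"
  proof (rule ccontr)
    assume "\<not> ?thesis"
    then have "integrable Q X"
      using neg_part_finite by (subst real_integrable_def) auto
    with assms show False ..
  qed
  then have "eventually (\<lambda>n. ennreal ?b < (\<integral>\<^sup>+x. ennreal (truncated n x) \<partial>Q)) sequentially"
    using truncated_pos_lim by (intro order_tendstoD(1)) auto
  then obtain n where n: "ennreal ?b < (\<integral>\<^sup>+x. ennreal (truncated n x) \<partial>Q)"
    by (auto simp: eventually_sequentially)
  moreover have "(\<integral>\<^sup>+x. ennreal (truncated n x) \<partial>Q) < \<infinity>"
    using integrableD(2)[OF truncated_integrable[of n]] by (simp add: less_top)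
  ultimately have "?b < enn2real (\<integral>\<^sup>+x. ennreal (truncated n x) \<partial>Q)"
    by (metis abs_ge_zero add_nonneg_nonneg enn2real_ennreal enn2real_nonneg enn2real_strict_mono infinity_ennreal_def)
  then show ?thesis by (auto simp: truncated_mean intro!: exI[of _ n])
qed

lemma mean_pos:
  assumes "integrable Q X"
  shows "(\<integral>x. X x \<partial>Q) > 0"
proof -
  obtain n where n: "(\<integral>x. truncated n x \<partial>Q) > 0" using ex_truncated_mean_pos by blast
  also have "(\<integral>x. truncated n x \<partial>Q) \<le> (\<integral>x. X x \<partial>Q)"
    by (rule integral_mono[OF truncated_integrable assms]) (simp add: truncated_def)
  finally show ?thesis .
qed

text \<open>The Laplace transform of \<open>X\<close> is 1 at 0 and starts with slope \<open>- E X < 0\<close>. Truncating \<open>X\<close> from above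
  keeps the slope finite and can only increase the transform.\<close>
lemma ex_exponent:
  assumes "\<delta> > 0"
  shows "\<exists>\<epsilon>>0. \<epsilon> < \<delta> \<and> (\<integral>\<^sup>+x. ennreal (exp (- \<epsilon> * X x)) \<partial>Q) < 1"
proof -
  obtain n where n: "(\<integral>x. truncated n x \<partial>Q) > 0" using ex_truncated_mean_pos by blast
  define Y where "Y = truncated n"
  have [measurable]: "Y \<in> borel_measurable Q" by (simp add: Y_def)
  \<comment> \<open>For \<open>\<epsilon> = 1 / (k + k0)\<close>, \<open>D k\<close> is the difference quotient of \<open>\<lambda>\<epsilon>. - exp (- \<epsilon> * Y)\<close> at 0. The choice
    of \<open>k0\<close> gives \<open>\<epsilon> < \<delta>\<close> and \<open>\<epsilon> \<le> \<kappa> / 2\<close>, where the spare half of \<open>\<kappa>\<close> absorbs the factor \<open>\<bar>X\<bar>\<close> on \<open>X < 0\<close>.\<close>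
  define k0 where "k0 = nat \<lceil>1 / \<delta> + 2 / \<kappa>\<rceil> + 1"
  define D where "D k x = (1 - exp (- Y x / real (k + k0))) * real (k + k0)" for k x
  have k0: "real (k + k0) > 0" "1 / real (k + k0) < \<delta>" "1 / real (k + k0) \<le> \<kappa> / 2" for k
  proof -
    have "real (k + k0) > 1 / \<delta> + 2 / \<kappa>" unfolding k0_def by linarith
    moreover have "1 / \<delta> > 0" "2 / \<kappa> > 0" using assms \<kappa>_pos by auto
    ultimately have "real (k + k0) > 1 / \<delta>" "real (k + k0) \<ge> 2 / \<kappa>" "real (k + k0) > 0" by linarith+
    then show "real (k + k0) > 0" "1 / real (k + k0) < \<delta>" "1 / real (k + k0) \<le> \<kappa> / 2"
      using assms \<kappa>_pos by (auto simp: field_simps)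
  qed
  have bound: "\<bar>D k x\<bar> \<le> \<bar>Y x\<bar> + 2 / \<kappa> * exp (- \<kappa> * X x)" for k x
  proof -
    define e where "e = 1 / real (k + k0)"
    have e: "e > 0" "e \<le> \<kappa> / 2" using k0[of k] by (auto simp: e_def)
    have D: "D k x = (1 - exp (- (e * Y x))) / e" by (simp add: D_def e_def field_simps)
    show ?thesis
    proof (cases "Y x \<ge> 0")
      case True
      have "1 - exp (- (e * Y x)) \<le> e * Y x" using exp_ge_add_one_self[of "- (e * Y x)"] by linarith
      moreover have "exp (- (e * Y x)) \<le> 1" using True e by simp
      ultimately have "\<bar>D k x\<bar> \<le> \<bar>Y x\<bar>" using e True by (simp add: D field_simps)
      moreover have "2 / \<kappa> * exp (- \<kappa> * X x) \<ge> 0" using \<kappa>_pos by simp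
      ultimately show ?thesis by linarith
    next
      case False
      then have YX: "Y x = X x" by (auto simp: Y_def truncated_def min_def split: if_splits)
      define a where "a = - X x"
      have a: "a > 0" using False YX by (simp add: a_def)
      have "exp (e * a) - 1 \<le> e * a * exp (e * a)"
      proof -
        have "(1 - e * a) * exp (e * a) \<le> exp (- (e * a)) * exp (e * a)"
          using exp_ge_add_one_self[of "- (e * a)"] by (intro mult_right_mono) auto
        then show ?thesis by (simp add: exp_minus algebra_simps)
      qed
      moreover have "\<bar>D k x\<bar> = (exp (e * a) - 1) / e"
      proof -
        have "exp (e * a) \<ge> 1" using e a by simp
        then show ?thesis using e by (simp add: D YX a_def abs_divide)
      qed
      ultimately have "\<bar>D k x\<bar> \<le> a * exp (e * a)"
        using e by (simp add: divide_le_eq mult_ac)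
      also have "\<dots> \<le> (2 / \<kappa> * exp (\<kappa> / 2 * a)) * exp (\<kappa> / 2 * a)"
      proof (rule mult_mono)
        have "\<kappa> / 2 * a \<le> exp (\<kappa> / 2 * a)" using exp_ge_add_one_self[of "\<kappa> / 2 * a"] by linarith
        then show "a \<le> 2 / \<kappa> * exp (\<kappa> / 2 * a)" using \<kappa>_pos by (simp add: field_simps)
        show "exp (e * a) \<le> exp (\<kappa> / 2 * a)" using e a by (simp add: mult_right_mono)
      qed (use \<kappa>_pos in auto)
      also have "\<dots> = 2 / \<kappa> * exp (- \<kappa> * X x)" by (simp add: a_def exp_add[symmetric] field_simps)
      finally show ?thesis by linarith
    qed
  qed
  have dom_int: "integrable Q (\<lambda>x. \<bar>Y x\<bar> + 2 / \<kappa> * exp (- \<kappa> * X x))"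
    using truncated_integrable[of n] exp_integrable unfolding Y_def by auto
  have D_meas [measurable]: "D k \<in> borel_measurable Q" for k unfolding D_def by measurable
  have "(\<lambda>k. (1 - exp (- y / real k)) * real k) \<longlonglongrightarrow> y" for y by real_asymp
  then have pointwise: "(\<lambda>k. D k x) \<longlonglongrightarrow> Y x" for x
    unfolding D_def by (rule LIMSEQ_ignore_initial_segment)
  have "(\<lambda>k. \<integral>x. D k x \<partial>Q) \<longlonglongrightarrow> (\<integral>x. Y x \<partial>Q)"
    by (rule integral_dominated_convergence[OF _ _ dom_int]) (use bound pointwise in auto)
  then have "eventually (\<lambda>k. (\<integral>x. D k x \<partial>Q) > 0) sequentially"
    using n by (intro order_tendstoD(1)) (auto simp: Y_def)
  then obtain k where k: "(\<integral>x. D k x \<partial>Q) > 0" by (auto simp: eventually_sequentially)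
  define \<epsilon> where "\<epsilon> = 1 / real (k + k0)"
  have \<epsilon>: "\<epsilon> > 0" "\<epsilon> < \<delta>" using k0[of k] by (auto simp: \<epsilon>_def)
  have D_int: "integrable Q (D k)"
  proof (rule Bochner_Integration.integrable_bound[OF dom_int D_meas], rule AE_I2)
    show "norm (D k x) \<le> norm (\<bar>Y x\<bar> + 2 / \<kappa> * exp (- \<kappa> * X x))" for x
      using bound[of k x] unfolding real_norm_def by linarith
  qed
  have eY: "exp (- \<epsilon> * Y x) = 1 - \<epsilon> * D k x" for x
    using k0(1)[of k] by (simp add: D_def \<epsilon>_def field_simps)
  have int: "integrable Q (\<lambda>x. exp (- \<epsilon> * Y x))" unfolding eY using D_int by auto
  have "(\<integral>\<^sup>+x. ennreal (exp (- \<epsilon> * X x)) \<partial>Q) \<le> (\<integral>\<^sup>+x. ennreal (exp (- \<epsilon> * Y x)) \<partial>Q)"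
    using \<epsilon> by (intro nn_integral_mono ennreal_leI) (auto simp: Y_def truncated_def)
  also have "\<dots> = ennreal (\<integral>x. exp (- \<epsilon> * Y x) \<partial>Q)" by (rule nn_integral_eq_integral[OF int]) auto
  also have "(\<integral>x. exp (- \<epsilon> * Y x) \<partial>Q) = 1 - \<epsilon> * (\<integral>x. D k x \<partial>Q)"
    unfolding eY using D_int by (simp add: prob_space)
  also have "ennreal \<dots> < 1" using k \<epsilon> by (simp add: ennreal_less_one_iff)
  finally show ?thesis using \<epsilon> by blast
qed

end

section \<open>The limit of the averaged solution\<close>

text \<open>The signed indicator of the interval between 0 and \<open>u\<close>.\<close>
definition oriented :: "real \<Rightarrow> real \<Rightarrow> real" where
  "oriented u s = (if 0 \<le> s \<and> s < u then 1 else if u \<le> s \<and> s < 0 then -1 else 0)"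

lemma oriented_measurable [measurable (raw)]:
  assumes [measurable]: "f \<in> borel_measurable M" "g \<in> borel_measurable M"
  shows "(\<lambda>x. oriented (f x) (g x)) \<in> borel_measurable M"
  unfolding oriented_def by measurable

lemma oriented_eq: "oriented u s = indicator {0..} s - indicator {u..} s"
  by (auto simp: oriented_def indicator_def)

lemma has_bochner_integral_oriented:
  "has_bochner_integral lborel (oriented u) u"
  "has_bochner_integral lborel (\<lambda>s. \<bar>oriented u s\<bar>) \<bar>u\<bar>"
proof -
  have pos: "has_bochner_integral lborel (indicator {a..<b} :: real \<Rightarrow> real) (b - a)" if "a \<le> b" for a b :: real
    using has_bochner_integral_real_indicator[of "{a..<b}" lborel] that by simp
  have "has_bochner_integral lborel (oriented u) u \<and> has_bochner_integral lborel (\<lambda>s. \<bar>oriented u s\<bar>) \<bar>u\<bar>"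
  proof (cases "u \<ge> 0")
    case True
    then have "oriented u = indicator {0..<u}" "(\<lambda>s. \<bar>oriented u s\<bar>) = indicator {0..<u}"
      by (auto simp: fun_eq_iff oriented_def indicator_def)
    then show ?thesis using pos[of 0 u] True by simp
  next
    case False
    then have "oriented u = (\<lambda>s. - indicator {u..<0} s)" "(\<lambda>s. \<bar>oriented u s\<bar>) = indicator {u..<0}"
      by (auto simp: fun_eq_iff oriented_def indicator_def)
    then show ?thesis
      using pos[of u 0] has_bochner_integral_minus[OF pos[of u 0]] False by simp
  qed
  then show "has_bochner_integral lborel (oriented u) u"
    "has_bochner_integral lborel (\<lambda>s. \<bar>oriented u s\<bar>) \<bar>u\<bar>" by auto
qed

context random_step
begin

lemma oriented_product_integrable:
  assumes Y: "integrable Q Y"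
  shows "integrable (Q \<Otimes>\<^sub>M lborel) (\<lambda>(\<omega>, s). \<bar>oriented (Y \<omega>) s\<bar>)"
proof -
  interpret pair_sigma_finite Q lborel ..
  have [measurable]: "Y \<in> borel_measurable Q" using Y by simp
  show ?thesis
    by (rule Fubini_integrable)
      (use Y has_bochner_integral_oriented(2) in \<open>auto simp: has_bochner_integral_iff\<close>)
qed

text \<open>A function that is asymptotically invariant under translations behaves like a constant when it
  is integrated from \<open>t - Y\<close> to \<open>t\<close>.\<close>
lemma oriented_mean_asymptotics:
  fixes z :: "real \<Rightarrow> real"
  assumes Y: "integrable Q Y" and z [measurable]: "z \<in> borel_measurable borel"
    and bdd: "\<And>t. \<bar>z t\<bar> \<le> A"
    and inv: "\<And>x. ((\<lambda>t. z t - z (t - x)) \<longlongrightarrow> 0) at_top"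
  shows "integrable Q (\<lambda>\<omega>. \<integral>s. oriented (Y \<omega>) s * z (t - s) \<partial>lborel)"
    and "((\<lambda>t. (\<integral>\<omega>. (\<integral>s. oriented (Y \<omega>) s * z (t - s) \<partial>lborel) \<partial>Q) - z t * (\<integral>\<omega>. Y \<omega> \<partial>Q)) \<longlongrightarrow> 0) at_top"
proof -
  interpret pair_sigma_finite Q lborel ..
  have Y_meas [measurable]: "Y \<in> borel_measurable Q" using Y by simp
  have "A \<ge> 0" using bdd[of 0] by linarith
  note o = has_bochner_integral_oriented(1)[THEN has_bochner_integral_integral_eq]
  have int: "integrable (Q \<Otimes>\<^sub>M lborel) (\<lambda>(\<omega>, s). oriented (Y \<omega>) s * z (t - s))" for t
  proof (rule Bochner_Integration.integrable_bound)
    show "integrable (Q \<Otimes>\<^sub>M lborel) (\<lambda>x. A * (case x of (\<omega>, s) \<Rightarrow> \<bar>oriented (Y \<omega>) s\<bar>))"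
      by (intro integrable_mult_right oriented_product_integrable Y)
    show "AE x in Q \<Otimes>\<^sub>M lborel. norm (case x of (\<omega>, s) \<Rightarrow> oriented (Y \<omega>) s * z (t - s))
        \<le> norm (A * (case x of (\<omega>, s) \<Rightarrow> \<bar>oriented (Y \<omega>) s\<bar>))"
      using bdd \<open>A \<ge> 0\<close> by (intro AE_I2) (auto simp: abs_mult mult.commute[of A] mult_left_mono)
  qed measurable
  show fst: "integrable Q (\<lambda>\<omega>. \<integral>s. oriented (Y \<omega>) s * z (t - s) \<partial>lborel)" for t
    by (rule integrable_fst[OF int])
  let ?F = "\<lambda>t (\<omega>, s). oriented (Y \<omega>) s * (z (t - s) - z t)"
  have "((\<lambda>t. integral\<^sup>L (Q \<Otimes>\<^sub>M lborel) (?F t)) \<longlongrightarrow> (\<integral>x. 0 \<partial>(Q \<Otimes>\<^sub>M (lborel :: real measure)))) at_top"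
  proof (rule integral_dominated_convergence_at_top[where w="\<lambda>x. (2 * A) * (case x of (\<omega>, s) \<Rightarrow> \<bar>oriented (Y \<omega>) s\<bar>)"])
    show "integrable (Q \<Otimes>\<^sub>M lborel) (\<lambda>x. (2 * A) * (case x of (\<omega>, s) \<Rightarrow> \<bar>oriented (Y \<omega>) s\<bar>))"
      by (intro integrable_mult_right oriented_product_integrable Y)
    show "AE x in Q \<Otimes>\<^sub>M lborel. ((\<lambda>t. ?F t x) \<longlongrightarrow> 0) at_top"
    proof (rule AE_I2, clarify)
      fix \<omega> s
      have "((\<lambda>t. - oriented (Y \<omega>) s * (z t - z (t - s))) \<longlongrightarrow> - oriented (Y \<omega>) s * 0) at_top"
        by (intro tendsto_intros inv)
      then show "((\<lambda>t. oriented (Y \<omega>) s * (z (t - s) - z t)) \<longlongrightarrow> 0) at_top"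
        by (simp add: algebra_simps)
    qed
    show "\<forall>\<^sub>F t in at_top. AE x in Q \<Otimes>\<^sub>M lborel. norm (?F t x) \<le> (2 * A) * (case x of (\<omega>, s) \<Rightarrow> \<bar>oriented (Y \<omega>) s\<bar>)"
    proof (intro always_eventually allI AE_I2, clarify)
      fix t \<omega> s
      have "\<bar>z (t - s) - z t\<bar> \<le> 2 * A" using bdd[of t] bdd[of "t - s"] by linarith
      then show "norm (oriented (Y \<omega>) s * (z (t - s) - z t)) \<le> 2 * A * \<bar>oriented (Y \<omega>) s\<bar>"
        by (simp add: abs_mult mult.commute mult_left_mono)
    qed
  qed measurable
  moreover have "integral\<^sup>L (Q \<Otimes>\<^sub>M lborel) (?F t)
      = (\<integral>\<omega>. (\<integral>s. oriented (Y \<omega>) s * z (t - s) \<partial>lborel) \<partial>Q) - z t * (\<integral>\<omega>. Y \<omega> \<partial>Q)" for t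
  proof -
    have o2: "integrable (Q \<Otimes>\<^sub>M lborel) (\<lambda>(\<omega>, s). z t * oriented (Y \<omega>) s)"
    proof (rule Bochner_Integration.integrable_bound)
      show "integrable (Q \<Otimes>\<^sub>M lborel) (\<lambda>x. A * (case x of (\<omega>, s) \<Rightarrow> \<bar>oriented (Y \<omega>) s\<bar>))"
        by (intro integrable_mult_right oriented_product_integrable Y)
      show "AE x in Q \<Otimes>\<^sub>M lborel. norm (case x of (\<omega>, s) \<Rightarrow> z t * oriented (Y \<omega>) s)
          \<le> norm (A * (case x of (\<omega>, s) \<Rightarrow> \<bar>oriented (Y \<omega>) s\<bar>))"
        using bdd[of t] \<open>A \<ge> 0\<close> by (intro AE_I2) (auto simp: abs_mult mult_right_mono)
    qed measurable
    have "?F t = (\<lambda>x. (case x of (\<omega>, s) \<Rightarrow> oriented (Y \<omega>) s * z (t - s)) - (case x of (\<omega>, s) \<Rightarrow> z t * oriented (Y \<omega>) s))"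
      by (auto simp: fun_eq_iff algebra_simps)
    then have "integral\<^sup>L (Q \<Otimes>\<^sub>M lborel) (?F t)
        = integral\<^sup>L (Q \<Otimes>\<^sub>M lborel) (\<lambda>(\<omega>, s). oriented (Y \<omega>) s * z (t - s))
          - integral\<^sup>L (Q \<Otimes>\<^sub>M lborel) (\<lambda>(\<omega>, s). z t * oriented (Y \<omega>) s)"
      using Bochner_Integration.integral_diff[OF int o2] by simp
    also have "integral\<^sup>L (Q \<Otimes>\<^sub>M lborel) (\<lambda>(\<omega>, s). oriented (Y \<omega>) s * z (t - s))
        = (\<integral>\<omega>. (\<integral>s. oriented (Y \<omega>) s * z (t - s) \<partial>lborel) \<partial>Q)"
      by (rule integral_fst[OF int, symmetric])
    also have "integral\<^sup>L (Q \<Otimes>\<^sub>M lborel) (\<lambda>(\<omega>, s). z t * oriented (Y \<omega>) s)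
        = (\<integral>\<omega>. (\<integral>s. z t * oriented (Y \<omega>) s \<partial>lborel) \<partial>Q)"
      by (rule integral_fst[OF o2, symmetric])
    also have "\<dots> = z t * (\<integral>\<omega>. Y \<omega> \<partial>Q)" using o by simp
    finally show ?thesis .
  qed
  ultimately show "((\<lambda>t. (\<integral>\<omega>. (\<integral>s. oriented (Y \<omega>) s * z (t - s) \<partial>lborel) \<partial>Q) - z t * (\<integral>\<omega>. Y \<omega> \<partial>Q)) \<longlongrightarrow> 0) at_top"
    by simp
qed

end

context random_step
begin

text \<open>Integrating the renewal equation over \<open>(-\<infinity>, t]\<close>, where the growth bound makes the primitive \<open>J\<close> of
  \<open>z\<close> finite. The integral of \<open>z (t - s)\<close> against \<open>oriented u s\<close> is \<open>J t - J (t - u)\<close>.\<close>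
lemma integrated_renewal_equation:
  fixes z \<gamma> :: "real \<Rightarrow> real"
  assumes z [measurable]: "z \<in> borel_measurable borel" and nonneg: "\<And>t. 0 \<le> z t"
    and growth: "\<And>t. z t \<le> c * exp (\<epsilon> * t)" and "\<epsilon> > 0"
    and finite: "(\<integral>\<^sup>+x. ennreal (exp (- \<epsilon> * X x)) \<partial>Q) < \<infinity>"
    and \<gamma>: "integrable lborel \<gamma>"
    and eq: "\<And>t. z t = \<gamma> t + (\<integral>x. z (t - X x) \<partial>Q)"
  shows "integrable lborel (\<lambda>s. indicator {u..} s * z (t - s))"
    and "integrable Q (\<lambda>x. \<integral>s. oriented (X x) s * z (t - s) \<partial>lborel)"
    and "(\<integral>x. (\<integral>s. oriented (X x) s * z (t - s) \<partial>lborel) \<partial>Q) = (\<integral>s. indicator {0..} s * \<gamma> (t - s) \<partial>lborel)"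
proof -
  interpret pair_sigma_finite Q lborel ..
  have \<gamma>_meas [measurable]: "\<gamma> \<in> borel_measurable borel" using \<gamma> by simp
  have "c \<ge> 0" using nonneg[of 0] growth[of 0] by simp
  have nn_tail: "(\<integral>\<^sup>+s. ennreal (indicator {u..} s * z (t - s)) \<partial>lborel) \<le> ennreal (c / \<epsilon> * exp (\<epsilon> * (t - u)))" for u t
  proof -
    have "(\<integral>\<^sup>+s. ennreal (indicator {u..} s * z (t - s)) \<partial>lborel)
        \<le> (\<integral>\<^sup>+s. ennreal (c * exp (\<epsilon> * (t - s))) * indicator {u..} s \<partial>lborel)"
      by (intro nn_integral_mono) (auto simp: indicator_def intro!: ennreal_leI growth)
    also have "\<dots> = ennreal (0 - (- c / \<epsilon> * exp (\<epsilon> * (t - u))))"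
    proof (rule nn_integral_FTC_atLeast[where F="\<lambda>s. - c / \<epsilon> * exp (\<epsilon> * (t - s))"])
      show "((\<lambda>s. - c / \<epsilon> * exp (\<epsilon> * (t - s))) has_field_derivative c * exp (\<epsilon> * (t - s))) (at s)" for s
        using \<open>\<epsilon> > 0\<close> by (auto intro!: derivative_eq_intros)
      have "((\<lambda>s. exp (\<epsilon> * (t - s))) \<longlongrightarrow> 0) at_top" using \<open>\<epsilon> > 0\<close> by real_asymp
      from tendsto_mult_right_zero[OF this] show "((\<lambda>s. - c / \<epsilon> * exp (\<epsilon> * (t - s))) \<longlongrightarrow> 0) at_top" by blast
    qed (use \<open>c \<ge> 0\<close> in auto)
    finally show ?thesis by simp
  qed
  show tail_int: "integrable lborel (\<lambda>s. indicator {u..} s * z (t - s))" for u t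
    by (rule integrableI_nonneg)
      (use nonneg le_less_trans[OF nn_tail] in \<open>auto intro!: AE_I2\<close>)
  have prod_int: "integrable (Q \<Otimes>\<^sub>M lborel) (\<lambda>(x, s). indicator {0..} s * z (t - s - X x))"
  proof (rule integrableI_nonneg)
    have "(\<integral>\<^sup>+x. ennreal (case x of (x, s) \<Rightarrow> indicator {0..} s * z (t - s - X x)) \<partial>(Q \<Otimes>\<^sub>M lborel))
        = (\<integral>\<^sup>+x. (\<integral>\<^sup>+s. ennreal (indicator {0..} s * z ((t - X x) - s)) \<partial>lborel) \<partial>Q)"
      by (subst lborel.nn_integral_fst[symmetric]) (auto simp: algebra_simps)
    also have "\<dots> \<le> (\<integral>\<^sup>+x. ennreal (c / \<epsilon> * exp (\<epsilon> * t)) * ennreal (exp (- \<epsilon> * X x)) \<partial>Q)"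
    proof (rule nn_integral_mono)
      fix x
      have "c / \<epsilon> * exp (\<epsilon> * (t - X x - 0)) = (c / \<epsilon> * exp (\<epsilon> * t)) * exp (- \<epsilon> * X x)"
        by (simp add: mult.assoc exp_add[symmetric] right_diff_distrib)
      then show "(\<integral>\<^sup>+s. ennreal (indicator {0..} s * z ((t - X x) - s)) \<partial>lborel)
          \<le> ennreal (c / \<epsilon> * exp (\<epsilon> * t)) * ennreal (exp (- \<epsilon> * X x))"
        using nn_tail[of 0 "t - X x"] by (simp only: ennreal_mult''[symmetric] exp_ge_zero)
    qed
    also have "\<dots> < \<infinity>"
      using finite by (subst nn_integral_cmult) (auto simp: ennreal_mult_less_top)
    finally show "(\<integral>\<^sup>+x. ennreal (case x of (x, s) \<Rightarrow> indicator {0..} s * z (t - s - X x)) \<partial>(Q \<Otimes>\<^sub>M lborel)) < \<infinity>" .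
    show "AE x in Q \<Otimes>\<^sub>M lborel. 0 \<le> (case x of (x, s) \<Rightarrow> indicator {0..} s * z (t - s - X x))"
      using nonneg by (intro AE_I2) auto
  qed measurable
  define J where "J t = (\<integral>s. indicator {0..} s * z (t - s) \<partial>lborel)" for t
  have J_shift: "J (t - u) = (\<integral>s. indicator {u..} s * z (t - s) \<partial>lborel)" for t u
    unfolding J_def by (subst lborel_integral_real_affine[where c=1 and t="-u"])
      (auto intro!: Bochner_Integration.integral_cong simp: indicator_def)
  have inner: "(\<integral>s. oriented u s * z (t - s) \<partial>lborel) = J t - J (t - u)" for u
  proof -
    have "(\<integral>s. oriented u s * z (t - s) \<partial>lborel)
        = (\<integral>s. indicator {0..} s * z (t - s) - indicator {u..} s * z (t - s) \<partial>lborel)"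
      by (intro Bochner_Integration.integral_cong) (auto simp: oriented_eq left_diff_distrib)
    also have "\<dots> = J t - J (t - u)"
      unfolding J_shift by (simp add: J_def Bochner_Integration.integral_diff[OF tail_int tail_int])
    finally show ?thesis .
  qed
  have J_X: "J (t - X x) = (\<integral>s. indicator {0..} s * z (t - s - X x) \<partial>lborel)" for x
    unfolding J_def by (intro Bochner_Integration.integral_cong) (auto simp: algebra_simps)
  have J_int: "integrable Q (\<lambda>x. J (t - X x))"
    unfolding J_X by (rule integrable_fst[OF prod_int])
  show "integrable Q (\<lambda>x. \<integral>s. oriented (X x) s * z (t - s) \<partial>lborel)"
    unfolding inner using J_int by simp
  have "(\<integral>x. J (t - X x) \<partial>Q) = (\<integral>s. (\<integral>x. indicator {0..} s * z (t - s - X x) \<partial>Q) \<partial>lborel)"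
    unfolding J_X by (rule Fubini_integral[OF prod_int, symmetric])
  also have "\<dots> = (\<integral>s. indicator {0..} s * z (t - s) - indicator {0..} s * \<gamma> (t - s) \<partial>lborel)"
  proof (rule Bochner_Integration.integral_cong[OF refl])
    fix s
    have "(\<integral>x. z (t - s - X x) \<partial>Q) = z (t - s) - \<gamma> (t - s)" using eq[of "t - s"] by linarith
    then show "(\<integral>x. indicator {0..} s * z (t - s - X x) \<partial>Q)
        = indicator {0..} s * z (t - s) - indicator {0..} s * \<gamma> (t - s)"
      by (simp add: right_diff_distrib)
  qed
  also have "\<dots> = J t - (\<integral>s. indicator {0..} s * \<gamma> (t - s) \<partial>lborel)"
    unfolding J_def
  proof (rule Bochner_Integration.integral_diff[OF tail_int])
    have "integrable lborel (\<lambda>s. \<gamma> (t + (-1) * s))"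
      using lborel_integrable_real_affine[OF \<gamma>, of "-1" t] by simp
    then show "integrable lborel (\<lambda>s. indicator {0..} s * \<gamma> (t - s))"
      using integrable_real_mult_indicator[of "{0..}" lborel "\<lambda>s. \<gamma> (t - s)"] by (simp add: mult.commute)
  qed
  finally show "(\<integral>x. (\<integral>s. oriented (X x) s * z (t - s) \<partial>lborel) \<partial>Q) = (\<integral>s. indicator {0..} s * \<gamma> (t - s) \<partial>lborel)"
    unfolding inner using J_int by (simp add: prob_space)
qed

end

lemma primitive_tendsto:
  fixes \<gamma> :: "real \<Rightarrow> real"
  assumes \<gamma>: "integrable lborel \<gamma>"
  shows "((\<lambda>t. \<integral>s. indicator {0..} s * \<gamma> (t - s) \<partial>lborel) \<longlongrightarrow> (\<integral>s. \<gamma> s \<partial>lborel)) at_top"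
proof -
  have [measurable]: "\<gamma> \<in> borel_measurable borel" using \<gamma> by simp
  have eq: "(\<integral>s. indicator {0..} s * \<gamma> (t - s) \<partial>lborel) = (\<integral>s. indicator {..t} s * \<gamma> s \<partial>lborel)" for t
    by (subst lborel_integral_real_affine[where c="-1" and t=t])
      (auto intro!: Bochner_Integration.integral_cong simp: indicator_def)
  have "((\<lambda>t. \<integral>s. indicator {..t} s * \<gamma> s \<partial>lborel) \<longlongrightarrow> (\<integral>s. \<gamma> s \<partial>lborel)) at_top"
  proof (rule integral_dominated_convergence_at_top[where w="\<lambda>s. \<bar>\<gamma> s\<bar>"])
    show "AE s in lborel. ((\<lambda>t. indicator {..t} s * \<gamma> s) \<longlongrightarrow> \<gamma> s) at_top"
    proof (rule AE_I2)
      fix s :: real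
      have "eventually (\<lambda>t. t \<ge> s) at_top" by (rule eventually_ge_at_top)
      then have "eventually (\<lambda>t. indicator {..t} s * \<gamma> s = \<gamma> s) at_top"
        by eventually_elim auto
      then show "((\<lambda>t. indicator {..t} s * \<gamma> s) \<longlongrightarrow> \<gamma> s) at_top" by (rule tendsto_eventually)
    qed
  qed (use \<gamma> in \<open>auto simp: indicator_def\<close>)
  then show ?thesis unfolding eq .
qed

context positive_drift
begin

text \<open>The negative part of \<open>X\<close> is integrable, so \<open>X\<close> can fail to be integrable only if its mean is \<open>\<infinity>\<close>, whose
  reciprocal is 0.\<close>
definition rate :: real where
  "rate = (if integrable Q X then 1 / (\<integral>x. X x \<partial>Q) else 0)"

text \<open>By translation invariance the mean of the integral of \<open>z\<close> from \<open>t - X\<close> to \<open>t\<close> is close to \<open>z t\<close> times the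
  mean of \<open>X\<close>, and by the integrated equation it tends to the integral of \<open>\<gamma>\<close>. If the mean of \<open>X\<close> is
  infinite, truncation shows that \<open>z t\<close> times an arbitrarily large number stays bounded.\<close>
lemma invariant_solution_limit:
  fixes z \<gamma> :: "real \<Rightarrow> real"
  assumes z [measurable]: "z \<in> borel_measurable borel" and nonneg: "\<And>t. 0 \<le> z t"
    and growth: "\<And>t. z t \<le> c * exp (\<epsilon> * t)" and "\<epsilon> > 0"
    and finite: "(\<integral>\<^sup>+x. ennreal (exp (- \<epsilon> * X x)) \<partial>Q) < \<infinity>"
    and bdd: "\<And>t. z t \<le> A"
    and \<gamma>: "integrable lborel \<gamma>"
    and eq: "\<And>t. z t = \<gamma> t + (\<integral>x. z (t - X x) \<partial>Q)"
    and inv: "\<And>x. ((\<lambda>t. z t - z (t - x)) \<longlongrightarrow> 0) at_top"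
  shows "(z \<longlongrightarrow> rate * (\<integral>t. \<gamma> t \<partial>lborel)) at_top"
proof -
  note int_eq = integrated_renewal_equation[OF z nonneg growth \<open>\<epsilon> > 0\<close> finite \<gamma> eq]
  have abs_bdd: "\<bar>z t\<bar> \<le> A" for t using nonneg[of t] bdd[of t] by simp
  have G: "((\<lambda>t. \<integral>x. (\<integral>s. oriented (X x) s * z (t - s) \<partial>lborel) \<partial>Q) \<longlongrightarrow> (\<integral>t. \<gamma> t \<partial>lborel)) at_top"
    unfolding int_eq(3) by (rule primitive_tendsto[OF \<gamma>])
  show ?thesis
  proof (cases "integrable Q X")
    case True
    have m: "(\<integral>x. X x \<partial>Q) > 0" by (rule mean_pos[OF True])
    from tendsto_diff[OF G oriented_mean_asymptotics(2)[OF True z abs_bdd inv]]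
    have "((\<lambda>t. z t * (\<integral>x. X x \<partial>Q)) \<longlongrightarrow> (\<integral>t. \<gamma> t \<partial>lborel)) at_top" by simp
    from tendsto_divide[OF this tendsto_const, of "\<integral>x. X x \<partial>Q"] m
    show ?thesis by (simp add: rate_def True)
  next
    case False
    have "(z \<longlongrightarrow> 0) at_top"
    proof (rule order_tendstoI)
      fix b :: real assume "b > 0"
      define g where "g = \<bar>\<integral>t. \<gamma> t \<partial>lborel\<bar> + 1"
      obtain n where n: "(\<integral>x. truncated n x \<partial>Q) > (g + 1) / b"
        using ex_truncated_mean_greater[OF False] by blast
      define m where "m = (\<integral>x. truncated n x \<partial>Q)"
      have "(g + 1) / b > 0" using \<open>b > 0\<close> by (simp add: g_def)
      then have m: "m > 0" "m > (g + 1) / b" using n by (auto simp: m_def)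
      note as = oriented_mean_asymptotics[OF truncated_integrable[of n] z abs_bdd inv, folded m_def]
      have "eventually (\<lambda>t. (\<integral>x. (\<integral>s. oriented (X x) s * z (t - s) \<partial>lborel) \<partial>Q) < g) at_top"
        using G by (rule order_tendstoD(2)) (simp add: g_def)
      moreover have "eventually (\<lambda>t. - 1 < (\<integral>x. (\<integral>s. oriented (truncated n x) s * z (t - s) \<partial>lborel) \<partial>Q) - z t * m) at_top"
        using as(2) by (rule order_tendstoD(1)) simp
      ultimately show "eventually (\<lambda>t. z t < b) at_top"
      proof eventually_elim
        case (elim t)
        have "(\<integral>x. (\<integral>s. oriented (truncated n x) s * z (t - s) \<partial>lborel) \<partial>Q)
            \<le> (\<integral>x. (\<integral>s. oriented (X x) s * z (t - s) \<partial>lborel) \<partial>Q)"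
        proof (rule integral_mono[OF as(1) int_eq(2)])
          fix x
          have o_int: "integrable lborel (\<lambda>s. oriented u s * z (t - s))" for u
            unfolding oriented_eq left_diff_distrib
            by (rule Bochner_Integration.integrable_diff; rule int_eq(1))
          show "(\<integral>s. oriented (truncated n x) s * z (t - s) \<partial>lborel) \<le> (\<integral>s. oriented (X x) s * z (t - s) \<partial>lborel)"
            by (rule integral_mono[OF o_int o_int])
              (use nonneg[of "t - s" for s] in \<open>auto simp: oriented_def truncated_def intro!: mult_right_mono\<close>)
        qed
        then have "z t * m < g + 1" using elim by linarith
        also have "g + 1 < m * b" using m(2) \<open>b > 0\<close> by (simp add: field_simps)
        finally show ?case using m(1) by (simp add: mult.commute)
      qed
    qed (use nonneg in \<open>auto intro!: always_eventually intro: less_le_trans\<close>)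
    then show ?thesis by (simp add: rate_def False)
  qed
qed

end

section \<open>The renewal theorem\<close>

text \<open>Since \<open>exp (- \<alpha> t) r t\<close> decreases, \<open>r\<close> is controlled from both sides by its window averages.\<close>
lemma tauberian_window:
  fixes r :: "real \<Rightarrow> real"
  assumes r [measurable]: "r \<in> borel_measurable borel" and nonneg: "\<And>t. 0 \<le> r t" and bdd: "\<And>t. r t \<le> A"
    and decr: "\<And>s t. s \<le> t \<Longrightarrow> r t \<le> exp (\<alpha> * (t - s)) * r s" and "\<alpha> > 0"
    and lim: "\<And>h. h > 0 \<Longrightarrow> (window h r \<longlongrightarrow> h * L) at_top"
  shows "(r \<longlongrightarrow> L) at_top"
proof -
  have abs_bdd: "\<bar>r t\<bar> \<le> A" for t using nonneg[of t] bdd[of t] by simp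
  have upper: "r t \<le> exp (\<alpha> * h) * (window h r t / h)" if "h > 0" for h t
  proof -
    have "h * (exp (- \<alpha> * h) * r t) = (\<integral>s. indicator {t-h..t} s * (exp (- \<alpha> * h) * r t) \<partial>lborel)"
      using that by simp
    also have "\<dots> \<le> window h r t" unfolding window_def
    proof (rule integral_mono[OF _ window_integrable[OF r abs_bdd]])
      show "integrable lborel (\<lambda>s. indicator {t-h..t} s * (exp (- \<alpha> * h) * r t))"
        by (rule integrable_indicator_Icc)
      fix s
      have "exp (- \<alpha> * h) * r t \<le> r s" if "s \<in> {t-h..t}"
      proof -
        have "r t \<le> exp (\<alpha> * (t - s)) * r s" using that by (intro decr) auto
        also have "\<dots> \<le> exp (\<alpha> * h) * r s" using that \<open>\<alpha> > 0\<close> nonneg by (intro mult_right_mono) auto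
        finally show ?thesis by (simp add: exp_minus field_simps)
      qed
      then show "indicator {t-h..t} s * (exp (- \<alpha> * h) * r t) \<le> indicator {t-h..t} s * r s"
        by (auto simp: indicator_def)
    qed
    finally show ?thesis using that by (simp add: exp_minus field_simps)
  qed
  have lower: "exp (- \<alpha> * h) * (window h r (t + h) / h) \<le> r t" if "h > 0" for h t
  proof -
    have "window h r (t + h) \<le> (\<integral>s. indicator {t..t+h} s * (exp (\<alpha> * h) * r t) \<partial>lborel)"
      unfolding window_def
    proof (rule integral_mono[OF window_integrable[OF r abs_bdd]])
      show "integrable lborel (\<lambda>s. indicator {t..t+h} s * (exp (\<alpha> * h) * r t))"
        by (rule integrable_indicator_Icc)
      fix s
      have "r s \<le> exp (\<alpha> * h) * r t" if "s \<in> {t..t+h}"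
      proof -
        have "r s \<le> exp (\<alpha> * (s - t)) * r t" using that by (intro decr) auto
        also have "\<dots> \<le> exp (\<alpha> * h) * r t" using that \<open>\<alpha> > 0\<close> nonneg by (intro mult_right_mono) auto
        finally show ?thesis .
      qed
      then show "indicator {t+h-h..t+h} s * r s \<le> indicator {t..t+h} s * (exp (\<alpha> * h) * r t)"
        by (auto simp: indicator_def)
    qed
    also have "\<dots> = h * (exp (\<alpha> * h) * r t)" using that by simp
    finally show ?thesis using that by (simp add: exp_minus field_simps)
  qed
  have cont: "((\<lambda>h. exp (\<alpha> * h) * L) \<longlongrightarrow> L) (at_right 0)" "((\<lambda>h. exp (- \<alpha> * h) * L) \<longlongrightarrow> L) (at_right 0)"
    by (auto intro!: tendsto_eq_intros)
  have win: "((\<lambda>t. window h r t / h) \<longlongrightarrow> L) at_top" if "h > 0" for h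
    using tendsto_divide[OF lim[OF that] tendsto_const[of h]] that by simp
  show ?thesis
  proof (rule order_tendstoI)
    fix b assume "b > L"
    have "eventually (\<lambda>h. exp (\<alpha> * h) * L < b) (at_right 0)"
      by (rule order_tendstoD(2)[OF cont(1) \<open>b > L\<close>])
    then have "eventually (\<lambda>h. exp (\<alpha> * h) * L < b \<and> h > 0) (at_right 0)"
      using eventually_at_right_less by (rule eventually_conj)
    then obtain h where h: "exp (\<alpha> * h) * L < b" "h > 0"
      using eventually_happens' trivial_limit_at_right_real by blast
    have "((\<lambda>t. exp (\<alpha> * h) * (window h r t / h)) \<longlongrightarrow> exp (\<alpha> * h) * L) at_top"
      by (intro tendsto_intros win h)
    then have "eventually (\<lambda>t. exp (\<alpha> * h) * (window h r t / h) < b) at_top"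
      using h(1) by (rule order_tendstoD(2))
    then show "eventually (\<lambda>t. r t < b) at_top"
      by eventually_elim (use upper[OF h(2)] le_less_trans in blast)
  next
    fix b assume "b < L"
    have "eventually (\<lambda>h. exp (- \<alpha> * h) * L > b) (at_right 0)"
      by (rule order_tendstoD(1)[OF cont(2) \<open>b < L\<close>])
    then have "eventually (\<lambda>h. exp (- \<alpha> * h) * L > b \<and> h > 0) (at_right 0)"
      using eventually_at_right_less by (rule eventually_conj)
    then obtain h where h: "exp (- \<alpha> * h) * L > b" "h > 0"
      using eventually_happens' trivial_limit_at_right_real by blast
    have shift: "filterlim (\<lambda>t. t + h) at_top at_top"
      using filterlim_tendsto_add_at_top[OF tendsto_const[of h] filterlim_ident] by (simp add: add.commute)
    have "((\<lambda>t. exp (- \<alpha> * h) * (window h r (t + h) / h)) \<longlongrightarrow> exp (- \<alpha> * h) * L) at_top"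
      by (intro tendsto_mult tendsto_const filterlim_compose[OF win[OF h(2)] shift])
    then have "eventually (\<lambda>t. exp (- \<alpha> * h) * (window h r (t + h) / h) > b) at_top"
      using h(1) by (rule order_tendstoD(1))
    then show "eventually (\<lambda>t. r t > b) at_top"
      by eventually_elim (use lower[OF h(2)] less_le_trans in blast)
  qed
qed

context random_step
begin

lemma translate_integrable_of_growth:
  fixes f :: "'b \<Rightarrow> real"
  assumes [measurable]: "f \<in> borel_measurable Q" and f: "\<And>x. x \<in> space Q \<Longrightarrow> \<bar>f x\<bar> \<le> c * exp (\<epsilon> * (t - X x))"
    and "c \<ge> 0" and finite: "(\<integral>\<^sup>+x. ennreal (exp (- \<epsilon> * X x)) \<partial>Q) < \<infinity>"
  shows "integrable Q f"
proof (rule integrableI_bounded)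
  have "(\<integral>\<^sup>+x. ennreal (norm (f x)) \<partial>Q) \<le> (\<integral>\<^sup>+x. ennreal (c * exp (\<epsilon> * t)) * ennreal (exp (- \<epsilon> * X x)) \<partial>Q)"
  proof (rule nn_integral_mono)
    fix x assume "x \<in> space Q"
    have "c * exp (\<epsilon> * (t - X x)) = (c * exp (\<epsilon> * t)) * exp (- \<epsilon> * X x)"
      by (simp add: mult.assoc exp_add[symmetric] right_diff_distrib)
    with f[OF \<open>x \<in> space Q\<close>] show "ennreal (norm (f x)) \<le> ennreal (c * exp (\<epsilon> * t)) * ennreal (exp (- \<epsilon> * X x))"
      using \<open>c \<ge> 0\<close> by (subst ennreal_mult[symmetric]) (auto intro!: ennreal_leI)
  qed
  also have "\<dots> < \<infinity>"
    using finite by (subst nn_integral_cmult) (auto simp: ennreal_mult_less_top)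
  finally show "(\<integral>\<^sup>+x. ennreal (norm (f x)) \<partial>Q) < \<infinity>" .
qed measurable

end

context positive_drift
begin

text \<open>Boundedness of the window averages carries over to \<open>r\<close> by the monotonicity of \<open>exp (- \<alpha> * t) * r t\<close>.
  The averages then are bounded, Lipschitz, and asymptotically invariant under translations, which
  determines their limit.\<close>
theorem renewal_limit:
  fixes r g :: "real \<Rightarrow> real"
  assumes r [measurable]: "r \<in> borel_measurable borel" and nonneg: "\<And>t. 0 \<le> r t"
    and decr: "\<And>s t. s \<le> t \<Longrightarrow> r t \<le> exp (\<alpha> * (t - s)) * r s" and "\<alpha> > 0"
    and growth: "\<And>\<epsilon>. 0 < \<epsilon> \<Longrightarrow> \<epsilon> < \<alpha> \<Longrightarrow> \<exists>c. \<forall>t. r t \<le> c * exp (\<epsilon> * t)"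
    and g: "integrable lborel g"
    and eq: "\<And>t. r t = g t + (\<integral>x. r (t - X x) \<partial>Q)"
  shows "(r \<longlongrightarrow> rate * (\<integral>t. g t \<partial>lborel)) at_top"
    and "h > 0 \<Longrightarrow> (window h r \<longlongrightarrow> h * (rate * (\<integral>t. g t \<partial>lborel))) at_top"
    and "\<exists>A. \<forall>t. r t \<le> A"
proof -
  obtain \<epsilon> where \<epsilon>: "\<epsilon> > 0" "\<epsilon> < \<alpha>" "(\<integral>\<^sup>+x. ennreal (exp (- \<epsilon> * X x)) \<partial>Q) < 1"
    using ex_exponent[OF \<open>\<alpha> > 0\<close>] by blast
  have finite: "(\<integral>\<^sup>+x. ennreal (exp (- \<epsilon> * X x)) \<partial>Q) < \<infinity>"
    using \<epsilon>(3) by (rule less_trans) simp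
  obtain c where c: "\<And>t. r t \<le> c * exp (\<epsilon> * t)" using growth[OF \<epsilon>(1,2)] by blast
  have "c \<ge> 0" using nonneg[of 0] c[of 0] by simp
  have r_int: "integrable Q (\<lambda>x. r (t - X x))" for t
    by (rule translate_integrable_of_growth[where c=c and t=t, OF _ _ \<open>c \<ge> 0\<close> finite])
      (use c nonneg in auto)
  have ineq: "ennreal (r t) \<le> ennreal \<bar>g t\<bar> + (\<integral>\<^sup>+x. ennreal (r (t - X x)) \<partial>Q)" for t
  proof -
    have "r t \<le> \<bar>g t\<bar> + (\<integral>x. r (t - X x) \<partial>Q)" using eq[of t] by linarith
    then have "ennreal (r t) \<le> ennreal (\<bar>g t\<bar> + (\<integral>x. r (t - X x) \<partial>Q))" by (rule ennreal_leI)
    also have "\<dots> = ennreal \<bar>g t\<bar> + ennreal (\<integral>x. r (t - X x) \<partial>Q)"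
      by (rule ennreal_plus) (auto intro!: integral_nonneg_AE nonneg AE_I2)
    also have "ennreal (\<integral>x. r (t - X x) \<partial>Q) = (\<integral>\<^sup>+x. ennreal (r (t - X x)) \<partial>Q)"
      using nonneg by (intro nn_integral_eq_integral[symmetric] r_int) auto
    finally show ?thesis .
  qed
  obtain B where B: "\<And>t. (\<integral>\<^sup>+s. indicator {0..1} (t - s) * ennreal (r s) \<partial>lborel) \<le> ennreal B"
    using nonneg_window_bounded[OF r nonneg c \<epsilon>(1,3) g ineq] by blast
  have bdd: "r t \<le> exp \<alpha> * max B 0" for t
  proof -
    have "ennreal (exp (- \<alpha>) * r t) = (\<integral>\<^sup>+s. ennreal (exp (- \<alpha>) * r t) * indicator {t-1..t} s \<partial>lborel)"
      by (subst nn_integral_cmult_indicator) auto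
    also have "\<dots> \<le> (\<integral>\<^sup>+s. indicator {0..1} (t - s) * ennreal (r s) \<partial>lborel)"
    proof (rule nn_integral_mono)
      fix s
      have "exp (- \<alpha>) * r t \<le> r s" if "s \<in> {t-1..t}"
      proof -
        have "r t \<le> exp (\<alpha> * (t - s)) * r s" using that by (intro decr) auto
        also have "\<dots> \<le> exp \<alpha> * r s" using that \<open>\<alpha> > 0\<close> nonneg by (intro mult_right_mono) auto
        finally show ?thesis by (simp add: exp_minus field_simps)
      qed
      then show "ennreal (exp (- \<alpha>) * r t) * indicator {t-1..t} s \<le> indicator {0..1} (t - s) * ennreal (r s)"
        by (auto simp: indicator_def intro!: ennreal_leI)
    qed
    also have "\<dots> \<le> ennreal (max B 0)" by (rule order_trans[OF B]) (auto intro!: ennreal_leI)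
    finally have "exp (- \<alpha>) * r t \<le> max B 0" by (subst (asm) ennreal_le_iff) auto
    then show ?thesis by (simp add: exp_minus field_simps)
  qed
  then show "\<exists>A. \<forall>t. r t \<le> A" by blast
  have abs_bdd: "\<bar>r t\<bar> \<le> exp \<alpha> * max B 0" for t using bdd[of t] nonneg[of t] by simp
  have win: "(window h r \<longlongrightarrow> h * (rate * (\<integral>t. g t \<partial>lborel))) at_top" if "h > 0" for h
  proof -
    have "h \<ge> 0" using that by simp
    have eq1: "r t = g t + (\<integral>x. 1 * r (t - X x) \<partial>Q)" for t using eq[of t] by (simp only: mult_1)
    have w_eq: "window h r t = window h g t + (\<integral>x. window h r (t - X x) \<partial>Q)" for t
    proof -
      have "window h r t = window h g t + (\<integral>x. 1 * window h r (t - X x) \<partial>Q)"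
        by (rule window_renewal_equation[OF _ r _ abs_bdd \<open>h \<ge> 0\<close> g eq1]) auto
      then show ?thesis by (simp only: mult_1)
    qed
    have w_inv: "((\<lambda>t. window h r t - window h r (t - x)) \<longlongrightarrow> 0) at_top" for x
      by (rule window_translation_invariance(1)[OF _ r _ abs_bdd \<open>h \<ge> 0\<close> g eq1]) auto
    have w_nonneg: "0 \<le> window h r t" for t
      unfolding window_def by (intro integral_nonneg_AE AE_I2) (use nonneg in auto)
    have w_growth: "window h r t \<le> (h * c) * exp (\<epsilon> * t)" for t
    proof -
      have "window h r t \<le> (\<integral>s. indicator {t-h..t} s * (c * exp (\<epsilon> * t)) \<partial>lborel)"
        unfolding window_def
      proof (rule integral_mono[OF window_integrable[OF r abs_bdd]])
        show "integrable lborel (\<lambda>s. indicator {t-h..t} s * (c * exp (\<epsilon> * t)))"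
          by (rule integrable_indicator_Icc)
        fix s
        have "r s \<le> c * exp (\<epsilon> * t)" if "s \<le> t"
        proof -
          have "r s \<le> c * exp (\<epsilon> * s)" by (rule c)
          also have "\<dots> \<le> c * exp (\<epsilon> * t)" using that \<epsilon> \<open>c \<ge> 0\<close> by (intro mult_left_mono) auto
          finally show ?thesis .
        qed
        then show "indicator {t-h..t} s * r s \<le> indicator {t-h..t} s * (c * exp (\<epsilon> * t))"
          by (auto simp: indicator_def)
      qed
      then show ?thesis using \<open>h > 0\<close> by simp
    qed
    have w_bdd: "window h r t \<le> exp \<alpha> * max B 0 * h" for t
      using window_bound[OF r abs_bdd \<open>h \<ge> 0\<close>, of t] by linarith
    have "(window h r \<longlongrightarrow> rate * (\<integral>t. window h g t \<partial>lborel)) at_top"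
      by (rule invariant_solution_limit[OF window_measurable[OF r] w_nonneg w_growth \<epsilon>(1) finite w_bdd
            window_integral(1)[OF g \<open>h \<ge> 0\<close>] w_eq w_inv])
    then show ?thesis
      by (simp add: window_integral(2)[OF g \<open>h \<ge> 0\<close>] mult.left_commute)
  qed
  then show "h > 0 \<Longrightarrow> (window h r \<longlongrightarrow> h * (rate * (\<integral>t. g t \<partial>lborel))) at_top" .
  show "(r \<longlongrightarrow> rate * (\<integral>t. g t \<partial>lborel)) at_top"
    by (rule tauberian_window[OF r nonneg bdd decr \<open>\<alpha> > 0\<close> win])
qed

text \<open>The sum of the two functions satisfies the equation without signs. Their difference satisfies the
  equation with the sign \<open>S\<close> inside the mean, which forces its window averages to vanish at infinity. Hence
  the two functions share the limit of their sum equally.\<close>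
theorem signed_renewal_limit:
  fixes rp rm gp gm :: "real \<Rightarrow> real" and S :: "'b \<Rightarrow> real"
  assumes S_meas [measurable]: "S \<in> borel_measurable Q"
    and S: "\<And>x. x \<in> space Q \<Longrightarrow> S x \<in> {1, -1}" and neg: "\<not> (AE x in Q. S x = 1)"
    and rp [measurable]: "rp \<in> borel_measurable borel" and rm [measurable]: "rm \<in> borel_measurable borel"
    and nonneg: "\<And>t. 0 \<le> rp t" "\<And>t. 0 \<le> rm t"
    and decr: "\<And>s t. s \<le> t \<Longrightarrow> rp t \<le> exp (\<alpha> * (t - s)) * rp s"
      "\<And>s t. s \<le> t \<Longrightarrow> rm t \<le> exp (\<alpha> * (t - s)) * rm s" and "\<alpha> > 0"
    and growth: "\<And>\<epsilon>. 0 < \<epsilon> \<Longrightarrow> \<epsilon> < \<alpha> \<Longrightarrow> \<exists>c. \<forall>t. rp t + rm t \<le> c * exp (\<epsilon> * t)"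
    and gp: "integrable lborel gp" and gm: "integrable lborel gm"
    and eqp: "\<And>t. rp t = gp t + (\<integral>x. (if S x = 1 then rp (t - X x) else rm (t - X x)) \<partial>Q)"
    and eqm: "\<And>t. rm t = gm t + (\<integral>x. (if S x = 1 then rm (t - X x) else rp (t - X x)) \<partial>Q)"
  shows "(rp \<longlongrightarrow> rate * ((\<integral>t. gp t \<partial>lborel) + (\<integral>t. gm t \<partial>lborel)) / 2) at_top"
    and "(rm \<longlongrightarrow> rate * ((\<integral>t. gp t \<partial>lborel) + (\<integral>t. gm t \<partial>lborel)) / 2) at_top"
proof -
  define r where "r t = rp t + rm t" for t
  define y where "y t = rp t - rm t" for t
  have r_meas [measurable]: "r \<in> borel_measurable borel" and y_meas [measurable]: "y \<in> borel_measurable borel"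
    unfolding r_def y_def by measurable
  let ?P = "\<lambda>t x. if S x = 1 then rp (t - X x) else rm (t - X x)"
  let ?M = "\<lambda>t x. if S x = 1 then rm (t - X x) else rp (t - X x)"
  have int: "integrable Q (?P t)" "integrable Q (?M t)" for t
  proof -
    obtain \<epsilon> where \<epsilon>: "\<epsilon> > 0" "\<epsilon> < \<alpha>" "(\<integral>\<^sup>+x. ennreal (exp (- \<epsilon> * X x)) \<partial>Q) < 1"
      using ex_exponent[OF \<open>\<alpha> > 0\<close>] by blast
    have finite: "(\<integral>\<^sup>+x. ennreal (exp (- \<epsilon> * X x)) \<partial>Q) < \<infinity>"
      using \<epsilon>(3) by (rule less_trans) simp
    obtain c where c: "\<And>t. rp t + rm t \<le> c * exp (\<epsilon> * t)" using growth[OF \<epsilon>(1,2)] by blast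
    have "c \<ge> 0" using nonneg[of 0] c[of 0] by simp
    have b: "\<bar>rp u\<bar> \<le> c * exp (\<epsilon> * u)" "\<bar>rm u\<bar> \<le> c * exp (\<epsilon> * u)" for u
      using nonneg[of u] c[of u] by linarith+
    have P: "?P t \<in> borel_measurable Q" and M: "?M t \<in> borel_measurable Q" by measurable
    show "integrable Q (?P t)" by (rule translate_integrable_of_growth[where t=t, OF P _ \<open>c \<ge> 0\<close> finite]) (simp add: b)
    show "integrable Q (?M t)" by (rule translate_integrable_of_growth[where t=t, OF M _ \<open>c \<ge> 0\<close> finite]) (simp add: b)
  qed
  have r_eq: "r t = (gp t + gm t) + (\<integral>x. r (t - X x) \<partial>Q)" for t
  proof -
    have "(\<integral>x. r (t - X x) \<partial>Q) = (\<integral>x. ?P t x + ?M t x \<partial>Q)"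
    proof (rule Bochner_Integration.integral_cong[OF refl])
      fix x assume "x \<in> space Q"
      then show "r (t - X x) = ?P t x + ?M t x" using S[of x] by (auto simp: r_def)
    qed
    moreover have "(\<integral>x. ?P t x + ?M t x \<partial>Q) = (\<integral>x. ?P t x \<partial>Q) + (\<integral>x. ?M t x \<partial>Q)"
      by (rule Bochner_Integration.integral_add[OF int(1)[of t] int(2)[of t]])
    ultimately show ?thesis unfolding r_def[of t] using eqp[of t] eqm[of t] by linarith
  qed
  have y_eq: "y t = (gp t - gm t) + (\<integral>x. S x * y (t - X x) \<partial>Q)" for t
  proof -
    have "(\<integral>x. S x * y (t - X x) \<partial>Q) = (\<integral>x. ?P t x - ?M t x \<partial>Q)"
    proof (rule Bochner_Integration.integral_cong[OF refl])
      fix x assume "x \<in> space Q"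
      then show "S x * y (t - X x) = ?P t x - ?M t x" using S[of x] by (auto simp: y_def)
    qed
    moreover have "(\<integral>x. ?P t x - ?M t x \<partial>Q) = (\<integral>x. ?P t x \<partial>Q) - (\<integral>x. ?M t x \<partial>Q)"
      by (rule Bochner_Integration.integral_diff[OF int(1)[of t] int(2)[of t]])
    ultimately show ?thesis unfolding y_def[of t] using eqp[of t] eqm[of t] by linarith
  qed
  have g: "integrable lborel (\<lambda>t. gp t + gm t)" "integrable lborel (\<lambda>t. gp t - gm t)"
    using gp gm by auto
  have r_nonneg: "0 \<le> r t" for t using nonneg[of t] by (simp add: r_def)
  have r_decr: "r t \<le> exp (\<alpha> * (t - s)) * r s" if "s \<le> t" for s t
    using decr[OF that] by (simp add: r_def distrib_left)
  obtain A where A: "\<And>t. r t \<le> A"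
    using renewal_limit(3)[OF r_meas r_nonneg r_decr \<open>\<alpha> > 0\<close> growth[folded r_def] g(1) r_eq] by blast
  have bdd: "\<bar>rp t\<bar> \<le> A" "\<bar>rm t\<bar> \<le> A" "rp t \<le> A" "rm t \<le> A" "\<bar>y t\<bar> \<le> A" "\<bar>r t\<bar> \<le> A" for t
    using A[of t] nonneg[of t] by (auto simp: r_def y_def)
  define L where "L = rate * ((\<integral>t. gp t \<partial>lborel) + (\<integral>t. gm t \<partial>lborel))"
  have y_win: "(window h y \<longlongrightarrow> 0) at_top" if "h > 0" for h
    by (rule window_translation_invariance(2)[OF S_meas y_meas S bdd(5) _ g(2) y_eq neg]) (use that in auto)
  have r_win: "(window h r \<longlongrightarrow> h * L) at_top" if "h > 0" for h
    using renewal_limit(2)[OF r_meas r_nonneg r_decr \<open>\<alpha> > 0\<close> growth[folded r_def] g(1) r_eq that] gp gm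
    by (simp add: L_def)
  have lim: "(f \<longlongrightarrow> L / 2) at_top" if f [measurable]: "f \<in> borel_measurable borel" and "\<And>t. 0 \<le> f t" "\<And>t. f t \<le> A"
    and dec: "\<And>s t. s \<le> t \<Longrightarrow> f t \<le> exp (\<alpha> * (t - s)) * f s" and e: "\<And>t. f t = (r t + e * y t) / 2" for f e
  proof (rule tauberian_window[OF that(1,2,3) dec \<open>\<alpha> > 0\<close>])
    fix h :: real assume "h > 0"
    have "window h f = (\<lambda>t. (window h r t + e * window h y t) / 2)"
    proof
      fix t
      have "window h f t = (\<integral>s. (indicator {t-h..t} s * r s + e * (indicator {t-h..t} s * y s)) / 2 \<partial>lborel)"
        unfolding window_def by (intro Bochner_Integration.integral_cong) (auto simp: e algebra_simps)
      also have "\<dots> = (window h r t + e * window h y t) / 2"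
        unfolding window_def
        using window_integrable[OF r_meas bdd(6)] window_integrable[OF y_meas bdd(5)] by simp
      finally show "window h f t = (window h r t + e * window h y t) / 2" .
    qed
    moreover have "((\<lambda>t. (window h r t + e * window h y t) / 2) \<longlongrightarrow> (h * L + e * 0) / 2) at_top"
      by (intro tendsto_intros r_win y_win \<open>h > 0\<close>) auto
    ultimately show "(window h f \<longlongrightarrow> h * (L / 2)) at_top" by simp
  qed
  show "(rp \<longlongrightarrow> rate * ((\<integral>t. gp t \<partial>lborel) + (\<integral>t. gm t \<partial>lborel)) / 2) at_top"
    unfolding L_def[symmetric] by (rule lim[of rp 1, OF rp nonneg(1) bdd(3) decr(1)]) (auto simp: r_def y_def)
  show "(rm \<longlongrightarrow> rate * ((\<integral>t. gp t \<partial>lborel) + (\<integral>t. gm t \<partial>lborel)) / 2) at_top"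
    unfolding L_def[symmetric] by (rule lim[of rm "-1", OF rm nonneg(2) bdd(4) decr(2)]) (auto simp: r_def y_def)
qed

end

section \<open>Extended-valued integrals\<close>

lemma suminf_ereal_eq_diff:
  fixes a :: "nat \<Rightarrow> real"
  assumes fin: "(\<Sum>j. ennreal (- a j)) < \<infinity>"
  shows "(\<Sum>j. ereal (a j)) = enn2ereal (\<Sum>j. ennreal (a j)) - enn2ereal (\<Sum>j. ennreal (- a j))"
proof (rule sums_unique[symmetric])
  have part: "(\<Sum>j<n. ereal (a j)) = enn2ereal (\<Sum>j<n. ennreal (a j)) - enn2ereal (\<Sum>j<n. ennreal (- a j))" for n
  proof -
    have "enn2ereal (\<Sum>j<n. ennreal (b j)) = ereal (\<Sum>j<n. max 0 (b j))" for b :: "nat \<Rightarrow> real"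
    proof -
      have "(\<Sum>j<n. ennreal (b j)) = (\<Sum>j<n. ennreal (max 0 (b j)))"
        by (intro sum.cong) (auto simp: max_def ennreal_neg)
      also have "\<dots> = ennreal (\<Sum>j<n. max 0 (b j))" by (rule sum_ennreal) simp
      finally show ?thesis by (simp add: enn2ereal_ennreal sum_nonneg)
    qed
    moreover have "(\<Sum>j<n. a j) = (\<Sum>j<n. max 0 (a j)) - (\<Sum>j<n. max 0 (- a j))"
      by (subst sum_subtractf[symmetric]) (intro sum.cong, auto simp: max_def)
    ultimately show ?thesis by simp
  qed
  have "(\<lambda>n. enn2ereal (\<Sum>j<n. ennreal (b j))) \<longlonglongrightarrow> enn2ereal (\<Sum>j. ennreal (b j))" for b :: "nat \<Rightarrow> real"
    by (intro continuous_on_tendsto_compose[OF continuous_on_enn2ereal] summable_LIMSEQ) auto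
  moreover have not_MInf: "enn2ereal x \<noteq> - \<infinity>" for x using enn2ereal_nonneg[of x] by auto
  ultimately have "(\<lambda>n. enn2ereal (\<Sum>j<n. ennreal (a j)) - enn2ereal (\<Sum>j<n. ennreal (- a j)))
      \<longlonglongrightarrow> enn2ereal (\<Sum>j. ennreal (a j)) - enn2ereal (\<Sum>j. ennreal (- a j))"
    using fin not_MInf by (intro tendsto_diff_ereal_general) (auto simp: less_top)
  then show "(\<lambda>j. ereal (a j)) sums (enn2ereal (\<Sum>j. ennreal (a j)) - enn2ereal (\<Sum>j. ennreal (- a j)))"
    unfolding sums_def part .
qed

lemma ennreal_finiteE: assumes "q \<noteq> (\<infinity>::ennreal)" obtains b where "b \<ge> 0" "q = ennreal b"
  using assms by (cases q) auto
lemma e2ennreal_minus_diff: assumes "q \<noteq> \<infinity>" shows "e2ennreal (- (enn2ereal p - enn2ereal q)) = q - p" 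
proof -
  obtain b where b: "b \<ge> 0" "q = ennreal b" using assms by (rule ennreal_finiteE)
  show ?thesis
  proof (cases "p = \<infinity>")
    case True then show ?thesis using b by (simp add: e2ennreal_neg)
  next
    case False
    then obtain a where "a \<ge> 0" "p = ennreal a" by (rule ennreal_finiteE)
    then show ?thesis using b by (simp add: ennreal_minus)
  qed
qed
lemma ennreal_diff_balance: "(p - q) + q = p + (q - p)" if "q \<noteq> \<infinity>" for p q :: ennreal
proof (cases "p \<le> q")
  case True
  then show ?thesis using that by (metis add.commute add_0 add_diff_inverse_ennreal diff_eq_0_iff_ennreal infinity_ennreal_def less_top not_le_imp_less order_le_less_trans)
next
  case False
  then have "q \<le> p" by simp
  then have "q - p = 0" using that by (simp add: diff_eq_0_iff_ennreal less_top)
  then show ?thesis using \<open>q \<le> p\<close> by (simp add: diff_add_cancel_ennreal)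
qed
lemma enn2ereal_diff_eq: "enn2ereal a - enn2ereal d = enn2ereal p - enn2ereal q"
    if eq: "a + q = p + d" and fin: "q < \<infinity>" "d < \<infinity>" for a d p q :: ennreal
proof -
  have "q \<noteq> \<infinity>" "d \<noteq> \<infinity>" using fin by auto
  obtain r where r: "r \<ge> 0" "q = ennreal r" using \<open>q \<noteq> \<infinity>\<close> by (rule ennreal_finiteE)
  obtain s where s: "s \<ge> 0" "d = ennreal s" using \<open>d \<noteq> \<infinity>\<close> by (rule ennreal_finiteE)
  show ?thesis
  proof (cases "p = \<infinity>")
    case True
    then have "a = \<infinity>" using eq r by auto
    then show ?thesis using True r s by simp
  next
    case False
    then obtain u where u: "u \<ge> 0" "p = ennreal u" by (rule ennreal_finiteE)
    have "a \<noteq> \<infinity>" using eq[symmetric] u r s by auto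
    then obtain v where v: "v \<ge> 0" "a = ennreal v" by (rule ennreal_finiteE)
    have "ennreal (v + r) = ennreal (u + s)" using eq u v r s by simp
    then have "v + r = u + s" using u v r s by (subst (asm) ennreal_inj) auto
    then show ?thesis using u v r s by simp
  qed
qed
text \<open>Truncated subtraction of \<open>ennreal\<close> yields the positive part \<open>P - n\<close> and the negative part \<open>n - P\<close>. The
  balance \<open>(P - n) + n = P + (n - P)\<close> involves sums only and can therefore be integrated.\<close>
lemma ext_integral_diff:
  assumes [measurable]: "P \<in> borel_measurable M" "n \<in> borel_measurable M"
    and fin: "(\<integral>\<^sup>+x. n x \<partial>M) < \<infinity>"
    and f: "AE x in M. f x = enn2ereal (P x) - enn2ereal (n x)"
  shows "ext_integral M f = enn2ereal (\<integral>\<^sup>+x. P x \<partial>M) - enn2ereal (\<integral>\<^sup>+x. n x \<partial>M)"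
proof -
  have n_fin: "AE x in M. n x \<noteq> \<infinity>" using fin by (intro nn_integral_noteq_infinite) auto
  have pos: "(\<integral>\<^sup>+x. e2ennreal (f x) \<partial>M) = (\<integral>\<^sup>+x. P x - n x \<partial>M)"
    by (rule nn_integral_cong_AE) (use f n_fin in \<open>eventually_elim, simp\<close>)
  have neg: "(\<integral>\<^sup>+x. e2ennreal (- f x) \<partial>M) = (\<integral>\<^sup>+x. n x - P x \<partial>M)"
    by (rule nn_integral_cong_AE) (use f n_fin in \<open>eventually_elim, simp add: e2ennreal_minus_diff\<close>)
  have "(\<integral>\<^sup>+x. P x - n x \<partial>M) + (\<integral>\<^sup>+x. n x \<partial>M) = (\<integral>\<^sup>+x. (P x - n x) + n x \<partial>M)"
    by (rule nn_integral_add[symmetric]) measurable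
  also have "\<dots> = (\<integral>\<^sup>+x. P x + (n x - P x) \<partial>M)"
  proof (rule nn_integral_cong_AE)
    show "AE x in M. (P x - n x) + n x = P x + (n x - P x)"
      using n_fin by eventually_elim (rule ennreal_diff_balance)
  qed
  also have "\<dots> = (\<integral>\<^sup>+x. P x \<partial>M) + (\<integral>\<^sup>+x. n x - P x \<partial>M)"
    by (rule nn_integral_add) measurable
  finally have eq: "(\<integral>\<^sup>+x. P x - n x \<partial>M) + (\<integral>\<^sup>+x. n x \<partial>M) = (\<integral>\<^sup>+x. P x \<partial>M) + (\<integral>\<^sup>+x. n x - P x \<partial>M)" .
  have "(\<integral>\<^sup>+x. n x - P x \<partial>M) \<le> (\<integral>\<^sup>+x. n x \<partial>M)"
    by (intro nn_integral_mono) (simp add: diff_le_self_ennreal)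
  then have fin': "(\<integral>\<^sup>+x. n x - P x \<partial>M) < \<infinity>" using fin by (rule le_less_trans)
  from enn2ereal_diff_eq[OF eq fin fin'] show ?thesis unfolding ext_integral_def pos neg .
qed

lemma ext_integral_real:
  assumes f: "integrable M f"
  shows "ext_integral M (\<lambda>x. ereal (f x)) = ereal (\<integral>x. f x \<partial>M)"
proof -
  have [measurable]: "f \<in> borel_measurable M" using f by simp
  have fin: "(\<integral>\<^sup>+x. ennreal (f x) \<partial>M) < \<infinity>" "(\<integral>\<^sup>+x. ennreal (- f x) \<partial>M) < \<infinity>"
    using f by (auto simp: real_integrable_def less_top)
  have "ext_integral M (\<lambda>x. ereal (f x)) = enn2ereal (\<integral>\<^sup>+x. ennreal (f x) \<partial>M) - enn2ereal (\<integral>\<^sup>+x. ennreal (- f x) \<partial>M)"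
    by (simp add: ext_integral_def)
  also have "\<dots> = ereal (\<integral>x. f x \<partial>M)"
    unfolding real_lebesgue_integral_def[OF f] using fin
    by (cases "\<integral>\<^sup>+x. ennreal (f x) \<partial>M"; cases "\<integral>\<^sup>+x. ennreal (- f x) \<partial>M") (auto simp: enn2ereal_ennreal)
  finally show ?thesis .
qed

section \<open>The substitution by the exponential function\<close>

text \<open>Under \<open>v = exp u\<close> the Lebesgue measure \<open>du\<close> corresponds to \<open>dv / v\<close> on the positive half-line.\<close>
lemma lborel_eq_distr_ln:
  "lborel = distr (density lborel (\<lambda>v. ennreal (1 / v) * indicator {0<..} v)) borel (ln :: real \<Rightarrow> real)"
proof (rule lborel_eqI)
  fix l u :: real assume lu: "\<And>b. b \<in> Basis \<Longrightarrow> l \<bullet> b \<le> u \<bullet> b"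
  then have "l \<le> u" by simp
  have ln_meas: "(ln :: real \<Rightarrow> real) \<in> borel_measurable borel" by measurable
  have "emeasure (distr (density lborel (\<lambda>v. ennreal (1 / v) * indicator {0<..} v)) borel ln) (box l u)
      = (\<integral>\<^sup>+v. ennreal (1 / v) * indicator {0<..} v * indicator (ln -` box l u \<inter> UNIV) v \<partial>lborel)"
    using measurable_sets[OF ln_meas, of "box l u"]
    by (subst emeasure_distr) (auto intro!: emeasure_density)
  also have "\<dots> = (\<integral>\<^sup>+v. ennreal (1 / v) * indicator {exp l..exp u} v \<partial>lborel)"
  proof (rule nn_integral_cong_AE)
    have "AE v in lborel. v \<noteq> exp l" "AE v in lborel. v \<noteq> exp u"
      by (auto intro!: AE_lborel_singleton)
    then show "AE v in lborel. ennreal (1 / v) * indicator {0<..} v * indicator (ln -` box l u \<inter> UNIV) v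
        = ennreal (1 / v) * indicator {exp l..exp u} v"
    proof eventually_elim
      case (elim v)
      show ?case
      proof (cases "v > 0")
        case True
        then have "l < ln v \<longleftrightarrow> exp l < v" "ln v < u \<longleftrightarrow> v < exp u"
          by (metis exp_less_cancel_iff exp_ln)+
        then show ?thesis using True elim by (auto simp: indicator_def)
      next
        case False
        then have "\<not> exp l \<le> v" using exp_gt_zero[of l] by linarith
        then show ?thesis using False by (auto simp: indicator_def)
      qed
    qed
  qed
  also have "\<dots> = ennreal (ln (exp u) - ln (exp l))"
  proof (rule nn_integral_FTC_Icc)
    show "exp l \<le> exp u" using \<open>l \<le> u\<close> by simp
    fix v assume "v \<in> {exp l..exp u}"
    then have "exp l \<le> v" by simp
    then have "v > 0" using exp_gt_zero[of l] by linarith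
    then show "(ln has_real_derivative 1 / v) (at v)" "0 \<le> 1 / v"
      by (auto intro: DERIV_ln_divide)
  qed auto
  finally show "emeasure (distr (density lborel (\<lambda>v. ennreal (1 / v) * indicator {0<..} v)) borel ln) (box l u)
      = (\<Prod>b\<in>Basis. (u - l) \<bullet> b)" by simp
qed simp

lemma nn_integral_exp_substitution:
  assumes [measurable]: "f \<in> borel_measurable borel"
  shows "(\<integral>\<^sup>+u. f u \<partial>lborel) = (\<integral>\<^sup>+v. ennreal (1 / v) * f (ln v) * indicator {0<..} v \<partial>lborel)"
proof -
  have "(\<integral>\<^sup>+u. f u \<partial>lborel)
      = (\<integral>\<^sup>+u. f u \<partial>distr (density lborel (\<lambda>v. ennreal (1 / v) * indicator {0<..} v)) borel ln)"
    by (subst lborel_eq_distr_ln) (rule refl)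
  also have "\<dots> = (\<integral>\<^sup>+v. ennreal (1 / v) * f (ln v) * indicator {0<..} v \<partial>lborel)"
    by (subst nn_integral_distr; (subst nn_integral_density)?) (auto intro!: nn_integral_cong simp: ac_simps)
  finally show ?thesis .
qed

lemma nn_integral_exp_substitution_real:
  fixes g :: "real \<Rightarrow> real"
  assumes [measurable]: "g \<in> borel_measurable borel"
  shows "(\<integral>\<^sup>+u. ennreal (g u) \<partial>lborel) = (\<integral>\<^sup>+v. ennreal (g (ln v) / v) * indicator {0<..} v \<partial>lborel)"
  by (subst nn_integral_exp_substitution)
    (auto intro!: nn_integral_cong simp: indicator_def ennreal_mult'[symmetric])

lemma ext_integral_exp_substitution:
  fixes g :: "real \<Rightarrow> real"
  assumes int: "integrable lborel g"
  shows "ext_integral (restrict_space lborel {0<..}) (\<lambda>v. ereal (g (ln v) / v)) = ereal (\<integral>u. g u \<partial>lborel)"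
proof -
  have [measurable]: "g \<in> borel_measurable borel" using int by simp
  have "ext_integral (restrict_space lborel {0<..}) (\<lambda>v. ereal (g (ln v) / v)) = ext_integral lborel (\<lambda>u. ereal (g u))"
    unfolding ext_integral_def
    by (subst (1 2) nn_integral_restrict_space) (auto simp: nn_integral_exp_substitution_real)
  also have "\<dots> = ereal (\<integral>u. g u \<partial>lborel)" by (rule ext_integral_real[OF int])
  finally show ?thesis .
qed

lemma ext_integral_cong:
  assumes "\<And>x. x \<in> space M \<Longrightarrow> f x = g x"
  shows "ext_integral M f = ext_integral M g"
  unfolding ext_integral_def
  by (intro arg_cong2[where f="(-)"] arg_cong[where f=enn2ereal] nn_integral_cong) (simp_all add: assms)

lemma tail_diff_logarithmic_scale:
  assumes [measurable]: "d \<in> borel_measurable borel"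
    and T: "\<And>v. v > 0 \<Longrightarrow> tail_diff M N Y Z v = ereal (v powr (- \<alpha>) * d (ln v))"
  shows "tail_diff_integrable M \<alpha> N Y Z \<longleftrightarrow> integrable lborel d"
    and "integrable lborel d \<Longrightarrow> tail_diff_integral M \<alpha> N Y Z = ereal (\<integral>u. d u \<partial>lborel)"
proof -
  have pw: "v powr (\<alpha> - 1) * v powr (- \<alpha>) = 1 / v" if "v > 0" for v
    using that by (simp only: powr_add[symmetric]) (simp add: powr_neg_one)
  have "(\<integral>\<^sup>+v\<in>{0<..}. e2ennreal (\<bar>tail_diff M N Y Z v\<bar> * ereal (v powr (\<alpha> - 1))) \<partial>lborel)
      = (\<integral>\<^sup>+v. ennreal (\<bar>d (ln v)\<bar> / v) * indicator {0<..} v \<partial>lborel)"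
  proof (rule nn_integral_cong)
    fix v :: real
    show "e2ennreal (\<bar>tail_diff M N Y Z v\<bar> * ereal (v powr (\<alpha> - 1))) * indicator {0<..} v
        = ennreal (\<bar>d (ln v)\<bar> / v) * indicator {0<..} v"
    proof (cases "v > 0")
      case True
      have "\<bar>v powr (- \<alpha>) * d (ln v)\<bar> * v powr (\<alpha> - 1) = \<bar>d (ln v)\<bar> * (v powr (\<alpha> - 1) * v powr (- \<alpha>))"
        by (simp add: abs_mult)
      also have "\<dots> = \<bar>d (ln v)\<bar> / v" unfolding pw[OF True] by simp
      finally show ?thesis using True by (simp add: T)
    qed simp
  qed
  also have "\<dots> = (\<integral>\<^sup>+u. ennreal (norm (d u)) \<partial>lborel)"
    by (subst nn_integral_exp_substitution_real) simp_all
  finally show "tail_diff_integrable M \<alpha> N Y Z \<longleftrightarrow> integrable lborel d"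
    by (simp add: tail_diff_integrable_def integrable_iff_bounded)
  assume d: "integrable lborel d"
  have "tail_diff_integral M \<alpha> N Y Z = ext_integral (restrict_space lborel {0<..}) (\<lambda>v. ereal (d (ln v) / v))"
    unfolding tail_diff_integral_def
  proof (rule ext_integral_cong)
    fix v :: real assume "v \<in> space (restrict_space lborel {0<..})"
    then have v: "v > 0" by (simp add: space_restrict_space)
    have "v powr (\<alpha> - 1) * (v powr (- \<alpha>) * d (ln v)) = d (ln v) / v"
      unfolding mult.assoc[symmetric] pw[OF v] by simp
    then show "ereal (v powr (\<alpha> - 1)) * tail_diff M N Y Z v = ereal (d (ln v) / v)" by (simp add: T[OF v])
  qed
  then show "tail_diff_integral M \<alpha> N Y Z = ereal (\<integral>u. d u \<partial>lborel)"
    by (simp add: ext_integral_exp_substitution[OF d])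
qed

section \<open>The exponentially tilted law of the weights\<close>

locale weighted_branching = prob_space M for M :: "'a measure" +
  fixes \<alpha> :: real and N :: "'a \<Rightarrow> enat" and C :: "nat \<Rightarrow> 'a \<Rightarrow> real" and R :: "'a \<Rightarrow> real"
  assumes \<alpha>_pos: "\<alpha> > 0"
    and weights_measurable: "weight_vector N C \<in> M \<rightarrow>\<^sub>M weight_space"
    and nonlattice: "\<exists>j\<ge>1. \<not> lattice_measure (log_weight_measure M N C j)"
    and log_moment_pos: "log_moment M N C \<alpha> > 0"
    and weight_moment_one: "weight_moment M N C \<alpha> = 1"
    and weight_moment_finite: "\<exists>\<gamma>. 0 \<le> \<gamma> \<and> \<gamma> < \<alpha> \<and> weight_moment M N C \<gamma> < \<infinity>"
    and R_measurable [measurable]: "R \<in> borel_measurable M"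
    and indep: "indep_of_weights M N C R"
begin

text \<open>The weights padded by 0. The bound \<open>1 \<le> j\<close> discards the index 0, over which the sums of type \<open>nat\<close>
  range as well.\<close>
definition weight :: "nat \<Rightarrow> 'a \<Rightarrow> real" where
  "weight j \<omega> = (if 1 \<le> j \<and> enat j \<le> N \<omega> then C j \<omega> else 0)"

lemma weight_eq: "1 \<le> j \<Longrightarrow> weight j \<omega> = snd (weight_vector N C \<omega>) j"
  by (simp add: weight_def weight_vector_def)

lemma component_measurable:
  assumes "1 \<le> j"
  shows "(\<lambda>w. snd w j) \<in> borel_measurable weight_space"
  unfolding weight_space_def
  by (rule measurable_compose[OF measurable_snd measurable_component_singleton]) (use assms in simp)

lemma weight_measurable [measurable]: "weight j \<in> borel_measurable M"
proof (cases "1 \<le> j")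
  case True
  have "(\<lambda>\<omega>. snd (weight_vector N C \<omega>) j) \<in> borel_measurable M"
    by (rule measurable_compose[OF weights_measurable component_measurable[OF True]])
  then show ?thesis by (simp add: weight_eq[OF True] cong: measurable_cong)
next
  case False
  then have "weight j = (\<lambda>_. 0)" by (auto simp: weight_def)
  then show ?thesis by simp
qed

lemma sum_upto_eq:
  assumes "F 0 = 0"
  shows "sum_upto (N \<omega>) (\<lambda>j. F (C j \<omega>)) = (\<Sum>j. F (weight j \<omega>))"
  unfolding sum_upto_def weight_def by (intro arg_cong[where f=suminf] ext) (use assms in auto)

lemma Int_stable_vimages: "Int_stable {f -` A \<inter> space M | A. A \<in> sets K}"
proof (rule Int_stableI, clarify)
  fix A B assume "A \<in> sets K" "B \<in> sets K"
  then show "\<exists>D. f -` A \<inter> space M \<inter> (f -` B \<inter> space M) = f -` D \<inter> space M \<and> D \<in> sets K"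
    by (intro exI[of _ "A \<inter> B"]) auto
qed

lemma weight_indep: "indep_var borel R borel (weight j)"
proof -
  have ind: "indep_set {R -` A \<inter> space M | A. A \<in> sets borel}
      {weight_vector N C -` B \<inter> space M | B. B \<in> sets weight_space}"
    using indep unfolding indep_of_weights_def .
  have sub: "{weight j -` A \<inter> space M | A. A \<in> sets borel}
      \<subseteq> {weight_vector N C -` B \<inter> space M | B. B \<in> sets weight_space}"
  proof (cases "1 \<le> j")
    case True
    show ?thesis
    proof safe
      fix A :: "real set" assume A: "A \<in> sets borel"
      let ?B = "(\<lambda>w. snd w j) -` A \<inter> space weight_space"
      have "?B \<in> sets weight_space" using component_measurable[OF True] A by (rule measurable_sets)
      moreover have "weight j -` A \<inter> space M = weight_vector N C -` ?B \<inter> space M"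
        using measurable_space[OF weights_measurable] by (auto simp: weight_eq[OF True])
      ultimately show "\<exists>B. weight j -` A \<inter> space M = weight_vector N C -` B \<inter> space M \<and> B \<in> sets weight_space"
        by blast
    qed
  next
    case False
    then have weight_0: "weight j = (\<lambda>_. 0)" by (auto simp: weight_def)
    show ?thesis
    proof safe
      fix A :: "real set"
      have "weight j -` A \<inter> space M = weight_vector N C -` (if 0 \<in> A then space weight_space else {}) \<inter> space M"
        using measurable_space[OF weights_measurable] by (auto simp: weight_0)
      then show "\<exists>B. weight j -` A \<inter> space M = weight_vector N C -` B \<inter> space M \<and> B \<in> sets weight_space"
        by (intro exI[of _ "if 0 \<in> A then space weight_space else {}"]) auto
    qed
  qed
  have "indep_set {R -` A \<inter> space M | A. A \<in> sets borel} {weight j -` A \<inter> space M | A. A \<in> sets borel}"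
  proof (rule indep_setI)
    fix a b assume "a \<in> {R -` A \<inter> space M | A. A \<in> sets borel}" "b \<in> {weight j -` A \<inter> space M | A. A \<in> sets borel}"
    then show "prob (a \<inter> b) = prob a * prob b" by (intro indep_setD[OF ind]) (use sub in blast)+
  qed (use measurable_sets[OF R_measurable] measurable_sets[OF weight_measurable] in blast)+
  then show ?thesis
    unfolding indep_var_eq by (intro conjI indep_set_sigma_sets Int_stable_vimages R_measurable weight_measurable)
qed

text \<open>By independence the joint law of a weight and \<open>R\<close> is a product, so \<open>R\<close> can be resampled.\<close>
lemma nn_integral_weight_R:
  fixes F :: "real \<Rightarrow> real \<Rightarrow> ennreal"
  assumes [measurable]: "(\<lambda>p. F (fst p) (snd p)) \<in> borel_measurable (borel \<Otimes>\<^sub>M borel)"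
  shows "(\<integral>\<^sup>+\<omega>. F (weight j \<omega>) (R \<omega>) \<partial>M) = (\<integral>\<^sup>+\<omega>. (\<integral>\<^sup>+\<omega>'. F (weight j \<omega>) (R \<omega>') \<partial>M) \<partial>M)"
proof -
  interpret dR: prob_space "distr M borel R" by (rule prob_space_distr) simp
  interpret dc: prob_space "distr M borel (weight j)" by (rule prob_space_distr) simp
  interpret pair_sigma_finite "distr M borel R" "distr M borel (weight j)" ..
  have joint: "distr M borel R \<Otimes>\<^sub>M distr M borel (weight j) = distr M (borel \<Otimes>\<^sub>M borel) (\<lambda>\<omega>. (R \<omega>, weight j \<omega>))"
    using weight_indep[of j] unfolding indep_var_distribution_eq by blast
  have F' [measurable]: "(\<lambda>p. F (snd p) (fst p)) \<in> borel_measurable (borel \<Otimes>\<^sub>M borel)"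
    using measurable_compose[OF measurable_pair_swap' assms] by (simp add: case_prod_beta)
  have sets_eq: "borel_measurable (distr M borel R \<Otimes>\<^sub>M distr M borel (weight j)) = borel_measurable (borel \<Otimes>\<^sub>M borel)"
    by (intro measurable_cong_sets sets_pair_measure_cong) auto
  have "(\<integral>\<^sup>+\<omega>. F (weight j \<omega>) (R \<omega>) \<partial>M)
      = (\<integral>\<^sup>+p. F (snd p) (fst p) \<partial>distr M (borel \<Otimes>\<^sub>M borel) (\<lambda>\<omega>. (R \<omega>, weight j \<omega>)))"
    by (subst nn_integral_distr) auto
  also have "\<dots> = (\<integral>\<^sup>+y. (\<integral>\<^sup>+x. F y x \<partial>distr M borel R) \<partial>distr M borel (weight j))"
    unfolding joint[symmetric]
    using nn_integral_snd[of "\<lambda>p. F (snd p) (fst p)"] F' by (simp add: sets_eq)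
  also have "\<dots> = (\<integral>\<^sup>+\<omega>. (\<integral>\<^sup>+x. F (weight j \<omega>) x \<partial>distr M borel R) \<partial>M)"
  proof (subst nn_integral_distr)
    have "(\<lambda>y. \<integral>\<^sup>+x. F y x \<partial>distr M borel R) \<in> borel_measurable borel"
      by (rule dR.borel_measurable_nn_integral) (use assms in \<open>simp add: case_prod_beta cong: measurable_cong_sets sets_pair_measure_cong\<close>)
    then show "(\<lambda>y. \<integral>\<^sup>+x. F y x \<partial>distr M borel R) \<in> borel_measurable (distr M borel (weight j))" by simp
  qed auto
  also have "\<dots> = (\<integral>\<^sup>+\<omega>. (\<integral>\<^sup>+\<omega>'. F (weight j \<omega>) (R \<omega>') \<partial>M) \<partial>M)"
  proof (rule nn_integral_cong)
    fix \<omega>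
    have "F (weight j \<omega>) \<in> borel_measurable borel"
      using measurable_compose[OF measurable_Pair1'[of "weight j \<omega>" borel borel] assms] by simp
    then show "(\<integral>\<^sup>+x. F (weight j \<omega>) x \<partial>distr M borel R) = (\<integral>\<^sup>+\<omega>'. F (weight j \<omega>) (R \<omega>') \<partial>M)"
      by (subst nn_integral_distr) auto
  qed
  finally show ?thesis .
qed

text \<open>The tilted law: an index \<open>j\<close> and an outcome \<open>\<omega>\<close> are drawn together, with density the \<open>\<alpha>\<close>-th power of
  the modulus of the \<open>j\<close>-th weight. Its mass is the weight moment of order \<open>\<alpha>\<close>, that is, 1. The step \<open>X\<close>
  of the random walk is the logarithm of the modulus of the selected weight, and \<open>S\<close> is its sign; their
  values at vanishing weights carry no mass.\<close>
definition Q :: "(nat \<times> 'a) measure" where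
  "Q = density (count_space UNIV \<Otimes>\<^sub>M M) (\<lambda>(j, \<omega>). ennreal (\<bar>weight j \<omega>\<bar> powr \<alpha>))"

definition X :: "nat \<times> 'a \<Rightarrow> real" where "X = (\<lambda>(j, \<omega>). ln \<bar>weight j \<omega>\<bar>)"

definition S :: "nat \<times> 'a \<Rightarrow> real" where "S = (\<lambda>(j, \<omega>). if weight j \<omega> < 0 then -1 else 1)"

lemma indexed_measurable:
  fixes f :: "nat \<times> 'a \<Rightarrow> 'b::topological_space"
  assumes "\<And>j. (\<lambda>\<omega>. f (j, \<omega>)) \<in> borel_measurable M"
  shows "f \<in> borel_measurable (count_space UNIV \<Otimes>\<^sub>M M)"
  by (rule measurable_pair_measure_countable1) (use assms in auto)

lemma density_measurable [measurable]:
  "(\<lambda>(j, \<omega>). ennreal (\<bar>weight j \<omega>\<bar> powr \<alpha>)) \<in> borel_measurable (count_space UNIV \<Otimes>\<^sub>M M)"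
  by (rule indexed_measurable) simp

lemma measurable_Q: "f \<in> borel_measurable Q \<longleftrightarrow> f \<in> borel_measurable (count_space UNIV \<Otimes>\<^sub>M M)"
  by (simp add: Q_def)

lemma X_measurable [measurable]: "X \<in> borel_measurable Q"
  unfolding measurable_Q by (rule indexed_measurable) (simp add: X_def)

lemma S_measurable [measurable]: "S \<in> borel_measurable Q"
  unfolding measurable_Q by (rule indexed_measurable) (simp add: S_def)

lemma nn_integral_Q:
  assumes "f \<in> borel_measurable Q"
  shows "(\<integral>\<^sup>+x. f x \<partial>Q) = (\<Sum>j. \<integral>\<^sup>+\<omega>. ennreal (\<bar>weight j \<omega>\<bar> powr \<alpha>) * f (j, \<omega>) \<partial>M)"
proof -
  have f [measurable]: "f \<in> borel_measurable (count_space UNIV \<Otimes>\<^sub>M M)" using assms by (simp add: measurable_Q)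
  have "(\<integral>\<^sup>+x. f x \<partial>Q) = (\<integral>\<^sup>+x. (case x of (j, \<omega>) \<Rightarrow> ennreal (\<bar>weight j \<omega>\<bar> powr \<alpha>)) * f x \<partial>(count_space UNIV \<Otimes>\<^sub>M M))"
    unfolding Q_def by (rule nn_integral_density) measurable
  also have "\<dots> = (\<integral>\<^sup>+j. (\<integral>\<^sup>+\<omega>. ennreal (\<bar>weight j \<omega>\<bar> powr \<alpha>) * f (j, \<omega>) \<partial>M) \<partial>count_space UNIV)"
    by (subst nn_integral_fst[symmetric]) auto
  finally show ?thesis by (simp add: nn_integral_count_space_nat)
qed

lemma nn_integral_Q_sum:
  assumes "f \<in> borel_measurable Q"
  shows "(\<integral>\<^sup>+x. f x \<partial>Q) = (\<integral>\<^sup>+\<omega>. (\<Sum>j. ennreal (\<bar>weight j \<omega>\<bar> powr \<alpha>) * f (j, \<omega>)) \<partial>M)"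
proof -
  have [measurable]: "(\<lambda>\<omega>. f (j, \<omega>)) \<in> borel_measurable M" for j
    using measurable_compose[OF measurable_Pair1'[of j "count_space UNIV" M]] assms
    by (auto simp: measurable_Q)
  show ?thesis unfolding nn_integral_Q[OF assms] by (rule nn_integral_suminf[symmetric]) measurable
qed

lemma prob_space_Q: "prob_space Q"
proof
  have "emeasure Q (space Q) = (\<integral>\<^sup>+x. 1 \<partial>Q)" by simp
  also have "\<dots> = (\<integral>\<^sup>+\<omega>. (\<Sum>j. ennreal (\<bar>weight j \<omega>\<bar> powr \<alpha>)) \<partial>M)"
    by (subst nn_integral_Q_sum) auto
  also have "\<dots> = weight_moment M N C \<alpha>"
    unfolding weight_moment_def
    by (intro nn_integral_cong) (subst sum_upto_eq, use \<alpha>_pos in \<open>auto simp: abs_pow_def\<close>)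
  finally show "emeasure Q (space Q) = 1" by (simp add: weight_moment_one)
qed

lemma AE_Q_component:
  assumes "AE x in Q. P x"
  shows "AE \<omega> in M. weight j \<omega> \<noteq> 0 \<longrightarrow> P (j, \<omega>)"
proof -
  interpret nat: sigma_finite_measure "count_space (UNIV :: nat set)"
    by (rule sigma_finite_measure_count_space)
  interpret pair_sigma_finite "count_space (UNIV :: nat set)" M ..
  have "AE x in count_space UNIV \<Otimes>\<^sub>M M. 0 < (case x of (j, \<omega>) \<Rightarrow> ennreal (\<bar>weight j \<omega>\<bar> powr \<alpha>)) \<longrightarrow> P x"
    using assms unfolding Q_def by (subst (asm) AE_density) auto
  from AE_pair[OF this] have "AE \<omega> in M. 0 < ennreal (\<bar>weight j \<omega>\<bar> powr \<alpha>) \<longrightarrow> P (j, \<omega>)"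
    by (simp add: AE_count_space)
  then show ?thesis by eventually_elim auto
qed

lemma nonarithmetic_Q:
  assumes "d > 0"
  shows "\<not> (AE x in Q. \<exists>k::int. X x = of_int k * d)"
proof
  assume ae: "AE x in Q. \<exists>k::int. X x = of_int k * d"
  have "lattice_measure (log_weight_measure M N C j)" if j: "1 \<le> j" for j
  proof -
    let ?\<Omega> = "{\<omega> \<in> space M. enat j \<le> N \<omega> \<and> \<bar>C j \<omega>\<bar> > 0}"
    have \<Omega>_eq: "?\<Omega> = {\<omega> \<in> space M. weight j \<omega> \<noteq> 0}" using j by (auto simp: weight_def)
    have \<Omega> [measurable]: "?\<Omega> \<in> sets M" unfolding \<Omega>_eq by measurable
    have "(\<lambda>\<omega>. ln \<bar>weight j \<omega>\<bar>) \<in> borel_measurable (restrict_space M ?\<Omega>)"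
      by (rule measurable_restrict_space1) measurable
    then have ln_meas: "(\<lambda>\<omega>. ln \<bar>C j \<omega>\<bar>) \<in> borel_measurable (restrict_space M ?\<Omega>)"
      by (rule measurable_cong[THEN iffD1, rotated]) (use j in \<open>auto simp: space_restrict_space weight_def\<close>)
    have "AE \<omega> in M. \<omega> \<in> ?\<Omega> \<longrightarrow> (\<exists>k::int. ln \<bar>C j \<omega>\<bar> = 0 + of_int k * d)"
      using AE_Q_component[OF ae, of j] by eventually_elim (use j in \<open>auto simp: X_def weight_def\<close>)
    then have ae_restr: "AE \<omega> in restrict_space M ?\<Omega>. \<exists>k::int. ln \<bar>C j \<omega>\<bar> = 0 + of_int k * d"
      by (rule AE_restrict_space_iff[THEN iffD2, rotated]) (rule sets.Int[OF \<Omega> sets.top])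
    have "{u \<in> space borel. \<exists>k::int. u = 0 + of_int k * d} \<in> sets borel" by measurable
    from AE_distr_iff[OF ln_meas this, THEN iffD2, OF ae_restr]
    have "AE u in log_weight_measure M N C j. \<exists>k::int. u = 0 + of_int k * d"
      unfolding log_weight_measure_def .
    then show ?thesis unfolding lattice_measure_def using assms by blast
  qed
  then show False using nonlattice by blast
qed

text \<open>With \<open>\<kappa> = \<alpha> - \<gamma>\<close>, the exponential moment is at most the weight moment of order \<open>\<gamma>\<close>; for \<open>\<gamma> = 0\<close> the
  latter counts the vanishing weights too.\<close>
lemma exp_moment_Q: "\<exists>\<kappa>>0. integrable Q (\<lambda>x. exp (- \<kappa> * X x))"
proof -
  obtain \<gamma> where \<gamma>: "0 \<le> \<gamma>" "\<gamma> < \<alpha>" "weight_moment M N C \<gamma> < \<infinity>" using weight_moment_finite by blast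
  have "(\<integral>\<^sup>+x. ennreal (exp (- (\<alpha> - \<gamma>) * X x)) \<partial>Q)
      = (\<integral>\<^sup>+\<omega>. (\<Sum>j. ennreal (\<bar>weight j \<omega>\<bar> powr \<alpha>) * ennreal (exp (- (\<alpha> - \<gamma>) * X (j, \<omega>)))) \<partial>M)"
    by (rule nn_integral_Q_sum) measurable
  also have "\<dots> \<le> weight_moment M N C \<gamma>"
    unfolding weight_moment_def sum_upto_def
  proof (intro nn_integral_mono suminf_le)
    fix \<omega> j
    show "ennreal (\<bar>weight j \<omega>\<bar> powr \<alpha>) * ennreal (exp (- (\<alpha> - \<gamma>) * X (j, \<omega>)))
        \<le> (if 1 \<le> j \<and> enat j \<le> N \<omega> then ennreal (abs_pow (C j \<omega>) \<gamma>) else 0)"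
    proof (cases "weight j \<omega> = 0")
      case False
      then have j: "1 \<le> j" "enat j \<le> N \<omega>" "weight j \<omega> = C j \<omega>" by (auto simp: weight_def split: if_splits)
      have "\<bar>weight j \<omega>\<bar> powr \<alpha> * exp (- (\<alpha> - \<gamma>) * X (j, \<omega>)) = \<bar>weight j \<omega>\<bar> powr \<gamma>"
        using False by (simp add: powr_def X_def exp_add[symmetric] algebra_simps)
      also have "\<dots> = abs_pow (C j \<omega>) \<gamma>" using False j by (simp add: abs_pow_def)
      finally show ?thesis using j by (simp add: ennreal_mult'[symmetric])
    qed simp
  qed auto
  also have "\<dots> < \<infinity>" by (rule \<gamma>)
  finally have "integrable Q (\<lambda>x. exp (- (\<alpha> - \<gamma>) * X x))"
    by (intro integrableI_nonneg) auto
  then show ?thesis using \<gamma> by (intro exI[of _ "\<alpha> - \<gamma>"]) auto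
qed

lemma neg_part_Q_finite: "(\<integral>\<^sup>+x. ennreal (- X x) \<partial>Q) < \<infinity>"
proof -
  obtain \<kappa> where \<kappa>: "\<kappa> > 0" "integrable Q (\<lambda>x. exp (- \<kappa> * X x))" using exp_moment_Q by blast
  have "(\<integral>\<^sup>+x. ennreal (- X x) \<partial>Q) \<le> (\<integral>\<^sup>+x. ennreal (exp (- \<kappa> * X x) / \<kappa>) \<partial>Q)"
  proof (intro nn_integral_mono ennreal_leI)
    fix x
    have "- \<kappa> * X x \<le> exp (- \<kappa> * X x)" using exp_ge_add_one_self[of "- \<kappa> * X x"] by linarith
    then show "- X x \<le> exp (- \<kappa> * X x) / \<kappa>" using \<kappa>(1) by (simp add: field_simps)
  qed
  also have "\<dots> < \<infinity>"
    using integrableD(2)[of Q "\<lambda>x. exp (- \<kappa> * X x) / \<kappa>"] \<kappa> by (simp add: less_top)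
  finally show ?thesis .
qed

text \<open>Both sides are the mean of \<open>X\<close> under the tilted law. On the left the sum over the weights is formed
  inside the expectation, which makes no difference because its negative terms have a finite total.\<close>
lemma log_moment_eq:
  "log_moment M N C \<alpha> = enn2ereal (\<integral>\<^sup>+x. ennreal (X x) \<partial>Q) - enn2ereal (\<integral>\<^sup>+x. ennreal (- X x) \<partial>Q)"
proof -
  define a where "a j \<omega> = \<bar>weight j \<omega>\<bar> powr \<alpha> * ln \<bar>weight j \<omega>\<bar>" for j \<omega>
  have [measurable]: "a j \<in> borel_measurable M" for j unfolding a_def by measurable
  have int: "(\<integral>\<^sup>+x. ennreal (X x) \<partial>Q) = (\<integral>\<^sup>+\<omega>. (\<Sum>j. ennreal (a j \<omega>)) \<partial>M)"
    "(\<integral>\<^sup>+x. ennreal (- X x) \<partial>Q) = (\<integral>\<^sup>+\<omega>. (\<Sum>j. ennreal (- a j \<omega>)) \<partial>M)"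
    by (subst nn_integral_Q_sum, measurable, simp add: a_def X_def ennreal_mult'[symmetric])+
  have fin: "(\<integral>\<^sup>+\<omega>. (\<Sum>j. ennreal (- a j \<omega>)) \<partial>M) < \<infinity>"
    using neg_part_Q_finite by (simp add: int)
  have "AE \<omega> in M. (\<Sum>j. ennreal (- a j \<omega>)) \<noteq> \<infinity>"
    using fin by (intro nn_integral_noteq_infinite) auto
  then have "AE \<omega> in M. sum_upto (N \<omega>) (\<lambda>j. ereal (\<bar>C j \<omega>\<bar> powr \<alpha> * ln \<bar>C j \<omega>\<bar>))
      = enn2ereal (\<Sum>j. ennreal (a j \<omega>)) - enn2ereal (\<Sum>j. ennreal (- a j \<omega>))"
  proof eventually_elim
    case (elim \<omega>)
    have "sum_upto (N \<omega>) (\<lambda>j. ereal (\<bar>C j \<omega>\<bar> powr \<alpha> * ln \<bar>C j \<omega>\<bar>)) = (\<Sum>j. ereal (a j \<omega>))"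
      unfolding a_def by (rule sum_upto_eq) simp
    then show ?case using suminf_ereal_eq_diff[of "\<lambda>j. a j \<omega>"] elim by (simp add: less_top)
  qed
  from ext_integral_diff[OF _ _ fin this] show ?thesis
    unfolding log_moment_def int by simp
qed

lemma positive_drift_Q: "\<exists>\<kappa>. positive_drift Q X \<kappa>"
proof -
  obtain \<kappa> where \<kappa>: "\<kappa> > 0" "integrable Q (\<lambda>x. exp (- \<kappa> * X x))" using exp_moment_Q by blast
  interpret Q: prob_space Q by (rule prob_space_Q)
  have "(\<integral>\<^sup>+x. ennreal (- X x) \<partial>Q) < (\<integral>\<^sup>+x. ennreal (X x) \<partial>Q)"
    using log_moment_pos neg_part_Q_finite unfolding log_moment_eq
    by (simp add: less_ennreal.rep_eq ereal_minus_less_iff ereal_less_minus_iff)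
  then have "positive_drift Q X \<kappa>"
    by unfold_locales (use \<kappa> nonarithmetic_Q in auto)
  then show ?thesis ..
qed

end

section \<open>The renewal equation for the tails\<close>

context weighted_branching
begin

text \<open>The tail of \<open>s R\<close> on a logarithmic scale, normalised by the expected order \<open>exp (- \<alpha> * u)\<close>.\<close>
definition tail :: "real \<Rightarrow> real \<Rightarrow> real" where
  "tail s u = exp (\<alpha> * u) * prob {\<omega> \<in> space M. s * R \<omega> > exp u}"

lemma prob_eq_integral: "Measurable.pred M P \<Longrightarrow> prob {\<omega> \<in> space M. P \<omega>} = (\<integral>\<omega>. (if P \<omega> then 1 else 0) \<partial>M)"
  by (subst Bochner_Integration.integral_cong[OF refl, of _ _ "indicator {\<omega> \<in> space M. P \<omega>}"]) auto

lemma tail_measurable [measurable]: "tail s \<in> borel_measurable borel"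
proof -
  have "tail s = (\<lambda>u. exp (\<alpha> * u) * (\<integral>\<omega>. (if s * R \<omega> > exp u then 1 else 0) \<partial>M))"
    unfolding tail_def by (subst prob_eq_integral) auto
  also have "\<dots> \<in> borel_measurable borel" by measurable
  finally show ?thesis .
qed

lemma tail_nonneg: "0 \<le> tail s u"
  by (simp add: tail_def)

lemma tail_decr:
  assumes "t \<le> u"
  shows "tail s u \<le> exp (\<alpha> * (u - t)) * tail s t"
proof -
  have "prob {\<omega> \<in> space M. s * R \<omega> > exp u} \<le> prob {\<omega> \<in> space M. s * R \<omega> > exp t}"
  proof (rule finite_measure_mono)
    have "exp t \<le> exp u" using assms by simp
    then show "{\<omega> \<in> space M. s * R \<omega> > exp u} \<subseteq> {\<omega> \<in> space M. s * R \<omega> > exp t}"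
      by (auto intro: le_less_trans)
  qed measurable
  then have "exp (\<alpha> * u) * prob {\<omega> \<in> space M. s * R \<omega> > exp u}
      \<le> exp (\<alpha> * u) * prob {\<omega> \<in> space M. s * R \<omega> > exp t}" by (rule mult_left_mono) simp
  moreover have "exp (\<alpha> * (u - t)) * tail s t = exp (\<alpha> * u) * prob {\<omega> \<in> space M. s * R \<omega> > exp t}"
    unfolding tail_def mult.assoc[symmetric] by (simp add: exp_add[symmetric] right_diff_distrib)
  ultimately show ?thesis unfolding tail_def[of s u] by linarith
qed

lemma tail_growth:
  assumes moment: "\<And>\<beta>. 0 < \<beta> \<Longrightarrow> \<beta> < \<alpha> \<Longrightarrow> (\<integral>\<^sup>+\<omega>. ennreal (max (s * R \<omega>) 0 powr \<beta>) \<partial>M) < \<infinity>"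
    and \<epsilon>: "0 < \<epsilon>" "\<epsilon> < \<alpha>"
  shows "\<exists>K. \<forall>u. tail s u \<le> K * exp (\<epsilon> * u)"
proof -
  define \<beta> where "\<beta> = \<alpha> - \<epsilon>"
  have \<beta>: "0 < \<beta>" "\<beta> < \<alpha>" using \<epsilon> by (auto simp: \<beta>_def)
  have "(\<integral>\<^sup>+\<omega>. ennreal (max (s * R \<omega>) 0 powr \<beta>) \<partial>M) \<noteq> \<infinity>" using moment[OF \<beta>] by simp
  then obtain K where K: "K \<ge> 0" "(\<integral>\<^sup>+\<omega>. ennreal (max (s * R \<omega>) 0 powr \<beta>) \<partial>M) = ennreal K"
    by (rule ennreal_finiteE)
  have "tail s u \<le> K * exp (\<epsilon> * u)" for u
  proof -
    let ?A = "{\<omega> \<in> space M. s * R \<omega> > exp u}"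
    have "ennreal (exp (\<beta> * u) * prob ?A) = (\<integral>\<^sup>+\<omega>. ennreal (exp (\<beta> * u)) * indicator ?A \<omega> \<partial>M)"
      by (subst nn_integral_cmult_indicator) (auto simp: emeasure_eq_measure ennreal_mult)
    also have "\<dots> \<le> (\<integral>\<^sup>+\<omega>. ennreal (max (s * R \<omega>) 0 powr \<beta>) \<partial>M)"
    proof (rule nn_integral_mono)
      fix \<omega>
      have "exp (\<beta> * u) \<le> max (s * R \<omega>) 0 powr \<beta>" if "s * R \<omega> > exp u"
      proof -
        have "exp (\<beta> * u) = exp u powr \<beta>" by (simp add: powr_def)
        also have "\<dots> \<le> max (s * R \<omega>) 0 powr \<beta>" using that \<beta> by (intro powr_mono2) auto
        finally show ?thesis .
      qed
      then show "ennreal (exp (\<beta> * u)) * indicator ?A \<omega> \<le> ennreal (max (s * R \<omega>) 0 powr \<beta>)"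
        by (auto simp: indicator_def intro!: ennreal_leI)
    qed
    finally have "exp (\<beta> * u) * prob ?A \<le> K" using K by simp
    then have "exp (\<epsilon> * u) * (exp (\<beta> * u) * prob ?A) \<le> exp (\<epsilon> * u) * K" by (rule mult_left_mono) simp
    moreover have "exp (\<alpha> * u) = exp (\<epsilon> * u) * exp (\<beta> * u)"
      by (simp add: \<beta>_def exp_add[symmetric] left_diff_distrib)
    ultimately show ?thesis by (simp only: tail_def mult.assoc mult.commute[of K])
  qed
  then show ?thesis by blast
qed

text \<open>The tail of \<open>s R\<close> seen after one step of the random walk; a negative weight exchanges the two tails of \<open>R\<close>.\<close>
definition weighted_tail :: "real \<Rightarrow> real \<Rightarrow> nat \<times> 'a \<Rightarrow> real" where
  "weighted_tail s u x = (if S x = 1 then tail s (u - X x) else tail (- s) (u - X x))"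

lemma weighted_tail_measurable [measurable]: "weighted_tail s u \<in> borel_measurable Q"
  unfolding weighted_tail_def[abs_def] by measurable

lemma weighted_tail_nonneg: "0 \<le> weighted_tail s u x"
  by (simp add: weighted_tail_def tail_nonneg)

definition exceedances :: "real \<Rightarrow> real \<Rightarrow> ennreal" where
  "exceedances s v = (\<integral>\<^sup>+\<omega>. sum_upto (N \<omega>) (\<lambda>j. if s * C j \<omega> * R \<omega> > v then 1 else 0) \<partial>M)"

lemma exceedances_eq:
  assumes "v > 0"
  shows "exceedances s v = (\<Sum>j. \<integral>\<^sup>+\<omega>. (if s * weight j \<omega> * R \<omega> > v then 1 else 0) \<partial>M)"
proof -
  have "sum_upto (N \<omega>) (\<lambda>j. if s * C j \<omega> * R \<omega> > v then 1 else 0 :: ennreal)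
      = (\<Sum>j. if s * weight j \<omega> * R \<omega> > v then 1 else 0)" for \<omega>
    by (rule sum_upto_eq[where F="\<lambda>y. if s * y * R \<omega> > v then 1 else 0"]) (use assms in simp)
  then show ?thesis unfolding exceedances_def by (simp add: nn_integral_suminf)
qed

text \<open>Given the weight \<open>y \<noteq> 0\<close>, the event \<open>s y R > exp u\<close> says that \<open>s (sgn y) R\<close> exceeds \<open>exp (u - ln \<bar>y\<bar>)\<close>. The
  factor \<open>exp (\<alpha> * u)\<close> splits into the density \<open>\<bar>y\<bar> powr \<alpha>\<close> of the tilted law and the normalisation of the
  shifted tail.\<close>
lemma exceedances_weighted_tail:
  assumes s: "s \<in> {1, -1}"
  shows "ennreal (exp (\<alpha> * u)) * exceedances s (exp u) = (\<integral>\<^sup>+x. ennreal (weighted_tail s u x) \<partial>Q)"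
proof -
  have "ennreal (exp (\<alpha> * u)) * (\<integral>\<^sup>+\<omega>. (if s * weight j \<omega> * R \<omega> > exp u then 1 else 0) \<partial>M)
      = (\<integral>\<^sup>+\<omega>. ennreal (\<bar>weight j \<omega>\<bar> powr \<alpha>) * ennreal (weighted_tail s u (j, \<omega>)) \<partial>M)" for j
  proof -
    let ?p = "\<lambda>\<omega>. prob {\<omega>' \<in> space M. s * weight j \<omega> * R \<omega>' > exp u}"
    have "(\<integral>\<^sup>+\<omega>. (if s * weight j \<omega> * R \<omega> > exp u then 1 else 0) \<partial>M)
        = (\<integral>\<^sup>+\<omega>. (\<integral>\<^sup>+\<omega>'. (if s * weight j \<omega> * R \<omega>' > exp u then 1 else 0) \<partial>M) \<partial>M)"
      by (rule nn_integral_weight_R[where F="\<lambda>y z. if s * y * z > exp u then 1 else 0"]) measurable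
    also have "\<dots> = (\<integral>\<^sup>+\<omega>. ennreal (?p \<omega>) \<partial>M)"
    proof (rule nn_integral_cong)
      fix \<omega>
      have "(\<integral>\<^sup>+\<omega>'. (if s * weight j \<omega> * R \<omega>' > exp u then 1 else 0) \<partial>M)
          = (\<integral>\<^sup>+\<omega>'. indicator {\<omega>' \<in> space M. s * weight j \<omega> * R \<omega>' > exp u} \<omega>' \<partial>M)"
        by (intro nn_integral_cong) auto
      also have "\<dots> = emeasure M {\<omega>' \<in> space M. s * weight j \<omega> * R \<omega>' > exp u}"
        by (rule nn_integral_indicator) measurable
      finally show "(\<integral>\<^sup>+\<omega>'. (if s * weight j \<omega> * R \<omega>' > exp u then 1 else 0) \<partial>M)
          = ennreal (?p \<omega>)" by (simp add: emeasure_eq_measure)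
    qed
    also have "ennreal (exp (\<alpha> * u)) * \<dots>
        = (\<integral>\<^sup>+\<omega>. ennreal (exp (\<alpha> * u)) * ennreal (?p \<omega>) \<partial>M)"
    proof (rule nn_integral_cmult[symmetric])
      show "(\<lambda>\<omega>. ennreal (?p \<omega>)) \<in> borel_measurable M"
        by (subst prob_eq_integral) measurable
    qed
    also have "\<dots> = (\<integral>\<^sup>+\<omega>. ennreal (\<bar>weight j \<omega>\<bar> powr \<alpha>) * ennreal (weighted_tail s u (j, \<omega>)) \<partial>M)"
    proof (rule nn_integral_cong)
      fix \<omega>
      show "ennreal (exp (\<alpha> * u)) * ennreal (?p \<omega>)
          = ennreal (\<bar>weight j \<omega>\<bar> powr \<alpha>) * ennreal (weighted_tail s u (j, \<omega>))"
      proof (cases "weight j \<omega> = 0")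
        case True
        then show ?thesis by simp
      next
        case False
        define e where "e = (if weight j \<omega> < 0 then -1 else 1 :: real)"
        have "exp u < s * weight j \<omega> * y \<longleftrightarrow> exp (u - ln \<bar>weight j \<omega>\<bar>) < (s * e) * y" for y
        proof -
          have y: "s * weight j \<omega> * y = ((s * e) * y) * \<bar>weight j \<omega>\<bar>" by (simp add: e_def)
          have "exp (u - ln \<bar>weight j \<omega>\<bar>) = exp u / \<bar>weight j \<omega>\<bar>" using False by (simp add: exp_diff)
          then show ?thesis unfolding y using False by (simp add: pos_divide_less_eq)
        qed
        then have "?p \<omega>
            = prob {\<omega>' \<in> space M. (s * e) * R \<omega>' > exp (u - ln \<bar>weight j \<omega>\<bar>)}" by simp
        moreover have "\<bar>weight j \<omega>\<bar> powr \<alpha> * exp (\<alpha> * (u - ln \<bar>weight j \<omega>\<bar>)) = exp (\<alpha> * u)"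
          using False by (simp add: powr_def exp_add[symmetric] algebra_simps)
        moreover have "weighted_tail s u (j, \<omega>) = tail (s * e) (u - ln \<bar>weight j \<omega>\<bar>)"
          by (simp add: weighted_tail_def S_def X_def e_def)
        ultimately have "exp (\<alpha> * u) * ?p \<omega>
            = \<bar>weight j \<omega>\<bar> powr \<alpha> * weighted_tail s u (j, \<omega>)" by (simp add: tail_def mult.assoc[symmetric])
        then show ?thesis by (simp add: ennreal_mult'[symmetric])
      qed
    qed
    finally show ?thesis .
  qed
  then show ?thesis
    by (subst nn_integral_Q) (simp_all add: exceedances_eq flip: ennreal_suminf_cmult)
qed

text \<open>The inhomogeneous term of the renewal equation, which is \<open>exp (\<alpha> * u)\<close> times the difference of tails
  at \<open>exp u\<close>.\<close>
definition defect :: "real \<Rightarrow> real \<Rightarrow> real" where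
  "defect s u = tail s u - (\<integral>x. weighted_tail s u x \<partial>Q)"

lemma defect_measurable [measurable]: "defect s \<in> borel_measurable borel"
proof -
  interpret Q: prob_space Q by (rule prob_space_Q)
  show ?thesis unfolding defect_def[abs_def] weighted_tail_def[abs_def] by measurable
qed

context
  fixes s :: real
  assumes s: "s \<in> {1, -1}" and int: "\<And>u. integrable Q (weighted_tail s u)"
begin

lemma exceedances_real:
  assumes "v > 0"
  shows "exceedances s v = ennreal (v powr (- \<alpha>) * (\<integral>x. weighted_tail s (ln v) x \<partial>Q))"
proof -
  have "ennreal (v powr \<alpha>) * exceedances s v = (\<integral>\<^sup>+x. ennreal (weighted_tail s (ln v) x) \<partial>Q)"
    using exceedances_weighted_tail[OF s, of "ln v"] assms by (simp add: powr_def)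
  also have "\<dots> = ennreal (\<integral>x. weighted_tail s (ln v) x \<partial>Q)"
    by (intro nn_integral_eq_integral int AE_I2 weighted_tail_nonneg)
  finally have "ennreal (v powr (- \<alpha>)) * (ennreal (v powr \<alpha>) * exceedances s v)
      = ennreal (v powr (- \<alpha>)) * ennreal (\<integral>x. weighted_tail s (ln v) x \<partial>Q)" by simp
  moreover have "ennreal (v powr (- \<alpha>)) * ennreal (v powr \<alpha>) = 1"
    using assms by (simp add: ennreal_mult'[symmetric] powr_add[symmetric])
  ultimately show ?thesis by (simp add: mult.assoc[symmetric] ennreal_mult')
qed

lemma tail_diff_eq:
  assumes "v > 0"
  shows "tail_diff M N (\<lambda>\<omega>. s * R \<omega>) (\<lambda>j \<omega>. s * C j \<omega> * R \<omega>) v = ereal (v powr (- \<alpha>) * defect s (ln v))"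
proof -
  have nonneg: "0 \<le> (\<integral>x. weighted_tail s (ln v) x \<partial>Q)"
    by (intro integral_nonneg_AE AE_I2 weighted_tail_nonneg)
  have "v powr (- \<alpha>) * tail s (ln v) = prob {\<omega> \<in> space M. s * R \<omega> > v}"
    using assms by (simp add: tail_def powr_def mult.assoc[symmetric] exp_add[symmetric])
  then have "v powr (- \<alpha>) * defect s (ln v) = prob {\<omega> \<in> space M. s * R \<omega> > v}
      - v powr (- \<alpha>) * (\<integral>x. weighted_tail s (ln v) x \<partial>Q)"
    by (simp add: defect_def right_diff_distrib)
  then show ?thesis
    unfolding tail_diff_def exceedances_def[symmetric] exceedances_real[OF assms] using nonneg by simp
qed

lemma defect_integrable:
  assumes "tail_diff_integrable M \<alpha> N (\<lambda>\<omega>. s * R \<omega>) (\<lambda>j \<omega>. s * C j \<omega> * R \<omega>)"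
  shows "integrable lborel (defect s)"
    and "tail_diff_integral M \<alpha> N (\<lambda>\<omega>. s * R \<omega>) (\<lambda>j \<omega>. s * C j \<omega> * R \<omega>) = ereal (\<integral>u. defect s u \<partial>lborel)"
  using tail_diff_logarithmic_scale[OF defect_measurable tail_diff_eq] assms by blast+

end

text \<open>For \<open>v > 0\<close> the event \<open>\<bar>Y\<bar> > v\<close> is the disjoint union of \<open>Y > v\<close> and \<open>- Y > v\<close>.\<close>
lemma tail_diff_integral_abs:
  assumes int: "\<And>u. integrable Q (weighted_tail 1 u)" "\<And>u. integrable Q (weighted_tail (-1) u)"
    and defect: "integrable lborel (defect 1)" "integrable lborel (defect (-1))"
  shows "tail_diff_integral M \<alpha> N (\<lambda>\<omega>. \<bar>R \<omega>\<bar>) (\<lambda>j \<omega>. \<bar>C j \<omega> * R \<omega>\<bar>)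
    = ereal ((\<integral>u. defect 1 u \<partial>lborel) + (\<integral>u. defect (-1) u \<partial>lborel))"
proof -
  let ?T = "tail_diff M N (\<lambda>\<omega>. \<bar>R \<omega>\<bar>) (\<lambda>j \<omega>. \<bar>C j \<omega> * R \<omega>\<bar>)"
  have T: "?T v = ereal (v powr (- \<alpha>) * (defect 1 (ln v) + defect (-1) (ln v)))" if "v > 0" for v
  proof -
    let ?e = "\<lambda>s j \<omega>. if s * weight j \<omega> * R \<omega> > v then 1 else 0 :: ennreal"
    have "prob {\<omega> \<in> space M. \<bar>R \<omega>\<bar> > v}
        = prob ({\<omega> \<in> space M. 1 * R \<omega> > v} \<union> {\<omega> \<in> space M. - 1 * R \<omega> > v})"
      by (rule arg_cong[where f=prob]) auto
    also have "\<dots> = prob {\<omega> \<in> space M. 1 * R \<omega> > v} + prob {\<omega> \<in> space M. - 1 * R \<omega> > v}"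
      by (rule finite_measure_Union) (use that in auto)
    finally have P: "prob {\<omega> \<in> space M. \<bar>R \<omega>\<bar> > v}
        = prob {\<omega> \<in> space M. 1 * R \<omega> > v} + prob {\<omega> \<in> space M. - 1 * R \<omega> > v}" .
    have "(\<integral>\<^sup>+\<omega>. sum_upto (N \<omega>) (\<lambda>j. if \<bar>C j \<omega> * R \<omega>\<bar> > v then 1 else 0) \<partial>M)
        = (\<integral>\<^sup>+\<omega>. (\<Sum>j. if \<bar>weight j \<omega> * R \<omega>\<bar> > v then 1 else 0) \<partial>M)"
      by (intro nn_integral_cong sum_upto_eq[where F="\<lambda>y. if \<bar>y * R \<omega>\<bar> > v then 1 else 0" for \<omega>]) (use that in simp)
    also have "\<dots> = (\<Sum>j. \<integral>\<^sup>+\<omega>. (if \<bar>weight j \<omega> * R \<omega>\<bar> > v then 1 else 0) \<partial>M)"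
      by (rule nn_integral_suminf) measurable
    also have "\<dots> = (\<Sum>j. (\<integral>\<^sup>+\<omega>. ?e 1 j \<omega> \<partial>M) + (\<integral>\<^sup>+\<omega>. ?e (- 1) j \<omega> \<partial>M))"
    proof (rule arg_cong[where f=suminf], rule ext)
      fix j
      have "(\<integral>\<^sup>+\<omega>. (if \<bar>weight j \<omega> * R \<omega>\<bar> > v then 1 else 0) \<partial>M) = (\<integral>\<^sup>+\<omega>. ?e 1 j \<omega> + ?e (- 1) j \<omega> \<partial>M)"
        using that by (intro nn_integral_cong) (auto simp: abs_if)
      also have "\<dots> = (\<integral>\<^sup>+\<omega>. ?e 1 j \<omega> \<partial>M) + (\<integral>\<^sup>+\<omega>. ?e (- 1) j \<omega> \<partial>M)" by (rule nn_integral_add) measurable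
      finally show "(\<integral>\<^sup>+\<omega>. (if \<bar>weight j \<omega> * R \<omega>\<bar> > v then 1 else 0) \<partial>M)
          = (\<integral>\<^sup>+\<omega>. ?e 1 j \<omega> \<partial>M) + (\<integral>\<^sup>+\<omega>. ?e (- 1) j \<omega> \<partial>M)" .
    qed
    also have "\<dots> = exceedances 1 v + exceedances (-1) v"
      unfolding exceedances_eq[OF that] by (rule suminf_add[symmetric]) simp_all
    finally have E: "(\<integral>\<^sup>+\<omega>. sum_upto (N \<omega>) (\<lambda>j. if \<bar>C j \<omega> * R \<omega>\<bar> > v then 1 else 0) \<partial>M)
        = exceedances 1 v + exceedances (-1) v" .
    have nonneg: "0 \<le> (\<integral>x. weighted_tail s (ln v) x \<partial>Q)" for s
      by (intro integral_nonneg_AE AE_I2 weighted_tail_nonneg)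
    have "?T v = tail_diff M N (\<lambda>\<omega>. 1 * R \<omega>) (\<lambda>j \<omega>. 1 * C j \<omega> * R \<omega>) v
        + tail_diff M N (\<lambda>\<omega>. - 1 * R \<omega>) (\<lambda>j \<omega>. - 1 * C j \<omega> * R \<omega>) v"
      unfolding tail_diff_def E P exceedances_def[of 1 v, symmetric] exceedances_def[of "-1" v, symmetric]
        exceedances_real[OF _ int(1) that, simplified] exceedances_real[OF _ int(2) that, simplified]
      using nonneg by (simp add: ennreal_plus[symmetric] del: ennreal_plus)
    also have "\<dots> = ereal (v powr (- \<alpha>) * (defect 1 (ln v) + defect (-1) (ln v)))"
      using tail_diff_eq[OF _ int(1) that] tail_diff_eq[OF _ int(2) that] by (simp add: distrib_left)
    finally show ?thesis .
  qed
  have "integrable lborel (\<lambda>u. defect 1 u + defect (-1) u)" using defect by auto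
  from tail_diff_logarithmic_scale(2)[OF _ T this] show ?thesis using defect by simp
qed

lemma power_tail_of_limit:
  assumes "(tail s \<longlongrightarrow> L) at_top"
  shows "power_tail (\<lambda>t. prob {\<omega> \<in> space M. s * R \<omega> > t}) (ereal L) \<alpha>"
  unfolding power_tail_def lim_ereal
proof (rule Lim_transform_eventually[OF filterlim_compose[OF assms ln_at_top]])
  show "\<forall>\<^sub>F t in at_top. tail s (ln t) = t powr \<alpha> * prob {\<omega> \<in> space M. s * R \<omega> > t}"
    using eventually_gt_at_top[of 0] by eventually_elim (simp add: tail_def powr_def)
qed

lemma inverse_log_moment:
  assumes "positive_drift Q X \<kappa>"
  shows "1 / log_moment M N C \<alpha> = ereal (positive_drift.rate Q X)"
    and "1 / (2 * log_moment M N C \<alpha>) = ereal (positive_drift.rate Q X / 2)"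
proof -
  interpret D: positive_drift Q X \<kappa> by fact
  have "1 / log_moment M N C \<alpha> = ereal D.rate \<and> 1 / (2 * log_moment M N C \<alpha>) = ereal (D.rate / 2)"
  proof (cases "integrable Q X")
    case True
    have "log_moment M N C \<alpha> = ereal (\<integral>x. X x \<partial>Q)"
      using ext_integral_real[OF True] by (simp add: ext_integral_def log_moment_eq)
    then show ?thesis using D.mean_pos[OF True] by (simp add: D.rate_def True one_ereal_def)
  next
    case False
    have "(\<integral>\<^sup>+x. ennreal (X x) \<partial>Q) = \<infinity>"
    proof (rule ccontr)
      assume "\<not> ?thesis"
      then have "integrable Q X" using neg_part_Q_finite by (subst real_integrable_def) auto
      with False show False ..
    qed
    then have "log_moment M N C \<alpha> = \<infinity>"
      using neg_part_Q_finite unfolding log_moment_eq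
      by (cases "\<integral>\<^sup>+x. ennreal (- X x) \<partial>Q") auto
    then show ?thesis by (simp add: D.rate_def False zero_ereal_def)
  qed
  then show "1 / log_moment M N C \<alpha> = ereal D.rate" "1 / (2 * log_moment M N C \<alpha>) = ereal (D.rate / 2)" by auto
qed

text \<open>Nonnegative weights never exchange the two tails, so each tail solves a renewal equation of its own.\<close>
lemma tail_limit_nonneg_weights:
  assumes s: "s \<in> {1, -1}"
    and nonneg: "AE \<omega> in M. \<forall>i\<ge>1. enat i \<le> N \<omega> \<longrightarrow> C i \<omega> \<ge> 0"
    and moment: "\<And>\<beta>. 0 < \<beta> \<Longrightarrow> \<beta> < \<alpha> \<Longrightarrow> (\<integral>\<^sup>+\<omega>. ennreal (max (s * R \<omega>) 0 powr \<beta>) \<partial>M) < \<infinity>"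
    and conv: "tail_diff_integrable M \<alpha> N (\<lambda>\<omega>. s * R \<omega>) (\<lambda>j \<omega>. s * C j \<omega> * R \<omega>)"
  shows "power_tail (\<lambda>t. prob {\<omega> \<in> space M. s * R \<omega> > t}) (H_const M \<alpha> N C R s) \<alpha>"
    and "0 \<le> H_const M \<alpha> N C R s" and "H_const M \<alpha> N C R s < \<infinity>"
proof -
  obtain \<kappa> where D: "positive_drift Q X \<kappa>" using positive_drift_Q by blast
  then interpret D: positive_drift Q X \<kappa> .
  have S_one: "AE x in Q. S x = 1"
  proof -
    have "AE x in count_space UNIV \<Otimes>\<^sub>M M. S x = 1"
    proof -
      interpret nat: sigma_finite_measure "count_space (UNIV :: nat set)"
        by (rule sigma_finite_measure_count_space)
      interpret pair_sigma_finite "count_space (UNIV :: nat set)" M ..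
      have "AE \<omega> in M. S (j, \<omega>) = 1" for j
        using nonneg by eventually_elim (auto simp: S_def weight_def)
      moreover have "{x \<in> space (count_space UNIV \<Otimes>\<^sub>M M). S x = 1} \<in> sets (count_space UNIV \<Otimes>\<^sub>M M)"
        using S_measurable unfolding measurable_Q by measurable
      ultimately show ?thesis by (intro AE_pair_measure) (auto simp: AE_count_space)
    qed
    then show ?thesis unfolding Q_def by (subst AE_density) auto
  qed
  obtain \<epsilon> where \<epsilon>: "\<epsilon> > 0" "\<epsilon> < \<alpha>" "(\<integral>\<^sup>+x. ennreal (exp (- \<epsilon> * X x)) \<partial>Q) < 1"
    using D.ex_exponent[OF \<alpha>_pos] by blast
  then have fin: "(\<integral>\<^sup>+x. ennreal (exp (- \<epsilon> * X x)) \<partial>Q) < \<infinity>" by (auto intro: less_trans)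
  obtain K where K: "\<And>u. tail s u \<le> K * exp (\<epsilon> * u)" using tail_growth[OF moment \<epsilon>(1,2)] by blast
  have "K \<ge> 0" using K[of 0] tail_nonneg[of s 0] by simp
  have wt: "AE x in Q. weighted_tail s u x = tail s (u - X x)" for u
    using S_one by eventually_elim (simp add: weighted_tail_def)
  have tr_int: "integrable Q (\<lambda>x. tail s (u - X x))" for u
    by (rule D.translate_integrable_of_growth[where c=K and t=u, OF _ _ \<open>K \<ge> 0\<close> fin])
      (use K tail_nonneg in auto)
  have int: "integrable Q (weighted_tail s u)" for u
    using tr_int[of u] by (subst integrable_cong_AE[OF _ _ wt]) auto
  have eq: "tail s u = defect s u + (\<integral>x. tail s (u - X x) \<partial>Q)" for u
  proof -
    have "(\<integral>x. weighted_tail s u x \<partial>Q) = (\<integral>x. tail s (u - X x) \<partial>Q)"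
      by (rule integral_cong_AE[OF _ _ wt]) auto
    then show ?thesis by (simp add: defect_def)
  qed
  define L where "L = D.rate * (\<integral>u. defect s u \<partial>lborel)"
  have lim: "(tail s \<longlongrightarrow> L) at_top"
    unfolding L_def
    by (rule D.renewal_limit(1)[OF tail_measurable tail_nonneg tail_decr \<alpha>_pos _ defect_integrable(1)[OF s int conv] eq])
      (use tail_growth[OF moment] in auto)
  have H: "H_const M \<alpha> N C R s = ereal L"
    unfolding H_const_def defect_integrable(2)[OF s int conv] inverse_log_moment(1)[OF D] L_def by simp
  show "power_tail (\<lambda>t. prob {\<omega> \<in> space M. s * R \<omega> > t}) (H_const M \<alpha> N C R s) \<alpha>"
    unfolding H by (rule power_tail_of_limit[OF lim])
  have "0 \<le> L" by (rule tendsto_lowerbound[OF lim]) (auto simp: tail_nonneg)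
  then show "0 \<le> H_const M \<alpha> N C R s" "H_const M \<alpha> N C R s < \<infinity>" by (auto simp: H)
qed

text \<open>A weight that is negative with positive probability gives the sign \<open>-1\<close> positive mass under the tilted
  law, so the two tails are coupled and the signed renewal theorem applies.\<close>
lemma tail_limit_signed_weights:
  assumes neg: "\<exists>j\<ge>1. measure M {\<omega> \<in> space M. enat j \<le> N \<omega> \<and> C j \<omega> < 0} > 0"
    and moment: "\<And>\<beta>. 0 < \<beta> \<Longrightarrow> \<beta> < \<alpha> \<Longrightarrow> (\<integral>\<^sup>+\<omega>. ennreal (\<bar>R \<omega>\<bar> powr \<beta>) \<partial>M) < \<infinity>"
    and conv: "tail_diff_integrable M \<alpha> N (\<lambda>\<omega>. 1 * R \<omega>) (\<lambda>j \<omega>. 1 * C j \<omega> * R \<omega>)"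
      "tail_diff_integrable M \<alpha> N (\<lambda>\<omega>. - 1 * R \<omega>) (\<lambda>j \<omega>. - 1 * C j \<omega> * R \<omega>)"
  shows "power_tail (\<lambda>t. prob {\<omega> \<in> space M. 1 * R \<omega> > t}) (H_abs M \<alpha> N C R) \<alpha>"
    and "power_tail (\<lambda>t. prob {\<omega> \<in> space M. - 1 * R \<omega> > t}) (H_abs M \<alpha> N C R) \<alpha>"
    and "H_abs M \<alpha> N C R = (H_const M \<alpha> N C R 1 + H_const M \<alpha> N C R (- 1)) / 2"
    and "0 \<le> H_abs M \<alpha> N C R" and "H_abs M \<alpha> N C R < \<infinity>"
proof -
  obtain \<kappa> where D: "positive_drift Q X \<kappa>" using positive_drift_Q by blast
  then interpret D: positive_drift Q X \<kappa> .
  have S_neg: "\<not> (AE x in Q. S x = 1)"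
  proof
    assume ae: "AE x in Q. S x = 1"
    obtain j where j: "1 \<le> j" "measure M {\<omega> \<in> space M. enat j \<le> N \<omega> \<and> C j \<omega> < 0} > 0" using neg by blast
    have "AE \<omega> in M. \<not> (enat j \<le> N \<omega> \<and> C j \<omega> < 0)"
      using AE_Q_component[OF ae, of j] by eventually_elim (use j(1) in \<open>auto simp: S_def weight_def split: if_splits\<close>)
    then have "prob {\<omega> \<in> space M. enat j \<le> N \<omega> \<and> C j \<omega> < 0} = 0"
      by (rule prob_eq_0_AE)
    with j(2) show False by simp
  qed
  have growth: "\<exists>K. \<forall>u. tail s u \<le> K * exp (\<epsilon> * u)" if s: "s \<in> {1, -1}" and \<epsilon>: "0 < \<epsilon>" "\<epsilon> < \<alpha>" for s \<epsilon>
  proof (rule tail_growth[OF _ \<epsilon>])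
    fix \<beta> assume \<beta>: "0 < \<beta>" "\<beta> < \<alpha>"
    have "(\<integral>\<^sup>+\<omega>. ennreal (max (s * R \<omega>) 0 powr \<beta>) \<partial>M) \<le> (\<integral>\<^sup>+\<omega>. ennreal (\<bar>R \<omega>\<bar> powr \<beta>) \<partial>M)"
      using s \<beta> by (intro nn_integral_mono ennreal_leI powr_mono2) auto
    also have "\<dots> < \<infinity>" by (rule moment[OF \<beta>])
    finally show "(\<integral>\<^sup>+\<omega>. ennreal (max (s * R \<omega>) 0 powr \<beta>) \<partial>M) < \<infinity>" .
  qed
  have growth_sum: "\<exists>K. \<forall>u. tail 1 u + tail (-1) u \<le> K * exp (\<epsilon> * u)" if \<epsilon>: "0 < \<epsilon>" "\<epsilon> < \<alpha>" for \<epsilon>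
  proof -
    obtain K1 K2 where "\<And>u. tail 1 u \<le> K1 * exp (\<epsilon> * u)" "\<And>u. tail (-1) u \<le> K2 * exp (\<epsilon> * u)"
      using growth[OF _ \<epsilon>, of 1] growth[OF _ \<epsilon>, of "-1"] by auto
    then have "tail 1 u + tail (-1) u \<le> (K1 + K2) * exp (\<epsilon> * u)" for u
      by (simp add: distrib_right add_mono)
    then show ?thesis by blast
  qed
  have int: "integrable Q (weighted_tail s u)" if s: "s \<in> {1, -1}" for s u
  proof -
    obtain \<epsilon> where \<epsilon>: "\<epsilon> > 0" "\<epsilon> < \<alpha>" "(\<integral>\<^sup>+x. ennreal (exp (- \<epsilon> * X x)) \<partial>Q) < 1"
      using D.ex_exponent[OF \<alpha>_pos] by blast
    then have fin: "(\<integral>\<^sup>+x. ennreal (exp (- \<epsilon> * X x)) \<partial>Q) < \<infinity>" by (auto intro: less_trans)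
    obtain K where K: "\<And>u. tail 1 u + tail (-1) u \<le> K * exp (\<epsilon> * u)" using growth_sum[OF \<epsilon>(1,2)] by blast
    have "K \<ge> 0" using K[of 0] tail_nonneg[of 1 0] tail_nonneg[of "-1" 0] by simp
    have "\<bar>weighted_tail s u x\<bar> \<le> K * exp (\<epsilon> * (u - X x))" for x
      using K[of "u - X x"] s tail_nonneg[of 1 "u - X x"] tail_nonneg[of "-1" "u - X x"]
      by (auto simp: weighted_tail_def)
    then show ?thesis
      by (intro D.translate_integrable_of_growth[where c=K and t=u, OF _ _ \<open>K \<ge> 0\<close> fin]) auto
  qed
  have int1: "integrable Q (weighted_tail 1 u)" and int2: "integrable Q (weighted_tail (-1) u)" for u
    by (rule int; simp)+
  have s1: "1 \<in> {1, -1 :: real}" and s2: "-1 \<in> {1, -1 :: real}" by auto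
  note d1 = defect_integrable[OF s1 int1 conv(1)] and d2 = defect_integrable[OF s2 int2 conv(2)]
  have eq1: "tail 1 u = defect 1 u + (\<integral>x. (if S x = 1 then tail 1 (u - X x) else tail (-1) (u - X x)) \<partial>Q)" for u
    by (simp add: defect_def weighted_tail_def)
  have eq2: "tail (-1) u = defect (-1) u + (\<integral>x. (if S x = 1 then tail (-1) (u - X x) else tail 1 (u - X x)) \<partial>Q)" for u
    by (simp add: defect_def weighted_tail_def cong: if_cong)
  have S_cases: "S x \<in> {1, -1}" for x by (cases x) (auto simp: S_def)
  define L where "L = D.rate * ((\<integral>u. defect 1 u \<partial>lborel) + (\<integral>u. defect (-1) u \<partial>lborel)) / 2"
  note lim = D.signed_renewal_limit[OF S_measurable S_cases S_neg tail_measurable tail_measurable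
      tail_nonneg tail_nonneg tail_decr tail_decr \<alpha>_pos growth_sum d1(1) d2(1) eq1 eq2, folded L_def]
  have H: "H_abs M \<alpha> N C R = ereal L"
    unfolding H_abs_def tail_diff_integral_abs[OF int1 int2 d1(1) d2(1)] inverse_log_moment(2)[OF D] L_def by simp
  have "H_const M \<alpha> N C R 1 = ereal (D.rate * (\<integral>u. defect 1 u \<partial>lborel))"
    "H_const M \<alpha> N C R (- 1) = ereal (D.rate * (\<integral>u. defect (-1) u \<partial>lborel))"
    unfolding H_const_def d1(2) d2(2) inverse_log_moment(1)[OF D] by simp_all
  then show "H_abs M \<alpha> N C R = (H_const M \<alpha> N C R 1 + H_const M \<alpha> N C R (- 1)) / 2"
    by (simp add: H L_def distrib_left)
  show "power_tail (\<lambda>t. prob {\<omega> \<in> space M. 1 * R \<omega> > t}) (H_abs M \<alpha> N C R) \<alpha>"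
    unfolding H by (rule power_tail_of_limit[OF lim(1)])
  show "power_tail (\<lambda>t. prob {\<omega> \<in> space M. - 1 * R \<omega> > t}) (H_abs M \<alpha> N C R) \<alpha>"
    unfolding H by (rule power_tail_of_limit[OF lim(2)])
  have "0 \<le> L" by (rule tendsto_lowerbound[OF lim(1)]) (auto simp: tail_nonneg)
  then show "0 \<le> H_abs M \<alpha> N C R" "H_abs M \<alpha> N C R < \<infinity>" by (auto simp: H)
qed

end

section \<open>Power tails for the fixed-point equation\<close>

theorem theorem3p4:
  fixes M :: "'a measure"
    and \<alpha> :: real
    and N :: "'a \<Rightarrow> enat"
    and C :: "nat \<Rightarrow> 'a \<Rightarrow> real"
    and R :: "'a \<Rightarrow> real"
  assumes "prob_space M"
    and "\<alpha> > 0"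
    and "weight_vector N C \<in> M \<rightarrow>\<^sub>M weight_space"
    and "\<exists>j\<ge>1. measure M {\<omega> \<in> space M. enat j \<le> N \<omega> \<and> \<bar>C j \<omega>\<bar> > 0} > 0
                \<and> \<not> lattice_measure (log_weight_measure M N C j)"
    and "log_moment M N C \<alpha> > 0"
    and "weight_moment M N C \<alpha> = 1"
    and "\<exists>\<gamma>. 0 \<le> \<gamma> \<and> \<gamma> < \<alpha> \<and> weight_moment M N C \<gamma> < \<infinity>"
    and "R \<in> borel_measurable M"
    and "indep_of_weights M N C R"
  shows
    "((AE \<omega> in M. \<forall>i\<ge>1. enat i \<le> N \<omega> \<longrightarrow> C i \<omega> \<ge> 0) \<longrightarrow>
        ((\<forall>\<beta>. 0 < \<beta> \<and> \<beta> < \<alpha> \<longrightarrow> (\<integral>\<^sup>+\<omega>. ennreal (max (R \<omega>) 0 powr \<beta>) \<partial>M) < \<infinity>)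
         \<and> tail_diff_integrable M \<alpha> N R (\<lambda>j \<omega>. C j \<omega> * R \<omega>)
         \<longrightarrow> power_tail (\<lambda>t. measure M {\<omega> \<in> space M. R \<omega> > t}) (H_const M \<alpha> N C R 1) \<alpha>
             \<and> 0 \<le> H_const M \<alpha> N C R 1 \<and> H_const M \<alpha> N C R 1 < \<infinity>)
      \<and> ((\<forall>\<beta>. 0 < \<beta> \<and> \<beta> < \<alpha> \<longrightarrow> (\<integral>\<^sup>+\<omega>. ennreal (max (- R \<omega>) 0 powr \<beta>) \<partial>M) < \<infinity>)
         \<and> tail_diff_integrable M \<alpha> N (\<lambda>\<omega>. - R \<omega>) (\<lambda>j \<omega>. - (C j \<omega> * R \<omega>))
         \<longrightarrow> power_tail (\<lambda>t. measure M {\<omega> \<in> space M. R \<omega> < - t}) (H_const M \<alpha> N C R (- 1)) \<alpha>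
             \<and> 0 \<le> H_const M \<alpha> N C R (- 1) \<and> H_const M \<alpha> N C R (- 1) < \<infinity>))
   \<and> ((\<exists>j\<ge>1. measure M {\<omega> \<in> space M. enat j \<le> N \<omega> \<and> C j \<omega> < 0} > 0)
      \<and> (\<forall>\<beta>. 0 < \<beta> \<and> \<beta> < \<alpha> \<longrightarrow> (\<integral>\<^sup>+\<omega>. ennreal (\<bar>R \<omega>\<bar> powr \<beta>) \<partial>M) < \<infinity>)
      \<and> tail_diff_integrable M \<alpha> N R (\<lambda>j \<omega>. C j \<omega> * R \<omega>)
      \<and> tail_diff_integrable M \<alpha> N (\<lambda>\<omega>. - R \<omega>) (\<lambda>j \<omega>. - (C j \<omega> * R \<omega>))
      \<longrightarrow> power_tail (\<lambda>t. measure M {\<omega> \<in> space M. R \<omega> > t}) (H_abs M \<alpha> N C R) \<alpha>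
          \<and> power_tail (\<lambda>t. measure M {\<omega> \<in> space M. R \<omega> < - t}) (H_abs M \<alpha> N C R) \<alpha>
          \<and> H_abs M \<alpha> N C R = (H_const M \<alpha> N C R 1 + H_const M \<alpha> N C R (- 1)) / 2
          \<and> 0 \<le> H_abs M \<alpha> N C R \<and> H_abs M \<alpha> N C R < \<infinity>)"
proof -
  interpret W: weighted_branching M \<alpha> N C R
    by (intro weighted_branching.intro weighted_branching_axioms.intro) (use assms in auto)
  have minus: "(\<lambda>\<omega>. - 1 * R \<omega>) = (\<lambda>\<omega>. - R \<omega>)"
    "(\<lambda>j \<omega>. - 1 * C j \<omega> * R \<omega>) = (\<lambda>j \<omega>. - (C j \<omega> * R \<omega>))" by auto
  have minus_tail: "{\<omega> \<in> space M. R \<omega> < - t} = {\<omega> \<in> space M. - 1 * R \<omega> > t}" for t by auto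
  note pos = W.tail_limit_nonneg_weights[of 1, unfolded mult_1]
  note neg = W.tail_limit_nonneg_weights[of "-1", unfolded minus]
  note signed = W.tail_limit_signed_weights[unfolded mult_1 minus]
  show ?thesis
    unfolding minus_tail
    by (intro conjI impI; elim conjE; (rule pos neg signed); simp)
qed

end
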